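(* For each level $j\in\mathbb{Z}$ let $\beta_n^j\in\mathbb{C}$ ($-N_j\le n\le N_j$) be angular localization coefficients, let $M_j\ge1$ be the number of orientations, put $\beta_n^{j,t}=\beta_n^j\,e^{-int(2\pi/M_j)}$ for $t=1,\dots,M_j$, and let $U_j$ be the $M_j\times(2N_j+1)$ matrix formed by the coefficients $\beta_n^{j,t}$ for the $M_j$ different orientations. Let $D_j$ be a diagonal matrix of size $(2N_j+1)\times(2N_j+1)$. When the Calderón admissibility condition $$\sum_{j\in\mathbb{Z}}\big|\hat h(2^{-j}|\xi|)\big|^2=1\qquad\text{for all }\xi\in\mathbb{R}^2\setminus\{0\}$$ is satisfied for the radial window $\hat h$, and $U_j^HU_j=D_j$ with $\mathrm{tr}(D_j)=1$ for all levels $j$, then any divergence free vector field $\vec u\in L_2^{\mathrm{div}}(\mathbb{R}^{2,2})$ has the representation $$\vec u(x)=\sum_{j\in\mathbb{Z}}\sum_{k\in\mathbb{Z}^2}\sum_{t=1}^{M_j}\big\langle\vec u(y),\vec\psi_{j,k,t}(y)\big\rangle\,\vec\psi_{j,k,t}(x)$$ with frame functions $$\vec\psi_{j,k,t}(x)=\frac{2^j}{2\pi}\,\vec\psi^{\,j,t}(2^jx-k),$$ where $\vec\psi^{\,j,t}$ is the divergence free polar wavelet with angular coefficients $(\beta_n^{j,t})_n$ (that is, with the level-$j$ angular window rotated by $2\pi t/M_j$) and radial window $\hat h$, as defined in the context.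
   Context: The Fourier transform on $\mathbb{R}^n$ is unitary: $\hat f(\xi)=(2\pi)^{-n/2}\int_{\mathbb{R}^n}f(x)e^{-i\langle x,\xi\rangle}dx$, applied componentwise to vector fields. $L_2^{\mathrm{div}}(\mathbb{R}^{2,2})$ is the space of divergence free vector fields on $\mathbb{R}^2$ with finite $L_2$-norm, i.e. those whose Fourier transform is tangential to the circles centred at the origin of frequency space. The inner product is $\langle\vec u,\vec v\rangle=\int_{\mathbb{R}^2}\vec u(y)\cdot\overline{\vec v(y)}\,dy$. $U^H$ denotes the conjugate transpose. The radial window $\hat h$ is a scalar function of $|\xi|$ and is bandlimited, i.e. it vanishes outside a bounded set of frequencies. Polar coordinates are $(\theta_\xi,|\xi|)$ in frequency space and $(\theta_x,|x|)$ in the spatial domain. The unit tangent vector to the circle of radius $|\xi|$ is taken as $\vec e_{\theta_\xi}=(\sin\theta_\xi,-\cos\theta_\xi)$ in Cartesian coordinates. The divergence free polar wavelet with angular coefficients $(\beta_n^{j,t})_{|n|\le N_j}$ and radial window $\hat h$ is the vector field $\vec\psi^{\,j,t}$ with Fourier transform $$\hat{\vec\psi}{}^{\,j,t}(\xi)=-i\Big(\sum_{n=-N_j}^{N_j}\beta_n^{j,t}e^{in\theta_\xi}\Big)\hat h(|\xi|)\,\vec e_{\theta_\xi};$$ equivalently, in space, $$\vec\psi^{\,j,t}(x)=\frac12\sum_{\sigma\in\{-1,1\}}\sum_{m=-N_j}^{N_j}i^{m+\sigma}\beta_m^{j,t}e^{i(m+\sigma)\theta_x}h_{m+\sigma}(|x|)\begin{pmatrix}-\sigma\\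 i\end{pmatrix},\qquad h_m(r)=\int_0^\infty\hat h(\rho)J_m(\rho r)\,\rho\,d\rho,$$ with $J_m$ the Bessel function of the first kind.
   Formalization: The radial window is assumed to vanish for all radii above π, not merely outside some bounded set; with a larger band, e.g. the window equal to 1 on [π,2π), aliasing makes the representation fail. *)

theory Defs
  imports
    "Jordan_Normal_Form.Schur_Decomposition"
    "HOL-Analysis.Analysis"
begin

no_notation Matrix.vec_index (infixl \<open>$\<close> 100)

text \<open>
  A vector field on the plane is a function of type \<open>real^2 \<Rightarrow> complex^2\<close>. Square integrability and all integrals
  are with respect to \<^const>\<open>lborel\<close>; since \<open>L\<^sub>2\<close>-functions matter only up to null
  sets, Borel representatives are used.
\<close>

definition square_integrable :: "(real^2 \<Rightarrow> complex^2) \<Rightarrow> bool" where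
  "square_integrable u \<longleftrightarrow>
     u \<in> borel_measurable lborel \<and> integrable lborel (\<lambda>x. (norm (u x))\<^sup>2)"

definition L2_inner :: "(real^2 \<Rightarrow> complex^2) \<Rightarrow> (real^2 \<Rightarrow> complex^2) \<Rightarrow> complex" where
  "L2_inner u v = (\<integral>y. (\<Sum>i\<in>UNIV. u y $ i * cnj (v y $ i)) \<partial>lborel)"

text \<open>
  The squared \<open>L\<^sub>2\<close>-distance is a nonnegative extended real, so that it is infinite, rather than
  zero, when the difference is not square integrable.
\<close>

definition L2_dist_sq :: "(real^2 \<Rightarrow> complex^2) \<Rightarrow> (real^2 \<Rightarrow> complex^2) \<Rightarrow> ennreal" where
  "L2_dist_sq u v = (\<integral>\<^sup>+x. ennreal ((norm (u x - v x))\<^sup>2) \<partial>lborel)"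

definition L2_has_sum ::
  "('i \<Rightarrow> real^2 \<Rightarrow> complex^2) \<Rightarrow> (real^2 \<Rightarrow> complex^2) \<Rightarrow> 'i set \<Rightarrow> bool" where
  "L2_has_sum f u A \<longleftrightarrow>
     ((\<lambda>F. L2_dist_sq u (\<lambda>x. \<Sum>i\<in>F. f i x)) \<longlongrightarrow> 0) (finite_subsets_at_top A)"

definition fourier_integral :: "(real^2 \<Rightarrow> complex^2) \<Rightarrow> real^2 \<Rightarrow> complex^2" where
  "fourier_integral u \<xi> =
     (\<chi> i. 1 / (2 * pi) * (\<integral>x. u x $ i * cis (- (x \<bullet> \<xi>)) \<partial>lborel))"

definition inverse_fourier_integral :: "(real^2 \<Rightarrow> complex^2) \<Rightarrow> real^2 \<Rightarrow> complex^2" where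
  "inverse_fourier_integral g x =
     (\<chi> i. 1 / (2 * pi) * (\<integral>\<xi>. g \<xi> $ i * cis (x \<bullet> \<xi>) \<partial>lborel))"

text \<open>
  The Fourier transform on \<open>L\<^sub>2\<close> (Plancherel): the limit in the mean of the Fourier integrals of
  the truncations to discs, which are integrable. It is determined up to null sets, hence a relation.
\<close>

definition has_fourier_transform ::
  "(real^2 \<Rightarrow> complex^2) \<Rightarrow> (real^2 \<Rightarrow> complex^2) \<Rightarrow> bool" where
  "has_fourier_transform u g \<longleftrightarrow>
     square_integrable u \<and> square_integrable g \<and>
     ((\<lambda>R. L2_dist_sq g (fourier_integral (\<lambda>x. if norm x \<le> R then u x else 0))) \<longlongrightarrow> 0) at_top"

definition polar_angle :: "real^2 \<Rightarrow> real" where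
  "polar_angle \<xi> = Arg (Complex (\<xi> $ 1) (\<xi> $ 2))"

definition e_theta :: "real^2 \<Rightarrow> complex^2" where
  "e_theta \<xi> = vector [of_real (sin (polar_angle \<xi>)), of_real (- cos (polar_angle \<xi>))]"

text \<open>
  Divergence free means that the Fourier transform is tangential to the circles centred at the
  origin. The coefficient \<open>c\<close> depends on \<open>\<xi>\<close>.
\<close>

definition L2_div_free :: "(real^2 \<Rightarrow> complex^2) \<Rightarrow> bool" where
  "L2_div_free u \<longleftrightarrow>
     square_integrable u \<and>
     (\<exists>g. has_fourier_transform u g \<and> (AE \<xi> in lborel. \<exists>c. g \<xi> = c *s e_theta \<xi>))"

definition polar_wavelet_hat ::
  "nat \<Rightarrow> (int \<Rightarrow> complex) \<Rightarrow> (real \<Rightarrow> complex) \<Rightarrow> real^2 \<Rightarrow> complex^2" where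
  "polar_wavelet_hat N \<beta> h \<xi> =
     (- \<i> * (\<Sum>n\<in>{- int N..int N}. \<beta> n * cis (of_int n * polar_angle \<xi>)) * h (norm \<xi>))
       *s e_theta \<xi>"

text \<open>
  For a bounded Borel window vanishing outside a bounded set, \<^const>\<open>polar_wavelet_hat\<close> is
  integrable and square integrable, so the vector field with this Fourier transform is given by the
  inverse Fourier integral (which is its continuous representative). The argument \<open>h\<close> is the
  window in frequency space, a function of \<open>norm \<xi>\<close>.
\<close>

definition polar_wavelet ::
  "nat \<Rightarrow> (int \<Rightarrow> complex) \<Rightarrow> (real \<Rightarrow> complex) \<Rightarrow> real^2 \<Rightarrow> complex^2" where
  "polar_wavelet N \<beta> h = inverse_fourier_integral (polar_wavelet_hat N \<beta> h)"

definition rotated_coeffs :: "nat \<Rightarrow> (int \<Rightarrow> complex) \<Rightarrow> nat \<Rightarrow> int \<Rightarrow> complex" where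
  "rotated_coeffs M \<beta> t n = \<beta> n * cis (- (of_int n * of_nat t * (2 * pi / of_nat M)))"

text \<open>
  Matrix indices start at 0: row \<open>r\<close> belongs to the orientation \<open>t = r + 1\<close> and column \<open>c\<close> to the
  angular frequency \<open>n = c - N\<close>.
\<close>

definition orientation_matrix :: "nat \<Rightarrow> nat \<Rightarrow> (int \<Rightarrow> complex) \<Rightarrow> complex Matrix.mat" where
  "orientation_matrix M N \<beta> =
     Matrix.mat M (2 * N + 1) (\<lambda>(r, c). rotated_coeffs M \<beta> (r + 1) (int c - int N))"

definition mat_trace :: "complex Matrix.mat \<Rightarrow> complex" where
  "mat_trace A = sum_list (diag_mat A)"

text \<open>
  Translating by all of \<open>\<int>\<^sup>2\<close> at level 0 samples at the Nyquist rate of the cell \<open>[-\<pi>, \<pi>]\<^sup>2\<close> in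
  frequency. With the normalization \<open>2\<^sup>j / (2 \<pi>)\<close> there is no aliasing precisely when the radial
  window vanishes for radii above \<open>\<pi>\<close>; a window vanishing only above some larger radius does not
  give a tight frame in general.
\<close>

definition frame_function ::
  "(int \<Rightarrow> nat) \<Rightarrow> (int \<Rightarrow> nat) \<Rightarrow> (int \<Rightarrow> int \<Rightarrow> complex) \<Rightarrow> (real \<Rightarrow> complex)
     \<Rightarrow> int \<times> (int^2) \<times> nat \<Rightarrow> real^2 \<Rightarrow> complex^2" where
  "frame_function N M \<beta> h = (\<lambda>(j, k, t) x.
     (2 powi j / (2 * pi)) *\<^sub>R
       polar_wavelet (N j) (rotated_coeffs (M j) (\<beta> j) t) h
         (2 powi j *\<^sub>R x - (\<chi> i. of_int (k $ i))))"

end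

theory Submission
  imports Defs
begin

text \<open>
  The frame functions form a Parseval frame of the divergence free fields, and the reason is visible
  in frequency space. The transform of the frame function with index \<open>(j, k, t)\<close> is up to normalization that of the wavelet,
  dilated by \<open>2\<^sup>j\<close> and multiplied by the character with frequency \<open>- k / 2\<^sup>j\<close>. Let \<open>g\<close> be the
  tangential transform of a divergence free field. For fixed level \<open>j\<close> and orientation \<open>t\<close>, the inner products of
  \<open>g\<close> with these functions are up to a factor Fourier coefficients, on the cube of side \<open>2 \<pi> 2\<^sup>j\<close>, of the
  pointwise product of \<open>g\<close> with the conjugated wavelet transform, a scalar function that the band limit confines to the
  disc of radius \<open>2\<^sup>j \<pi>\<close>. By Parseval's identity their squares add up to the integral of the squared
  modulus of this product, which is the product of the squared moduli because both fields are tangential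
  (\<open>frame_hat_parseval_translations\<close>). Diagonality of \<open>U\<^sup>H U\<close> and the trace condition mean that the squared angular
  windows of one level sum to 1 at every angle (\<open>orientation_sum_eq_1\<close>), and the Calderon condition means the same
  for the radial windows over all levels. Altogether the squared inner products of \<open>g\<close> sum to \<open>\<parallel>g\<parallel>\<^sup>2\<close>
  (\<open>frame_hat_parseval\<close>).

  A Parseval identity implies unconditional reconstruction. Applied to a finite linear combination \<open>v\<close> of
  frame functions, it shows that \<open>\<parallel>v\<parallel>\<^sup>2\<close> is at most the sum of the squared coefficients
  (\<open>bessel_synthesis\<close>). If \<open>v\<close> is a partial sum of the expansion of \<open>u\<close> and \<open>S\<close> the sum of the squared moduli of its
  coefficients, this gives \<open>\<parallel>u - v\<parallel>\<^sup>2 \<le> \<parallel>u\<parallel>\<^sup>2 - S\<close>, where \<open>S\<close> tends to \<open>\<parallel>g\<parallel>\<^sup>2\<close> and \<open>\<parallel>u\<parallel> \<le> \<parallel>g\<parallel>\<close>.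

  Two classical theorems are needed to pass between space and frequency, and both are derived here. Parseval's identity
  for multiple Fourier series (\<open>parseval_cube\<close>) rests on the density of trigonometric polynomials, which comes
  from the Stone-Weierstrass theorem on the torus and the regularity of Lebesgue measure. Plancherel's
  identity for functions of bounded support (\<open>plancherel_compact_support\<close>) follows from it by averaging over shifts of the
  frequency lattice. The transform of a general square integrable field is a limit in the mean
  of transforms of truncations, and the two facts about it that the reconstruction uses
  (\<open>L2_inner_fourier_transform\<close>, \<open>L2_norm_sq_le_fourier_transform\<close>) are obtained as limits.
\<close>

section \<open>Measure-theoretic preliminaries\<close>

lemma measurable_vec_nth [measurable]: "(\<lambda>v :: 'a::euclidean_space ^ 'n. v $ i) \<in> borel_measurable borel"
  by (intro borel_measurable_continuous_onI continuous_intros)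

lemma borel_measurable_vec_lambda [measurable (raw)]:
  fixes f :: "'n::finite \<Rightarrow> 'a \<Rightarrow> 'b::euclidean_space"
  assumes "\<And>i. f i \<in> borel_measurable M"
  shows "(\<lambda>x. \<chi> i. f i x) \<in> borel_measurable M"
proof (rule borel_measurable_euclidean_space[THEN iffD2], rule ballI)
  fix b :: "'b ^ 'n" assume "b \<in> Basis"
  then obtain i c where "b = axis i c" by (auto simp: Basis_vec_def)
  then have "(\<lambda>x. (\<chi> i. f i x) \<bullet> b) = (\<lambda>x. f i x \<bullet> c)" by (simp add: inner_axis)
  then show "(\<lambda>x. (\<chi> i. f i x) \<bullet> b) \<in> borel_measurable M" using assms by simp
qed

lemma borel_measurable_cis [measurable (raw)]:
  "f \<in> borel_measurable M \<Longrightarrow> (\<lambda>x. cis (f x)) \<in> borel_measurable M"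
  by (rule borel_measurable_continuous_on[of cis]) (auto intro: continuous_intros)

lemma borel_measurable_cnj [measurable (raw)]:
  "f \<in> borel_measurable M \<Longrightarrow> (\<lambda>x. cnj (f x)) \<in> borel_measurable M"
  by (rule borel_measurable_continuous_on[of cnj]) (auto intro: continuous_intros)

lemma nn_integral_lborel_affine:
  fixes f :: "'a::euclidean_space \<Rightarrow> ennreal"
  assumes [measurable]: "f \<in> borel_measurable borel" and c: "c \<noteq> 0"
  shows "(\<integral>\<^sup>+x. f x \<partial>lborel) = ennreal (\<bar>c\<bar> ^ DIM('a)) * (\<integral>\<^sup>+x. f (t + c *\<^sub>R x) \<partial>lborel)"
  by (subst lborel_affine[OF c, of t])
     (simp add: nn_integral_density nn_integral_distr nn_integral_cmult)

lemma integrable_lborel_affine: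
  fixes f :: "'a::euclidean_space \<Rightarrow> 'b::{banach, second_countable_topology}"
  assumes f: "integrable lborel f" and c: "c \<noteq> 0"
  shows "integrable lborel (\<lambda>x. f (t + c *\<^sub>R x))"
proof -
  have [measurable]: "f \<in> borel_measurable borel" using f by auto
  show ?thesis
    using f c zero_less_power[of "\<bar>c\<bar>" "DIM('a)"] unfolding integrable_iff_bounded
    by (subst (asm) nn_integral_lborel_affine[where c=c and t=t])
       (auto simp: ennreal_mult_less_top)
qed

lemma integrable_lborel_affine_iff:
  fixes f :: "'a::euclidean_space \<Rightarrow> 'b::{banach, second_countable_topology}"
  assumes c: "c \<noteq> 0"
  shows "integrable lborel (\<lambda>x. f (t + c *\<^sub>R x)) \<longleftrightarrow> integrable lborel f"
  using integrable_lborel_affine[of f c t, OF _ c]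
    integrable_lborel_affine[of "\<lambda>x. f (t + c *\<^sub>R x)" "1/c" "(-1/c) *\<^sub>R t"] c
  by (auto simp: algebra_simps)

lemma integral_lborel_affine:
  fixes f :: "'a::euclidean_space \<Rightarrow> 'b::{banach, second_countable_topology}"
  assumes c: "c \<noteq> 0"
  shows "(\<integral>x. f x \<partial>lborel) = (\<bar>c\<bar> ^ DIM('a)) *\<^sub>R (\<integral>x. f (t + c *\<^sub>R x) \<partial>lborel)"
proof (cases "integrable lborel f")
  case True
  then have [measurable]: "f \<in> borel_measurable borel" by auto
  show ?thesis
    using integrable_lborel_affine[OF True c, of t]
    by (subst lborel_affine[OF c, of t]) (simp add: integral_density integral_distr)
next
  case False
  with c show ?thesis by (simp add: integrable_lborel_affine_iff not_integrable_integral_eq)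
qed

text \<open>
  Sums over the index set of the frame are computed as integrals with respect to counting measures,
  where the order of nonnegative summations and integrations may be exchanged freely. This lemma and
  its converse translate between such integrals and \<^const>\<open>has_sum\<close>.
\<close>

lemma nn_integral_count_space_imp_has_sum:
  fixes f :: "'i \<Rightarrow> real"
  assumes nonneg: "\<And>i. i \<in> A \<Longrightarrow> f i \<ge> 0" and "S \<ge> 0"
    and eq: "(\<integral>\<^sup>+i. ennreal (f i) \<partial>count_space A) = ennreal S"
  shows "(f has_sum S) A"
proof -
  have int: "integrable (count_space A) f"
    using eq nonneg by (intro integrableI_nn_integral_finite[of _ _ S]) (auto simp: \<open>S \<ge> 0\<close> AE_count_space)
  then have abs: "Infinite_Set_Sum.abs_summable_on f A" by (simp add: abs_summable_on_def)
  have "infsetsum f A = S"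
    unfolding infsetsum_def using eq nonneg \<open>S \<ge> 0\<close>
    by (subst integral_eq_nn_integral) (auto simp: AE_count_space)
  moreover have "f summable_on A"
    using abs abs_summable_equivalent abs_summable_summable by blast
  ultimately show ?thesis
    using infsetsum_infsum[OF abs] by (metis has_sum_infsum)
qed

lemma has_sum_imp_nn_integral_count_space:
  fixes f :: "'i \<Rightarrow> real"
  assumes nonneg: "\<And>i. i \<in> A \<Longrightarrow> f i \<ge> 0" and sum: "(f has_sum S) A"
  shows "(\<integral>\<^sup>+i. ennreal (f i) \<partial>count_space A) = ennreal S"
proof -
  have "(\<lambda>i. norm (f i)) summable_on A"
    using has_sum_imp_summable[OF sum] by (rule summable_on_cong[THEN iffD1, rotated]) (simp add: nonneg)
  then have abs: "Infinite_Set_Sum.abs_summable_on f A" using abs_summable_equivalent by blast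
  then have "integrable (count_space A) f" by (simp add: abs_summable_on_def)
  moreover have "integral\<^sup>L (count_space A) f = S"
    using infsetsum_infsum[OF abs] infsumI[OF sum] by (simp add: infsetsum_def)
  ultimately show ?thesis
    using nonneg by (subst nn_integral_eq_integral) (auto simp: AE_count_space)
qed

lemma norm_add_square_le: "(norm (a + b))\<^sup>2 \<le> 2 * (norm a)\<^sup>2 + 2 * (norm (b::'a::real_normed_vector))\<^sup>2"
proof -
  have "(norm (a + b))\<^sup>2 \<le> (norm a + norm b)\<^sup>2" by (simp add: norm_triangle_ineq power_mono)
  also have "\<dots> \<le> 2 * (norm a)\<^sup>2 + 2 * (norm b)\<^sup>2"
    using sum_squares_bound[of "norm a" "norm b"] by (simp add: power2_sum)
  finally show ?thesis .
qed

section \<open>Characters on the period cube\<close>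

definition lattice_point :: "int ^ 'n \<Rightarrow> real ^ 'n" where
  "lattice_point k = (\<chi> i. of_int (k $ i))"

definition character :: "int ^ 'n \<Rightarrow> real ^ 'n \<Rightarrow> complex" where
  "character k x = cis (lattice_point k \<bullet> x)"

definition period_cube :: "(real ^ 'n) set" where
  "period_cube = box (\<chi> i. - pi) (\<chi> i. pi)"

lemma mem_period_cube: "x \<in> period_cube \<longleftrightarrow> (\<forall>i. \<bar>x $ i\<bar> < pi)"
  by (auto simp: period_cube_def mem_box_cart abs_less_iff; smt)

text \<open>
  Lebesgue measure on the open cube \<open>(-\<pi>, \<pi>)\<^sup>n\<close>. It is a density rather than a restriction to a subspace, so
  that its measurable sets are all Borel sets of the ambient space: the regularity theorem for finite
  Borel measures then applies directly.
\<close>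

definition cube_measure :: "(real ^ 'n) measure" where
  "cube_measure = density lborel (indicator period_cube)"

lemma period_cube_borel [measurable]: "period_cube \<in> sets borel"
  by (simp add: period_cube_def)

lemma sets_cube_measure [measurable_cong]: "sets cube_measure = sets borel"
  by (simp add: cube_measure_def)

lemma space_cube_measure [simp]: "space cube_measure = UNIV"
  by (simp add: cube_measure_def)

lemma emeasure_cube_measure:
  "A \<in> sets borel \<Longrightarrow> emeasure cube_measure A = emeasure lborel (A \<inter> period_cube)"
  by (simp add: cube_measure_def emeasure_density indicator_inter_arith[symmetric] mult.commute[of "indicator period_cube _"] Int_commute)

lemma nn_integral_cube_measure:
  "f \<in> borel_measurable borel \<Longrightarrow> (\<integral>\<^sup>+x. f x \<partial>cube_measure) = (\<integral>\<^sup>+x. f x * indicator period_cube x \<partial>lborel)"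
  by (simp add: cube_measure_def nn_integral_density mult.commute)

lemma integral_cube_measure:
  fixes f :: "real ^ 'n \<Rightarrow> 'b::{banach, second_countable_topology}"
  assumes "f \<in> borel_measurable borel"
  shows "(\<integral>x. f x \<partial>cube_measure) = (\<integral>x. indicator period_cube x *\<^sub>R f x \<partial>lborel)"
proof -
  have eq: "cube_measure = density lborel (\<lambda>x :: real ^ 'n. ennreal (indicator period_cube x))"
    by (simp add: cube_measure_def ennreal_indicator)
  show ?thesis
    unfolding eq by (subst integral_density) (use assms in auto)
qed

lemma AE_cube_measure: "AE x in cube_measure. x \<in> period_cube"
  unfolding cube_measure_def by (subst AE_density) (auto simp: indicator_def split: if_splits)

lemma finite_measure_cube_measure: "finite_measure cube_measure"
  by (rule finite_measureI) (simp add: emeasure_cube_measure period_cube_def emeasure_lborel_box_eq)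

lemma character_measurable [measurable]: "character k \<in> borel_measurable borel"
  unfolding character_def by measurable

lemma norm_character [simp]: "norm (character k x) = 1"
  by (simp add: character_def)

lemma lattice_point_add: "lattice_point (k + l) = lattice_point k + lattice_point l"
  by (simp add: lattice_point_def vec_eq_iff)
lemma lattice_point_minus: "lattice_point (- k) = - lattice_point k"
  by (simp add: lattice_point_def vec_eq_iff)

lemma character_add: "character (k + l) x = character k x * character l x"
  by (simp add: character_def lattice_point_add inner_add_left cis_mult)

lemma character_minus: "character (- k) x = cnj (character k x)"
  by (simp add: character_def lattice_point_minus cis_cnj)

lemma character_zero [simp]: "character 0 x = 1"
  by (simp add: character_def lattice_point_def inner_vec_def)

lemma integral_cis_int:
  "(\<integral>t. indicator {-pi<..<pi} t *\<^sub>R cis (of_int m * t) \<partial>lborel) = (if m = 0 then 2 * pi else 0)"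
proof -
  have ae: "(\<integral>t. indicator {-pi<..<pi} t *\<^sub>R cis (of_int m * t) \<partial>lborel) =
    (\<integral>t. indicator {-pi..pi} t *\<^sub>R cis (of_int m * t) \<partial>lborel)"
  proof (rule integral_cong_AE)
    show "AE t in lborel. indicator {-pi<..<pi} t *\<^sub>R cis (of_int m * t)
       = (indicator {-pi..pi} t *\<^sub>R cis (of_int m * t) :: complex)"
      using AE_lborel_singleton[of "-pi"] AE_lborel_singleton[of pi]
      by eventually_elim (auto simp: indicator_def)
  qed auto
  show ?thesis
  proof (cases "m = 0")
    case True
    then show ?thesis by (simp add: one_complex.code[symmetric] cis_zero scaleR_conv_of_real)
  next
    case False
    have "(\<integral>t. indicator {-pi..pi} t *\<^sub>R cis (of_int m * t) \<partial>lborel) =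
      cis (of_int m * pi) / (\<i> * of_int m) - cis (of_int m * (-pi)) / (\<i> * of_int m)"
    proof (rule integral_FTC_Icc)
      show "((\<lambda>t. cis (of_int m * t) / (\<i> * of_int m)) has_vector_derivative cis (of_int m * t)) (at t within {-pi..pi})" for t
      proof -
        have eq: "cis (of_int m * t) = exp (t *\<^sub>R (\<i> * of_int m))" for t
          by (simp add: cis_conv_exp scaleR_conv_of_real mult_ac)
        show ?thesis
          unfolding eq using False
          by (auto intro!: has_vector_derivative_eq_rhs[OF has_vector_derivative_divide[OF exp_scaleR_has_vector_derivative_right]])
      qed
    qed (use pi_ge_zero in \<open>auto intro!: continuous_intros\<close>)
    also have "\<dots> = 0"
    proof -
      have "cis (of_int m * pi) = cis (of_int m * (- pi))"
        by (simp add: complex_eq_iff mult.commute[of _ pi] sin_integer_2pi sin_zero_iff_int2)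
      then show ?thesis by simp
    qed
    finally show ?thesis using False ae by simp
  qed
qed

text \<open>
  The integrand is a product of functions of one coordinate each, so the integral factors into
  one-dimensional integrals, of which one vanishes unless all frequencies are zero.
\<close>

lemma integral_character:
  "(\<integral>x. character m x \<partial>cube_measure) = (if m = 0 then (2 * pi) ^ CARD('n) else 0 :: complex)"
  for m :: "int ^ 'n"
proof -
  define g where "g b t = indicator {-pi<..<pi} t *\<^sub>R cis ((lattice_point m \<bullet> b) * t)" for b :: "real^'n" and t
  have g_meas [measurable]: "g b \<in> borel_measurable borel" for b
    unfolding g_def by measurable
  have prod: "indicator period_cube x *\<^sub>R character m x = (\<Prod>b\<in>Basis. g b (x \<bullet> b))" for x
  proof -
    have "character m x = (\<Prod>b\<in>Basis. cis ((lattice_point m \<bullet> b) * (x \<bullet> b)))"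
    proof -
      have "cis (sum h B) = (\<Prod>b\<in>B. cis (h b))" if "finite B" for h and B :: "(real^'n) set"
        using that by (induction B) (auto simp: cis_mult[symmetric])
      then show ?thesis
        unfolding character_def by (subst euclidean_inner) simp
    qed
    moreover have "indicator period_cube x = (\<Prod>b\<in>Basis. indicator {-pi<..<pi} (x \<bullet> b) :: real)"
    proof (cases "x \<in> period_cube")
      case True
      have "x \<bullet> b \<in> {-pi<..<pi}" if "b \<in> Basis" for b
        using that True by (auto simp: Basis_vec_def inner_axis mem_period_cube abs_less_iff; smt)
      with True show ?thesis by simp
    next
      case False
      then obtain i where "\<not> \<bar>x $ i\<bar> < pi" by (auto simp: mem_period_cube)
      then have "indicator {-pi<..<pi} (x \<bullet> axis i 1) = (0::real)"
        by (auto simp: inner_axis indicator_def)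
      moreover have "axis i 1 \<in> (Basis :: (real^'n) set)" by simp
      ultimately show ?thesis using False by (auto simp: prod_zero_iff)
    qed
    ultimately show ?thesis
      unfolding g_def by (simp add: scaleR_conv_of_real prod.distrib of_real_prod)
  qed
  interpret product_sigma_finite "\<lambda>_::real^'n. lborel :: real measure" ..
  have g_int: "integrable lborel (g b)" for b
  proof (rule Bochner_Integration.integrable_bound)
    show "integrable lborel (indicator {-pi<..<pi} :: real \<Rightarrow> real)" by simp
  qed (auto simp: g_def indicator_def)
  have "(\<integral>x. character m x \<partial>cube_measure) = (\<integral>x. (\<Prod>b\<in>Basis. g b (x \<bullet> b)) \<partial>lborel)"
    unfolding prod[symmetric] by (simp add: integral_cube_measure)
  also have "\<dots> = (\<integral>y. (\<Prod>b\<in>Basis. g b (y b)) \<partial>(\<Pi>\<^sub>M b\<in>Basis. lborel))"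
    by (subst lborel_eq, subst integral_distr) (auto intro!: Bochner_Integration.integral_cong prod.cong)
  also have "\<dots> = (\<Prod>b\<in>Basis. integral\<^sup>L lborel (g b))"
    by (rule product_integral_prod) (auto intro: g_int)
  also have "\<dots> = (\<Prod>i\<in>UNIV. integral\<^sup>L lborel (g (axis i 1)))"
  proof -
    have eq: "(Basis :: (real^'n) set) = range (\<lambda>i. axis i 1)" by (auto simp: Basis_vec_def)
    have "inj (\<lambda>i. axis i (1::real) :: real^'n)" by (auto simp: inj_on_def axis_eq_axis)
    then show ?thesis unfolding eq by (subst prod.reindex) (auto simp: o_def)
  qed
  also have "\<dots> = (\<Prod>i\<in>UNIV. if m $ i = 0 then 2 * pi else 0)"
    unfolding g_def inner_axis by (simp add: lattice_point_def integral_cis_int)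
  also have "\<dots> = (if m = 0 then (2 * pi) ^ CARD('n) else 0 :: complex)"
    by (auto simp: vec_eq_iff prod_zero_iff)
  finally show ?thesis .
qed

section \<open>Trigonometric polynomials and their density\<close>

text \<open>
  Building trigonometric polynomials by adding one term at a time makes closure under products an
  induction on each factor, without reindexing of double sums.
\<close>

inductive trig_poly :: "(real ^ 'n \<Rightarrow> complex) \<Rightarrow> bool" where
  zero: "trig_poly (\<lambda>x. 0)"
| add_term: "trig_poly p \<Longrightarrow> trig_poly (\<lambda>x. p x + c * character k x)"

lemma trig_poly_monomial: "trig_poly (\<lambda>x. c * character k x)"
  using trig_poly.add_term[OF trig_poly.zero] by simp

lemma trig_poly_const: "trig_poly (\<lambda>x. c)"
  using trig_poly_monomial[of c 0] by simp

lemma trig_poly_add: "trig_poly q \<Longrightarrow> trig_poly p \<Longrightarrow> trig_poly (\<lambda>x. p x + q x)"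
proof (induction q rule: trig_poly.induct)
  case (add_term q c k)
  then show ?case using trig_poly.add_term[of "\<lambda>x. p x + q x" c k] by (simp add: add.assoc)
qed simp

lemma trig_poly_mult_term: "trig_poly p \<Longrightarrow> trig_poly (\<lambda>x. p x * (c * character k x))"
proof (induction rule: trig_poly.induct)
  case (add_term q d l)
  then show ?case
    using trig_poly.add_term[of "\<lambda>x. q x * (c * character k x)" "d * c" "l + k"]
    by (simp add: character_add algebra_simps)
qed (simp add: trig_poly.zero)

lemma trig_poly_mult: "trig_poly q \<Longrightarrow> trig_poly p \<Longrightarrow> trig_poly (\<lambda>x. p x * q x)"
proof (induction q rule: trig_poly.induct)
  case (add_term q c k)
  then show ?case
    using trig_poly_add[OF trig_poly_mult_term add_term.IH] by (simp add: distrib_left)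
qed (simp add: trig_poly.zero)

lemma trig_poly_sum: "finite I \<Longrightarrow> (\<And>i. i \<in> I \<Longrightarrow> trig_poly (p i)) \<Longrightarrow> trig_poly (\<lambda>x. \<Sum>i\<in>I. p i x)"
  by (induction I rule: finite_induct) (auto intro: trig_poly.zero trig_poly_add)

lemma trig_poly_measurable: "trig_poly p \<Longrightarrow> p \<in> borel_measurable borel"
  by (induction rule: trig_poly.induct) auto

lemma trig_poly_eq_sum:
  assumes "trig_poly p"
  obtains F a where "finite F" "p = (\<lambda>x. \<Sum>k\<in>F. a k * character k x)"
proof -
  have "\<exists>F a. finite F \<and> p = (\<lambda>x. \<Sum>k\<in>F. a k * character k x)"
    using assms
  proof (induction rule: trig_poly.induct)
    case zero
    show ?case by (intro exI[of _ "{}"]) simp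
  next
    case (add_term p c k)
    then obtain F a where F: "finite F" "p = (\<lambda>x. \<Sum>k\<in>F. a k * character k x)" by auto
    define b where "b l = (if l \<in> F then a l else 0) + (if l = k then c else 0)" for l
    have "(\<Sum>l\<in>insert k F. b l * character l x) = p x + c * character k x" for x
    proof -
      have "(\<Sum>l\<in>insert k F. b l * character l x) =
        (\<Sum>l\<in>insert k F. (if l \<in> F then a l * character l x else 0)) + (\<Sum>l\<in>insert k F. (if l = k then c * character l x else 0))"
        unfolding b_def sum.distrib[symmetric] by (intro sum.cong) (auto simp: algebra_simps)
      also have "(\<Sum>l\<in>insert k F. (if l \<in> F then a l * character l x else 0)) = p x"
        using F by (subst sum.inter_restrict[symmetric]) (auto intro!: sum.cong)
      finally show ?thesis using F by simp
    qed
    then show ?case using F(1) by (intro exI[of _ "insert k F"] exI[of _ b]) auto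
  qed
  with that show ?thesis by blast
qed

text \<open>
  The projection of \<open>\<real>\<^sup>n\<close> onto the torus, which lies in \<open>\<complex>\<^sup>n\<close>. It is injective on the open cube
  \<open>(-\<pi>, \<pi>)\<^sup>n\<close>, so that functions on the cube can be approximated through functions on the torus.
\<close>

definition torus_point :: "real ^ 'n \<Rightarrow> complex ^ 'n" where
  "torus_point x = (\<chi> i. cis (x $ i))"

text \<open>
  A real linear form in a point of the torus is a combination of the functions \<open>cos x\<^sub>i\<close> and \<open>sin x\<^sub>i\<close>,
  which are trigonometric polynomials by Euler's formulas; sums and products are closure properties.
\<close>

lemma trig_poly_real_polynomial:
  fixes g :: "complex ^ 'n \<Rightarrow> real"
  assumes "real_polynomial_function g"
  shows "trig_poly (\<lambda>x. complex_of_real (g (torus_point x)))"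
  using assms
proof (induction rule: real_polynomial_function.induct)
  case (linear f)
  interpret bounded_linear f by fact
  have eq: "torus_point x = (\<Sum>i\<in>UNIV. cos (x $ i) *\<^sub>R axis i 1 + sin (x $ i) *\<^sub>R axis i \<i>)" for x :: "real^'n"
    by (auto simp: torus_point_def vec_eq_iff axis_def complex_eq_iff if_distrib sum.distrib cong: if_cong)
  have char: "character (axis i s) x = cis (of_int s * x $ i)" for i :: 'n and s x
  proof -
    have "lattice_point (axis i s) = axis i (of_int s)" by (simp add: lattice_point_def vec_eq_iff axis_def)
    then show ?thesis by (simp add: character_def inner_axis')
  qed
  have c: "complex_of_real (cos (x $ i)) = (1/2) * character (axis i 1) x + (1/2) * character (axis i (-1)) x" for i :: 'n and x
    by (simp add: char complex_eq_iff)
  have s: "complex_of_real (sin (x $ i)) = (-\<i>/2) * character (axis i 1) x + (\<i>/2) * character (axis i (-1)) x" for i :: 'n and x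
    by (simp add: char complex_eq_iff)
  have "trig_poly (\<lambda>x. \<Sum>i\<in>UNIV. complex_of_real (cos (x $ i)) * complex_of_real (f (axis i 1)) +
     complex_of_real (sin (x $ i)) * complex_of_real (f (axis i \<i>)))"
    unfolding c s
    by (intro trig_poly_sum trig_poly_add trig_poly_mult trig_poly_monomial trig_poly_const) auto
  then show ?case
    unfolding eq sum add scaleR by simp
next
  case (const c)
  show ?case by (rule trig_poly_const)
next
  case (add f g)
  then show ?case by (simp add: trig_poly_add)
next
  case (mult f g)
  then show ?case by (simp add: trig_poly_mult)
qed

lemma nn_integral_diff_square_triangle:
  fixes f g h :: "'a \<Rightarrow> 'b::{real_normed_vector, second_countable_topology}"
  assumes [measurable]: "f \<in> borel_measurable M" "g \<in> borel_measurable M" "h \<in> borel_measurable M"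
  shows "(\<integral>\<^sup>+x. ennreal ((norm (f x - h x))\<^sup>2) \<partial>M) \<le>
    2 * (\<integral>\<^sup>+x. ennreal ((norm (f x - g x))\<^sup>2) \<partial>M) + 2 * (\<integral>\<^sup>+x. ennreal ((norm (g x - h x))\<^sup>2) \<partial>M)"
proof -
  have "(\<integral>\<^sup>+x. ennreal ((norm (f x - h x))\<^sup>2) \<partial>M) \<le>
    (\<integral>\<^sup>+x. 2 * ennreal ((norm (f x - g x))\<^sup>2) + 2 * ennreal ((norm (g x - h x))\<^sup>2) \<partial>M)"
  proof (rule nn_integral_mono)
    fix x
    have "(norm (f x - h x))\<^sup>2 \<le> 2 * (norm (f x - g x))\<^sup>2 + 2 * (norm (g x - h x))\<^sup>2"
      using norm_add_square_le[of "f x - g x" "g x - h x"] by simp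
    then have "ennreal ((norm (f x - h x))\<^sup>2) \<le> ennreal (2 * (norm (f x - g x))\<^sup>2 + 2 * (norm (g x - h x))\<^sup>2)"
      by (rule ennreal_leI)
    also have "\<dots> = 2 * ennreal ((norm (f x - g x))\<^sup>2) + 2 * ennreal ((norm (g x - h x))\<^sup>2)"
      by (simp add: ennreal_plus ennreal_mult)
    finally show "ennreal ((norm (f x - h x))\<^sup>2) \<le> \<dots>" .
  qed
  also have "\<dots> = 2 * (\<integral>\<^sup>+x. ennreal ((norm (f x - g x))\<^sup>2) \<partial>M) + 2 * (\<integral>\<^sup>+x. ennreal ((norm (g x - h x))\<^sup>2) \<partial>M)"
    by (simp add: nn_integral_add nn_integral_cmult)
  finally show ?thesis .
qed

text \<open>
  Membership in the closure of the trigonometric polynomials in \<open>L\<^sub>2\<close> of the cube.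
\<close>

definition trig_approximable :: "(real ^ 'n \<Rightarrow> complex) \<Rightarrow> bool" where
  "trig_approximable f \<longleftrightarrow> f \<in> borel_measurable borel \<and>
     (\<forall>e>0. \<exists>p. trig_poly p \<and> (\<integral>\<^sup>+x. ennreal ((norm (f x - p x))\<^sup>2) \<partial>cube_measure) \<le> ennreal e)"

lemma trig_approximable_measurable: "trig_approximable f \<Longrightarrow> f \<in> borel_measurable borel"
  by (simp add: trig_approximable_def)

lemma four_quarters_ennreal: "e \<ge> 0 \<Longrightarrow> 2 * ennreal (e / 4) + 2 * ennreal (e / 4) = ennreal e"
  by (simp add: ennreal_mult[symmetric] ennreal_plus[symmetric] ennreal_numeral[symmetric] del: ennreal_plus ennreal_numeral)

lemma trig_approximable_closed:
  fixes f :: "real ^ 'n \<Rightarrow> complex"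
  assumes f [measurable]: "f \<in> borel_measurable borel"
    and g: "\<And>e. e > 0 \<Longrightarrow> \<exists>g. trig_approximable g \<and> (\<integral>\<^sup>+x. ennreal ((norm (f x - g x))\<^sup>2) \<partial>cube_measure) \<le> ennreal e"
  shows "trig_approximable f"
  unfolding trig_approximable_def
proof (intro conjI allI impI f)
  fix e :: real assume "e > 0"
  then have e4: "e / 4 > 0" by simp
  obtain g where g: "trig_approximable g" "(\<integral>\<^sup>+x. ennreal ((norm (f x - g x))\<^sup>2) \<partial>cube_measure) \<le> ennreal (e/4)"
    using g[OF e4] by blast
  then obtain p where p: "trig_poly p" "(\<integral>\<^sup>+x. ennreal ((norm (g x - p x))\<^sup>2) \<partial>cube_measure) \<le> ennreal (e/4)"
    using e4 unfolding trig_approximable_def by blast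
  have [measurable]: "g \<in> borel_measurable borel" "p \<in> borel_measurable borel"
    using g p by (auto simp: trig_approximable_def trig_poly_measurable)
  have "(\<integral>\<^sup>+x. ennreal ((norm (f x - p x))\<^sup>2) \<partial>cube_measure) \<le>
    2 * (\<integral>\<^sup>+x. ennreal ((norm (f x - g x))\<^sup>2) \<partial>cube_measure) + 2 * (\<integral>\<^sup>+x. ennreal ((norm (g x - p x))\<^sup>2) \<partial>cube_measure)"
    by (rule nn_integral_diff_square_triangle) measurable
  also have "\<dots> \<le> 2 * ennreal (e / 4) + 2 * ennreal (e / 4)"
    by (intro add_mono mult_left_mono g p) auto
  also have "\<dots> = ennreal e" using \<open>e > 0\<close> by (simp add: four_quarters_ennreal)
  finally show "\<exists>p. trig_poly p \<and> (\<integral>\<^sup>+x. ennreal ((norm (f x - p x))\<^sup>2) \<partial>cube_measure) \<le> ennreal e"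
    using p by blast
qed

lemma trig_approximable_limit:
  fixes f :: "real ^ 'n \<Rightarrow> complex"
  assumes f: "f \<in> borel_measurable borel" and g: "\<And>n. trig_approximable (g n)"
    and lim: "(\<lambda>n::nat. \<integral>\<^sup>+x. ennreal ((norm (f x - g n x))\<^sup>2) \<partial>cube_measure) \<longlonglongrightarrow> 0"
  shows "trig_approximable f"
proof (rule trig_approximable_closed[OF f])
  fix e :: real assume "e > 0"
  then have "eventually (\<lambda>n. (\<integral>\<^sup>+x. ennreal ((norm (f x - g n x))\<^sup>2) \<partial>cube_measure) < ennreal e) sequentially"
    using lim by (intro order_tendstoD) auto
  then show "\<exists>g. trig_approximable g \<and> (\<integral>\<^sup>+x. ennreal ((norm (f x - g x))\<^sup>2) \<partial>cube_measure) \<le> ennreal e"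
    using g by (auto simp: eventually_sequentially intro: less_imp_le)
qed

lemma trig_approximable_add:
  fixes f g :: "real ^ 'n \<Rightarrow> complex"
  assumes "trig_approximable f" "trig_approximable g"
  shows "trig_approximable (\<lambda>x. f x + g x)"
  unfolding trig_approximable_def
proof (intro conjI allI impI)
  have [measurable]: "f \<in> borel_measurable borel" "g \<in> borel_measurable borel"
    using assms by (auto simp: trig_approximable_def)
  show "(\<lambda>x. f x + g x) \<in> borel_measurable borel" by measurable
  fix e :: real assume "e > 0"
  then have e4: "e / 4 > 0" by simp
  obtain p where p: "trig_poly p" "(\<integral>\<^sup>+x. ennreal ((norm (f x - p x))\<^sup>2) \<partial>cube_measure) \<le> ennreal (e/4)"
    using assms e4 unfolding trig_approximable_def by blast
  obtain q where q: "trig_poly q" "(\<integral>\<^sup>+x. ennreal ((norm (g x - q x))\<^sup>2) \<partial>cube_measure) \<le> ennreal (e/4)"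
    using assms e4 unfolding trig_approximable_def by blast
  have [measurable]: "q \<in> borel_measurable borel" "p \<in> borel_measurable borel"
    using p q by (auto simp: trig_poly_measurable)
  have "(\<integral>\<^sup>+x. ennreal ((norm (f x + g x - (p x + q x)))\<^sup>2) \<partial>cube_measure) \<le>
    2 * (\<integral>\<^sup>+x. ennreal ((norm (f x + g x - (p x + g x)))\<^sup>2) \<partial>cube_measure) +
    2 * (\<integral>\<^sup>+x. ennreal ((norm (p x + g x - (p x + q x)))\<^sup>2) \<partial>cube_measure)"
    by (rule nn_integral_diff_square_triangle) measurable
  also have "\<dots> = 2 * (\<integral>\<^sup>+x. ennreal ((norm (f x - p x))\<^sup>2) \<partial>cube_measure) +
    2 * (\<integral>\<^sup>+x. ennreal ((norm (g x - q x))\<^sup>2) \<partial>cube_measure)" by simp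
  also have "\<dots> \<le> 2 * ennreal (e / 4) + 2 * ennreal (e / 4)"
    by (intro add_mono mult_left_mono p q) auto
  also have "\<dots> = ennreal e" using \<open>e > 0\<close> by (simp add: four_quarters_ennreal)
  finally show "\<exists>p. trig_poly p \<and> (\<integral>\<^sup>+x. ennreal ((norm (f x + g x - p x))\<^sup>2) \<partial>cube_measure) \<le> ennreal e"
    using p q by (intro exI[of _ "\<lambda>x. p x + q x"] conjI trig_poly_add)
qed

lemma trig_approximable_cmult:
  fixes f :: "real ^ 'n \<Rightarrow> complex"
  assumes "trig_approximable f"
  shows "trig_approximable (\<lambda>x. c * f x)"
  unfolding trig_approximable_def
proof (intro conjI allI impI)
  have [measurable]: "f \<in> borel_measurable borel"
    using assms by (auto simp: trig_approximable_def)
  show "(\<lambda>x. c * f x) \<in> borel_measurable borel" by measurable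
  fix e :: real assume "e > 0"
  \<comment> \<open>adding 1 covers \<open>c = 0\<close>\<close>
  define d where "d = e / ((norm c)\<^sup>2 + 1)"
  have "d > 0" using \<open>e > 0\<close> by (simp add: d_def add_nonneg_pos)
  obtain p where p: "trig_poly p" "(\<integral>\<^sup>+x. ennreal ((norm (f x - p x))\<^sup>2) \<partial>cube_measure) \<le> ennreal d"
    using assms \<open>d > 0\<close> unfolding trig_approximable_def by blast
  have [measurable]: "p \<in> borel_measurable borel"
    using p by (auto simp: trig_poly_measurable)
  have "(\<integral>\<^sup>+x. ennreal ((norm (c * f x - p x * c))\<^sup>2) \<partial>cube_measure) =
    (\<integral>\<^sup>+x. ennreal ((norm c)\<^sup>2) * ennreal ((norm (f x - p x))\<^sup>2) \<partial>cube_measure)"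
    by (intro nn_integral_cong)
      (simp add: ennreal_mult[symmetric] power_mult_distrib[symmetric] norm_mult[symmetric] right_diff_distrib mult.commute)
  also have "\<dots> = ennreal ((norm c)\<^sup>2) * (\<integral>\<^sup>+x. ennreal ((norm (f x - p x))\<^sup>2) \<partial>cube_measure)"
    by (rule nn_integral_cmult) measurable
  also have "\<dots> \<le> ennreal ((norm c)\<^sup>2) * ennreal d"
    by (intro mult_left_mono p) auto
  also have "\<dots> \<le> ennreal e"
  proof -
    have "(norm c)\<^sup>2 * d \<le> ((norm c)\<^sup>2 + 1) * d" using \<open>d > 0\<close> by simp
    also have "\<dots> = e" unfolding d_def by (simp add: add_nonneg_eq_0_iff)
    finally show ?thesis using \<open>d > 0\<close> by (simp add: ennreal_mult[symmetric] ennreal_leI)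
  qed
  finally show "\<exists>p. trig_poly p \<and> (\<integral>\<^sup>+x. ennreal ((norm (c * f x - p x))\<^sup>2) \<partial>cube_measure) \<le> ennreal e"
    using trig_poly_mult[OF trig_poly_const[of c] p(1)] by blast
qed

lemma trig_approximable_zero: "trig_approximable (\<lambda>x :: real ^ 'n. 0)"
  unfolding trig_approximable_def by (auto intro!: exI[of _ "\<lambda>_. 0"] trig_poly.zero)

lemma trig_approximable_sum:
  fixes f :: "'i \<Rightarrow> real ^ 'n \<Rightarrow> complex"
  assumes "finite I" "\<And>i. i \<in> I \<Longrightarrow> trig_approximable (f i)"
  shows "trig_approximable (\<lambda>x. \<Sum>i\<in>I. f i x)"
  using assms by (induction I rule: finite_induct) (auto intro: trig_approximable_zero trig_approximable_add)

lemma torus_point_continuous: "continuous_on S torus_point"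
  unfolding torus_point_def by (intro continuous_intros)

lemma torus_point_inj:
  assumes "x \<in> period_cube" "y \<in> period_cube" "torus_point x = torus_point y"
  shows "x = y"
proof (rule vec_eq_iff[THEN iffD2], rule allI)
  fix i
  have "cis (x $ i) = cis (y $ i)" using assms(3) by (simp add: torus_point_def vec_eq_iff)
  moreover have "\<bar>x $ i\<bar> < pi" "\<bar>y $ i\<bar> < pi" using assms by (auto simp: mem_period_cube)
  then have "Arg (cis (x $ i)) = x $ i" "Arg (cis (y $ i)) = y $ i"
    by (intro Arg_cis; simp add: abs_less_iff)+
  ultimately show "x $ i = y $ i" by metis
qed

text \<open>
  The torus is compact, so the Stone-Weierstrass theorem approximates a continuous function on it
  uniformly by real polynomials in the coordinates, which pull back to trigonometric polynomials.
\<close>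

lemma trig_approximable_continuous_torus:
  fixes f :: "complex ^ 'n \<Rightarrow> real"
  assumes "continuous_on UNIV f"
  shows "trig_approximable (\<lambda>x. complex_of_real (f (torus_point x)))"
  unfolding trig_approximable_def
proof (intro conjI allI impI)
  have meas: "(\<lambda>x. complex_of_real (f (torus_point x))) \<in> borel_measurable borel"
    by (intro borel_measurable_continuous_onI continuous_intros continuous_on_compose2[OF assms] torus_point_continuous) auto
  then show "(\<lambda>x. complex_of_real (f (torus_point x))) \<in> borel_measurable borel" .
  fix e :: real assume "e > 0"
  interpret finite_measure "cube_measure :: (real^'n) measure" by (rule finite_measure_cube_measure)
  define V where "V = measure (cube_measure :: (real^'n) measure) UNIV"
  have "V \<ge> 0" by (simp add: V_def)
  \<comment> \<open>uniform error \<open>d\<close> costs \<open>d\<^sup>2 V\<close> in the mean square; adding 1 avoids a case distinction on \<open>V\<close>\<close>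
  define d where "d = sqrt (e / (V + 1))"
  have "d > 0" using \<open>e > 0\<close> \<open>V \<ge> 0\<close> by (simp add: d_def)
  define K where "K = torus_point ` (cbox (\<chi> i. -pi) (\<chi> i. pi) :: (real^'n) set)"
  have "compact K" unfolding K_def by (intro compact_continuous_image torus_point_continuous compact_cbox)
  moreover have "continuous_on K f" using assms continuous_on_subset by blast
  ultimately obtain g where g: "real_polynomial_function g" "\<And>z. z \<in> K \<Longrightarrow> \<bar>f z - g z\<bar> < d"
    using \<open>d > 0\<close> Stone_Weierstrass_real_polynomial_function[of K f d] by blast
  let ?p = "\<lambda>x. complex_of_real (g (torus_point x))"
  have "(\<integral>\<^sup>+x. ennreal ((norm (complex_of_real (f (torus_point x)) - ?p x))\<^sup>2) \<partial>cube_measure) \<le>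
    (\<integral>\<^sup>+x. ennreal (d\<^sup>2) \<partial>(cube_measure :: (real^'n) measure))"
  proof (rule nn_integral_mono_AE)
    show "AE x in cube_measure. ennreal ((norm (complex_of_real (f (torus_point x)) - ?p x))\<^sup>2) \<le> ennreal (d\<^sup>2)"
      using AE_cube_measure
    proof eventually_elim
      case (elim x)
      then have "torus_point x \<in> K"
        unfolding K_def period_cube_def using box_subset_cbox by blast
      from g(2)[OF this] have "(\<bar>f (torus_point x) - g (torus_point x)\<bar>)\<^sup>2 \<le> d\<^sup>2"
        by (intro power_mono) auto
      moreover have "norm (complex_of_real (f (torus_point x)) - ?p x) = \<bar>f (torus_point x) - g (torus_point x)\<bar>"
        unfolding of_real_diff[symmetric] norm_of_real ..
      ultimately show ?case by (simp add: ennreal_leI)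
    qed
  qed
  also have "\<dots> = ennreal (d\<^sup>2 * V)"
    using \<open>V \<ge> 0\<close> by (simp add: emeasure_eq_measure V_def ennreal_mult)
  also have "\<dots> \<le> ennreal e"
  proof (rule ennreal_leI)
    have "d\<^sup>2 * V = e * (V / (V + 1))" using \<open>V \<ge> 0\<close> \<open>e > 0\<close> by (simp add: d_def)
    also have "\<dots> \<le> e * 1" using \<open>V \<ge> 0\<close> \<open>e > 0\<close> by (intro mult_left_mono) auto
    finally show "d\<^sup>2 * V \<le> e" by simp
  qed
  finally show "\<exists>p. trig_poly p \<and> (\<integral>\<^sup>+x. ennreal ((norm (complex_of_real (f (torus_point x)) - p x))\<^sup>2) \<partial>cube_measure) \<le> ennreal e"
    using trig_poly_real_polynomial[OF g(1)] by blast
qed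

text \<open>
  The projection maps \<open>C\<close> to a closed subset of the torus, and because of injectivity no other point of the
  cube lands in it. Hence the indicator of \<open>C\<close> is on the cube a limit of continuous functions of the
  distance to that closed set.
\<close>

lemma trig_approximable_compact:
  fixes C :: "(real ^ 'n) set"
  assumes "compact C" "C \<subseteq> period_cube"
  shows "trig_approximable (indicator C)"
proof (cases "C = {}")
  case True
  then show ?thesis using trig_approximable_zero by (simp add: indicator_def[abs_def])
next
  case False
  interpret finite_measure "cube_measure :: (real^'n) measure" by (rule finite_measure_cube_measure)
  define E where "E = torus_point ` C"
  have "compact E" unfolding E_def by (intro compact_continuous_image torus_point_continuous assms)
  then have "closed E" "E \<noteq> {}" using False by (auto simp: E_def compact_imp_closed)
  \<comment> \<open>equal to 1 on \<open>E\<close> and, away from the closed set \<open>E\<close>, to 0 for all large \<open>n\<close>\<close>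
  define f where "f n z = max 0 (1 - real n * infdist z E)" for n z
  have [measurable]: "C \<in> sets borel" using assms by (simp add: borel_compact)
  have app: "trig_approximable (\<lambda>x. complex_of_real (f n (torus_point x)))" for n
    by (rule trig_approximable_continuous_torus) (auto simp: f_def intro!: continuous_intros)
  note [measurable] = app[THEN trig_approximable_measurable]
  show ?thesis
  proof (rule trig_approximable_limit[OF _ app])
    have "(\<lambda>n. \<integral>\<^sup>+x. ennreal ((norm (indicator C x - complex_of_real (f n (torus_point x))))\<^sup>2) \<partial>cube_measure)
      \<longlonglongrightarrow> (\<integral>\<^sup>+x. 0 \<partial>(cube_measure :: (real^'n) measure))"
    proof (rule nn_integral_dominated_convergence[where w="\<lambda>_. 1"])
      show "AE x in cube_measure. ennreal ((norm (indicator C x - complex_of_real (f n (torus_point x))))\<^sup>2) \<le> 1" for n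
      proof (rule AE_I2)
        fix x :: "real^'n"
        have "0 \<le> f n (torus_point x)" "f n (torus_point x) \<le> 1"
          by (auto simp: f_def infdist_nonneg)
        then have "\<bar>indicator C x - f n (torus_point x)\<bar> \<le> 1" by (auto simp: indicator_def)
        moreover have "indicator C x - complex_of_real (f n (torus_point x)) = complex_of_real (indicator C x - f n (torus_point x))"
          by (simp add: indicator_def)
        then have "norm (indicator C x - complex_of_real (f n (torus_point x))) = \<bar>indicator C x - f n (torus_point x)\<bar>"
          by (simp only: norm_of_real)
        ultimately show "ennreal ((norm (indicator C x - complex_of_real (f n (torus_point x))))\<^sup>2) \<le> 1"
          by (simp add: abs_square_le_1)
      qed
      show "AE x in cube_measure. (\<lambda>n. ennreal ((norm (indicator C x - complex_of_real (f n (torus_point x))))\<^sup>2)) \<longlonglongrightarrow> 0"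
        using AE_cube_measure
      proof eventually_elim
        case (elim x)
        have "eventually (\<lambda>n. f n (torus_point x) = indicator C x) sequentially"
        proof (cases "x \<in> C")
          case True
          then have "infdist (torus_point x) E = 0" by (simp add: E_def)
          then show ?thesis using True by (simp add: f_def)
        next
          case False
          then have "torus_point x \<notin> E"
            using torus_point_inj elim assms(2) unfolding E_def by blast
          then have "infdist (torus_point x) E > 0"
            using \<open>closed E\<close> \<open>E \<noteq> {}\<close> by (simp add: infdist_pos_not_in_closed)
          then obtain m where m: "1 < real m * infdist (torus_point x) E"
            using reals_Archimedean3 by blast
          show ?thesis
          proof (rule eventually_sequentiallyI[of m])
            fix n assume "m \<le> n"
            then have "real m * infdist (torus_point x) E \<le> real n * infdist (torus_point x) E"
              by (intro mult_right_mono) (auto simp: infdist_nonneg)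
            with m False show "f n (torus_point x) = indicator C x" by (simp add: f_def)
          qed
        qed
        then have "eventually (\<lambda>n. ennreal ((norm (indicator C x - complex_of_real (f n (torus_point x))))\<^sup>2) = 0) sequentially"
          by eventually_elim (simp add: of_real_indicator)
        then show ?case by (rule tendsto_eventually)
      qed
    qed (auto simp: less_top[symmetric] emeasure_eq_measure)
    then show "(\<lambda>n. \<integral>\<^sup>+x. ennreal ((norm (indicator C x - complex_of_real (f n (torus_point x))))\<^sup>2) \<partial>cube_measure) \<longlonglongrightarrow> 0"
      by simp
  qed simp
qed

text \<open>
  Inner regularity: the part of \<open>A\<close> in the cube contains a compact set of almost the same measure.
\<close>

lemma trig_approximable_borel:
  fixes A :: "(real ^ 'n) set"
  assumes A [measurable]: "A \<in> sets borel"
  shows "trig_approximable (indicator A)"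
proof (rule trig_approximable_closed)
  fix e :: real assume "e > 0"
  interpret finite_measure "cube_measure :: (real^'n) measure" by (rule finite_measure_cube_measure)
  let ?N = "cube_measure :: (real^'n) measure"
  let ?B = "A \<inter> period_cube"
  have "emeasure ?N ?B = (SUP K\<in>{K. K \<subseteq> ?B \<and> compact K}. emeasure ?N K)"
    by (rule inner_regular) (auto simp: sets_cube_measure)
  moreover have "emeasure ?N ?B \<noteq> \<infinity>" by simp
  moreover have "{K. K \<subseteq> ?B \<and> compact K} \<noteq> {}" using compact_empty by blast
  ultimately have "\<exists>K\<in>{K. K \<subseteq> ?B \<and> compact K}. emeasure ?N ?B < emeasure ?N K + ennreal e"
    using \<open>e > 0\<close> by (intro SUP_approx_ennreal)
  then obtain K where K: "K \<subseteq> ?B" "compact K" "emeasure ?N ?B < emeasure ?N K + ennreal e"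
    by auto
  have [measurable]: "K \<in> sets borel" using K by (simp add: borel_compact)
  have "(\<integral>\<^sup>+x. ennreal ((norm (indicator A x - indicator K x :: complex))\<^sup>2) \<partial>?N) = (\<integral>\<^sup>+x. indicator (?B - K) x \<partial>?N)"
    by (rule nn_integral_cong_AE, use AE_cube_measure in eventually_elim)
      (use K in \<open>auto simp: indicator_def\<close>)
  also have "\<dots> = emeasure ?N (?B - K)" by (simp add: sets_cube_measure)
  also have "\<dots> = emeasure ?N ?B - emeasure ?N K"
    using K by (intro emeasure_Diff) (auto simp: sets_cube_measure)
  also have "\<dots> \<le> ennreal e"
    using K(3) by (simp add: ennreal_minus_le_iff less_imp_le)
  finally show "\<exists>g. trig_approximable g \<and> (\<integral>\<^sup>+x. ennreal ((norm (indicator A x - g x))\<^sup>2) \<partial>?N) \<le> ennreal e"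
    using trig_approximable_compact[of K] K by blast
qed simp

text \<open>
  Completeness of the characters: a square integrable function is a dominated limit of simple
  functions, and these are combinations of indicators of Borel sets.
\<close>

lemma trig_approximable_L2:
  fixes f :: "real ^ 'n \<Rightarrow> complex"
  assumes f [measurable]: "f \<in> borel_measurable borel"
    and fin: "(\<integral>\<^sup>+x. ennreal ((norm (f x))\<^sup>2) \<partial>cube_measure) < \<infinity>"
  shows "trig_approximable f"
proof -
  obtain s where s: "\<And>i. simple_function borel (s i)" "\<And>x. (\<lambda>i. s i x) \<longlonglongrightarrow> f x"
    "\<And>i x. norm (s i x) \<le> 2 * norm (f x)"
  proof -
    from borel_measurable_implies_sequence_metric[OF f, of 0] obtain s where
      "\<forall>i. simple_function borel (s i)" "\<forall>x\<in>space borel. (\<lambda>i. s i x) \<longlonglongrightarrow> f x"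
      "\<forall>i. \<forall>x\<in>space borel. dist (s i x) 0 \<le> 2 * dist (f x) 0"
      by blast
    then show thesis by (intro that[of s]) simp_all
  qed
  have app: "trig_approximable (s i)" for i
  proof -
    have "s i = (\<lambda>x. \<Sum>y\<in>s i ` UNIV. y * indicator (s i -` {y}) x)"
    proof
      fix x
      have "(\<Sum>y\<in>s i ` UNIV. y * indicator (s i -` {y}) x) = (\<Sum>y\<in>s i ` UNIV. if y = s i x then y else 0)"
        by (intro sum.cong) (auto simp: indicator_def)
      then show "s i x = (\<Sum>y\<in>s i ` UNIV. y * indicator (s i -` {y}) x)"
        using s(1)[of i] by (simp add: simple_function_def)
    qed
    moreover have "trig_approximable (\<lambda>x. \<Sum>y\<in>s i ` UNIV. y * indicator (s i -` {y}) x)"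
      using s(1)[of i]
      by (intro trig_approximable_sum trig_approximable_cmult trig_approximable_borel)
        (auto simp: simple_function_def)
    ultimately show ?thesis by simp
  qed
  note [measurable] = app[THEN trig_approximable_measurable]
  show ?thesis
  proof (rule trig_approximable_limit[OF f app])
    have "(\<lambda>n. \<integral>\<^sup>+x. ennreal ((norm (f x - s n x))\<^sup>2) \<partial>cube_measure)
      \<longlonglongrightarrow> (\<integral>\<^sup>+x. 0 \<partial>(cube_measure :: (real^'n) measure))"
    proof (rule nn_integral_dominated_convergence[where w="\<lambda>x. 9 * ennreal ((norm (f x))\<^sup>2)"])
      show "AE x in cube_measure. ennreal ((norm (f x - s n x))\<^sup>2) \<le> 9 * ennreal ((norm (f x))\<^sup>2)" for n
      proof (rule AE_I2)
        fix x
        have "norm (f x - s n x) \<le> 3 * norm (f x)"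
          using norm_triangle_ineq4[of "f x" "s n x"] s(3)[of n x] by simp
        then have "(norm (f x - s n x))\<^sup>2 \<le> (3 * norm (f x))\<^sup>2" by (intro power_mono) auto
        also have "\<dots> = 9 * (norm (f x))\<^sup>2" by (simp add: power_mult_distrib)
        finally show "ennreal ((norm (f x - s n x))\<^sup>2) \<le> 9 * ennreal ((norm (f x))\<^sup>2)"
          by (metis ennreal_leI ennreal_mult'' ennreal_numeral zero_le_numeral zero_le_power2)
      qed
      show "(\<integral>\<^sup>+x. 9 * ennreal ((norm (f x))\<^sup>2) \<partial>cube_measure) < \<infinity>"
        using fin by (simp add: nn_integral_cmult ennreal_mult_less_top)
      show "AE x in cube_measure. (\<lambda>n. ennreal ((norm (f x - s n x))\<^sup>2)) \<longlonglongrightarrow> 0"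
      proof (rule AE_I2)
        fix x
        have "(\<lambda>n. ennreal ((norm (f x - s n x))\<^sup>2)) \<longlonglongrightarrow> ennreal ((norm (f x - f x))\<^sup>2)"
          by (intro tendsto_ennrealI tendsto_intros s)
        then show "(\<lambda>n. ennreal ((norm (f x - s n x))\<^sup>2)) \<longlonglongrightarrow> 0" by simp
      qed
    qed auto
    then show "(\<lambda>n. \<integral>\<^sup>+x. ennreal ((norm (f x - s n x))\<^sup>2) \<partial>cube_measure) \<longlonglongrightarrow> 0" by simp
  qed
qed

section \<open>Parseval's identity for Fourier series\<close>

definition fourier_coeff :: "(real ^ 'n \<Rightarrow> complex) \<Rightarrow> int ^ 'n \<Rightarrow> complex" where
  "fourier_coeff f k = (\<integral>x. f x * cnj (character k x) \<partial>cube_measure)"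

lemma cube_measure_square_integrable_imp_integrable:
  fixes f :: "real ^ 'n \<Rightarrow> complex"
  assumes f [measurable]: "f \<in> borel_measurable borel"
    and sq: "integrable cube_measure (\<lambda>x. (norm (f x))\<^sup>2)"
  shows "integrable cube_measure f"
proof -
  interpret finite_measure "cube_measure :: (real^'n) measure" by (rule finite_measure_cube_measure)
  show ?thesis
  proof (rule Bochner_Integration.integrable_bound)
    show "integrable cube_measure (\<lambda>x. 1 + (norm (f x))\<^sup>2)" using sq by simp
    show "AE x in cube_measure. norm (f x) \<le> norm (1 + (norm (f x))\<^sup>2)"
    proof (rule AE_I2)
      fix x
      have "norm (f x) \<le> 1 + (norm (f x))\<^sup>2"
        using sum_squares_bound[of 1 "norm (f x)"] by (simp add: power2_eq_square) (smt (verit) norm_ge_zero)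
      then show "norm (f x) \<le> norm (1 + (norm (f x))\<^sup>2)" by simp
    qed
  qed simp
qed

lemma norm_diff_square_complex:
  "(norm (u - v))\<^sup>2 = (norm u)\<^sup>2 - 2 * Re (u * cnj v) + Re (v * cnj v)" for u v :: complex
  unfolding cmod_power2 by (simp add: power2_eq_square algebra_simps)

text \<open>
  Expanding the square with the orthogonality of the characters. For fixed \<open>F\<close> the right hand side is
  minimized by the normalized Fourier coefficients of \<open>f\<close>, which yields Bessel's inequality as well as the best
  approximation property used for Parseval's identity.
\<close>

lemma integral_diff_trig_poly:
  fixes f :: "real ^ 'n \<Rightarrow> complex"
  assumes f [measurable]: "f \<in> borel_measurable borel"
    and sq: "integrable cube_measure (\<lambda>x. (norm (f x))\<^sup>2)" and F: "finite F"
  defines "V \<equiv> (2 * pi) ^ CARD('n)"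
  shows "(\<integral>x. (norm (f x - (\<Sum>k\<in>F. a k * character k x)))\<^sup>2 \<partial>cube_measure) =
    (\<integral>x. (norm (f x))\<^sup>2 \<partial>cube_measure) - 2 * Re (\<Sum>k\<in>F. cnj (a k) * fourier_coeff f k) + V * (\<Sum>k\<in>F. (norm (a k))\<^sup>2)"
    and "integrable cube_measure (\<lambda>x. (norm (f x - (\<Sum>k\<in>F. a k * character k x)))\<^sup>2)"
proof -
  interpret finite_measure "cube_measure :: (real^'n) measure" by (rule finite_measure_cube_measure)
  let ?p = "\<lambda>x. \<Sum>k\<in>F. a k * character k x"
  have f_int: "integrable cube_measure f"
    by (rule cube_measure_square_integrable_imp_integrable[OF f sq])
  have fc: "integrable cube_measure (\<lambda>x. f x * cnj (character k x))" for k
    by (rule Bochner_Integration.integrable_bound[OF f_int]) (auto simp: norm_mult)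
  have cc: "integrable cube_measure (\<lambda>x. character k x * cnj (character l x))" for k l :: "int^'n"
    by (rule integrable_const_bound[of _ 1]) (auto simp: norm_mult)
  have orth: "(\<integral>x. character k x * cnj (character l x) \<partial>cube_measure) = (if k = l then V else 0)" for k l :: "int^'n"
    using integral_character[of "k - l"]
    by (simp add: character_add character_minus V_def flip: character_minus character_add)
  have fp: "integrable cube_measure (\<lambda>x. f x * cnj (?p x))"
  proof -
    have "(\<lambda>x. f x * cnj (?p x)) = (\<lambda>x. \<Sum>k\<in>F. cnj (a k) * (f x * cnj (character k x)))"
      by (simp add: sum_distrib_left mult_ac)
    then show ?thesis using fc by simp
  qed
  have fp_val: "(\<integral>x. f x * cnj (?p x) \<partial>cube_measure) = (\<Sum>k\<in>F. cnj (a k) * fourier_coeff f k)"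
  proof -
    have "(\<lambda>x. f x * cnj (?p x)) = (\<lambda>x. \<Sum>k\<in>F. cnj (a k) * (f x * cnj (character k x)))"
      by (simp add: sum_distrib_left mult_ac)
    then show ?thesis using fc by (simp add: fourier_coeff_def)
  qed
  have pp_eq: "(\<lambda>x. ?p x * cnj (?p x)) = (\<lambda>x. \<Sum>k\<in>F. \<Sum>l\<in>F. a k * cnj (a l) * (character k x * cnj (character l x)))"
    by (subst sum.swap, simp add: sum_distrib_left sum_distrib_right mult_ac)
  have pp: "integrable cube_measure (\<lambda>x. ?p x * cnj (?p x))"
    unfolding pp_eq using cc by simp
  have pp_val: "(\<integral>x. ?p x * cnj (?p x) \<partial>cube_measure) = of_real (V * (\<Sum>k\<in>F. (norm (a k))\<^sup>2))"
  proof -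
    have "(\<integral>x. ?p x * cnj (?p x) \<partial>cube_measure) = (\<Sum>k\<in>F. \<Sum>l\<in>F. a k * cnj (a l) * (if k = l then V else 0))"
      unfolding pp_eq using cc by (simp add: orth)
    also have "\<dots> = (\<Sum>k\<in>F. a k * cnj (a k) * V)"
      using F by (intro sum.cong) (simp_all add: if_distrib cong: if_cong)
    also have "\<dots> = of_real (V * (\<Sum>k\<in>F. (norm (a k))\<^sup>2))"
      by (simp add: sum_distrib_left mult.commute flip: complex_norm_square)
    finally show ?thesis .
  qed
  define A where "A = (\<lambda>x. f x * cnj (?p x))"
  define B where "B = (\<lambda>x. ?p x * cnj (?p x))"
  have A: "integrable cube_measure A" and B: "integrable cube_measure B"
    using fp pp by (simp_all only: A_def B_def)
  have pt: "(norm (f x - ?p x))\<^sup>2 = (norm (f x))\<^sup>2 - 2 * Re (A x) + Re (B x)" for x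
    unfolding A_def B_def by (rule norm_diff_square_complex)
  show "integrable cube_measure (\<lambda>x. (norm (f x - ?p x))\<^sup>2)"
    unfolding pt using sq A B by simp
  have "(\<integral>x. (norm (f x - ?p x))\<^sup>2 \<partial>cube_measure) =
    (\<integral>x. (norm (f x))\<^sup>2 \<partial>cube_measure) - 2 * Re (integral\<^sup>L cube_measure A) + Re (integral\<^sup>L cube_measure B)"
    unfolding pt using sq A B by simp
  also have "\<dots> = (\<integral>x. (norm (f x))\<^sup>2 \<partial>cube_measure) - 2 * Re (\<Sum>k\<in>F. cnj (a k) * fourier_coeff f k) + V * (\<Sum>k\<in>F. (norm (a k))\<^sup>2)"
    unfolding A_def B_def fp_val pp_val Re_complex_of_real ..
  finally show "(\<integral>x. (norm (f x - ?p x))\<^sup>2 \<partial>cube_measure) =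
    (\<integral>x. (norm (f x))\<^sup>2 \<partial>cube_measure) - 2 * Re (\<Sum>k\<in>F. cnj (a k) * fourier_coeff f k) + V * (\<Sum>k\<in>F. (norm (a k))\<^sup>2)" .
qed

text \<open>
  Bessel's inequality bounds the partial sums. Conversely, a trigonometric polynomial close to \<open>f\<close> is
  no better than the partial Fourier sum over its spectrum, so density of the trigonometric
  polynomials makes the partial sums come arbitrarily close to the bound.
\<close>

theorem parseval_cube:
  fixes f :: "real ^ 'n \<Rightarrow> complex"
  assumes f [measurable]: "f \<in> borel_measurable borel"
    and sq: "integrable cube_measure (\<lambda>x. (norm (f x))\<^sup>2)"
  shows "((\<lambda>k. (norm (fourier_coeff f k))\<^sup>2) has_sum (2 * pi) ^ CARD('n) * (\<integral>x. (norm (f x))\<^sup>2 \<partial>cube_measure)) UNIV"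
proof -
  define V :: real where "V = (2 * pi) ^ CARD('n)"
  have "V > 0" by (simp add: V_def)
  define I where "I = (\<integral>x. (norm (f x))\<^sup>2 \<partial>cube_measure)"
  define c where "c = fourier_coeff f"
  \<comment> \<open>no choice of coefficients beats the Fourier coefficients \<open>c k / V\<close>\<close>
  have lower: "(\<integral>x. (norm (f x - (\<Sum>k\<in>F. a k * character k x)))\<^sup>2 \<partial>cube_measure) \<ge> I - (\<Sum>k\<in>F. (norm (c k))\<^sup>2) / V"
    if F: "finite F" for F a
  proof -
    have "2 * Re (cnj (a k) * c k) \<le> V * (norm (a k))\<^sup>2 + (norm (c k))\<^sup>2 / V" for k
    proof -
      have "Re (cnj (a k) * c k) \<le> norm (a k) * norm (c k)"
        using complex_Re_le_cmod[of "cnj (a k) * c k"] by (simp add: norm_mult)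
      moreover have "2 * (norm (a k) * norm (c k)) \<le> V * (norm (a k))\<^sup>2 + (norm (c k))\<^sup>2 / V"
      proof -
        have "0 \<le> (V * norm (a k) - norm (c k))\<^sup>2 / V" using \<open>V > 0\<close> by simp
        also have "\<dots> = V * (norm (a k))\<^sup>2 + (norm (c k))\<^sup>2 / V - 2 * (norm (a k) * norm (c k))"
          using \<open>V > 0\<close> by (simp add: power2_eq_square field_simps)
        finally show ?thesis by simp
      qed
      ultimately show ?thesis by linarith
    qed
    then have "(\<Sum>k\<in>F. 2 * Re (cnj (a k) * c k)) \<le> (\<Sum>k\<in>F. V * (norm (a k))\<^sup>2 + (norm (c k))\<^sup>2 / V)"
      by (rule sum_mono)
    then have "2 * Re (\<Sum>k\<in>F. cnj (a k) * c k) \<le> V * (\<Sum>k\<in>F. (norm (a k))\<^sup>2) + (\<Sum>k\<in>F. (norm (c k))\<^sup>2) / V"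
      by (simp add: sum.distrib sum_distrib_left sum_divide_distrib Re_sum)
    then show ?thesis
      unfolding integral_diff_trig_poly(1)[OF f sq F] I_def c_def V_def by simp
  qed
  have bessel: "(\<Sum>k\<in>F. (norm (c k))\<^sup>2) \<le> V * I" if F: "finite F" for F
  proof -
    have re: "Re (cnj (c k / V) * c k) = (norm (c k))\<^sup>2 / V" for k
      using cmod_power2[of "c k"] by (simp add: power2_eq_square add_divide_distrib)
    have "0 \<le> (\<integral>x. (norm (f x - (\<Sum>k\<in>F. c k / V * character k x)))\<^sup>2 \<partial>cube_measure)" by simp
    also have "\<dots> = I - 2 * Re (\<Sum>k\<in>F. cnj (c k / V) * c k) + V * (\<Sum>k\<in>F. (norm (c k / V))\<^sup>2)"
      unfolding integral_diff_trig_poly(1)[OF f sq F] I_def c_def V_def ..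
    also have "\<dots> = I - (\<Sum>k\<in>F. (norm (c k))\<^sup>2) / V"
      using \<open>V > 0\<close> unfolding Re_sum re
      by (simp add: norm_divide power_divide sum_divide_distrib[symmetric] power2_eq_square)
    finally show ?thesis using \<open>V > 0\<close> by (simp add: field_simps)
  qed
  have "trig_approximable f"
  proof (rule trig_approximable_L2[OF f])
    have "(\<integral>\<^sup>+x. ennreal ((norm (f x))\<^sup>2) \<partial>cube_measure) = ennreal I"
      unfolding I_def by (rule nn_integral_eq_integral[OF sq]) simp
    then show "(\<integral>\<^sup>+x. ennreal ((norm (f x))\<^sup>2) \<partial>cube_measure) < \<infinity>" by simp
  qed
  then have approx: "\<exists>F. finite F \<and> V * I - e \<le> (\<Sum>k\<in>F. (norm (c k))\<^sup>2)" if "e > 0" for e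
  proof -
    have "e / V > 0" using that \<open>V > 0\<close> by simp
    then obtain p where p: "trig_poly p" "(\<integral>\<^sup>+x. ennreal ((norm (f x - p x))\<^sup>2) \<partial>cube_measure) \<le> ennreal (e / V)"
      using \<open>trig_approximable f\<close> unfolding trig_approximable_def by blast
    obtain F a where F: "finite F" and p_eq: "p = (\<lambda>x. \<Sum>k\<in>F. a k * character k x)"
      using p(1) by (rule trig_poly_eq_sum)
    have "ennreal (\<integral>x. (norm (f x - p x))\<^sup>2 \<partial>cube_measure) \<le> ennreal (e / V)"
      using p(2) nn_integral_eq_integral[OF integral_diff_trig_poly(2)[OF f sq F, of a]] unfolding p_eq by simp
    then have "(\<integral>x. (norm (f x - p x))\<^sup>2 \<partial>cube_measure) \<le> e / V"
      using \<open>e / V > 0\<close> by (subst (asm) ennreal_le_iff) auto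
    then have "I - (\<Sum>k\<in>F. (norm (c k))\<^sup>2) / V \<le> e / V"
      using lower[OF F, of a] unfolding p_eq by linarith
    then have "V * (I - (\<Sum>k\<in>F. (norm (c k))\<^sup>2) / V) \<le> V * (e / V)"
      using \<open>V > 0\<close> by (intro mult_left_mono) auto
    then show ?thesis using F \<open>V > 0\<close> by (intro exI[of _ F]) (simp add: right_diff_distrib)
  qed
  have "((\<lambda>k. (norm (c k))\<^sup>2) has_sum (SUP F\<in>{F. finite F \<and> F \<subseteq> UNIV}. \<Sum>k\<in>F. (norm (c k))\<^sup>2)) UNIV"
    by (rule nonneg_bdd_above_has_sum) (auto intro!: bdd_aboveI[of _ "V * I"] bessel)
  moreover have "(SUP F\<in>{F. finite F \<and> F \<subseteq> UNIV}. \<Sum>k\<in>F. (norm (c k))\<^sup>2) = V * I"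
  proof (rule cSup_eq_non_empty)
    show "(\<lambda>F. \<Sum>k\<in>F. (norm (c k))\<^sup>2) ` {F. finite F \<and> F \<subseteq> UNIV} \<noteq> {}" by auto
    show "x \<le> V * I" if "x \<in> (\<lambda>F. \<Sum>k\<in>F. (norm (c k))\<^sup>2) ` {F. finite F \<and> F \<subseteq> UNIV}" for x
      using that bessel by auto
    show "V * I \<le> y" if *: "\<And>x. x \<in> (\<lambda>F. \<Sum>k\<in>F. (norm (c k))\<^sup>2) ` {F. finite F \<and> F \<subseteq> UNIV} \<Longrightarrow> x \<le> y" for y
    proof (rule field_le_epsilon)
      fix e :: real assume "e > 0"
      then obtain F where "finite F" "V * I - e \<le> (\<Sum>k\<in>F. (norm (c k))\<^sup>2)" using approx by blast
      moreover from this * have "(\<Sum>k\<in>F. (norm (c k))\<^sup>2) \<le> y" by auto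
      ultimately show "V * I \<le> y + e" by simp
    qed
  qed
  ultimately show ?thesis by (simp add: c_def V_def I_def)
qed

text \<open>
  Parseval's identity on a cube of side \<open>2 \<pi> a\<close>, for functions supported in the closed ball of radius \<open>a \<pi>\<close>.
  The ball meets the boundary of the cube, but only in a null set.
\<close>

lemma parseval_scaled:
  fixes f :: "real ^ 'n \<Rightarrow> complex"
  assumes f [measurable]: "f \<in> borel_measurable borel"
    and sq: "(\<integral>\<^sup>+x. ennreal ((norm (f x))\<^sup>2) \<partial>lborel) < \<infinity>"
    and a: "a > 0" and supp: "\<And>x. norm x > a * pi \<Longrightarrow> f x = 0"
  shows "(\<integral>\<^sup>+k. ennreal ((norm (\<integral>x. f x * cnj (character k ((1 / a) *\<^sub>R x)) \<partial>lborel))\<^sup>2) \<partial>count_space UNIV) =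
    ennreal ((2 * pi * a) ^ CARD('n)) * (\<integral>\<^sup>+x. ennreal ((norm (f x))\<^sup>2) \<partial>lborel)"
proof -
  define g where "g y = f (a *\<^sub>R y)" for y
  have [measurable]: "g \<in> borel_measurable borel" unfolding g_def by measurable
  define V where "V = a ^ CARD('n)"
  have V: "V > 0" using a by (simp add: V_def)
  have g_supp: "AE y in lborel. indicator period_cube y *\<^sub>R g y = g y"
  proof -
    have "negligible (cbox (\<chi> i. -pi) (\<chi> i. pi) - box (\<chi> i. -pi) (\<chi> i. pi) :: (real^'n) set)"
      by (rule negligible_frontier_interval)
    then have "cbox (\<chi> i. -pi) (\<chi> i. pi) - box (\<chi> i. -pi) (\<chi> i. pi) \<in> null_sets (lborel :: (real^'n) measure)"
      by (subst (asm) negligible_iff_null_sets) (auto simp: null_sets_completion_iff)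
    then have "AE y :: real^'n in lborel. y \<notin> cbox (\<chi> i. -pi) (\<chi> i. pi) - box (\<chi> i. -pi) (\<chi> i. pi)"
      by (rule AE_not_in)
    then show ?thesis
    proof eventually_elim
      case (elim y)
      show ?case
      proof (cases "y \<in> period_cube")
        case False
        with elim have "y \<notin> cbox (\<chi> i. -pi) (\<chi> i. pi)" by (auto simp: period_cube_def)
        then obtain i where "\<not> (- pi \<le> y $ i \<and> y $ i \<le> pi)" by (auto simp: mem_box_cart)
        then have "pi < norm y" using component_le_norm_cart[of y i] by linarith
        then have "norm (a *\<^sub>R y) > a * pi" using a by simp
        then show ?thesis by (simp add: g_def supp)
      qed simp
    qed
  qed
  have g_norm: "(\<integral>\<^sup>+y. ennreal ((norm (g y))\<^sup>2) \<partial>cube_measure) = (\<integral>\<^sup>+y. ennreal ((norm (g y))\<^sup>2) \<partial>lborel)"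
    unfolding nn_integral_cube_measure[OF measurable_compose[OF _ measurable_ennreal], of "\<lambda>y. (norm (g y))\<^sup>2", simplified]
    by (rule nn_integral_cong_AE, use g_supp in eventually_elim) (auto simp: indicator_def split: if_splits)
  have f_g: "(\<integral>\<^sup>+x. ennreal ((norm (f x))\<^sup>2) \<partial>lborel) = ennreal V * (\<integral>\<^sup>+y. ennreal ((norm (g y))\<^sup>2) \<partial>lborel)"
    using a by (subst nn_integral_lborel_affine[where c=a and t=0]) (simp_all add: V_def g_def)
  have fin: "(\<integral>\<^sup>+y. ennreal ((norm (g y))\<^sup>2) \<partial>lborel) < \<infinity>"
    using sq V unfolding f_g by (auto simp: ennreal_mult_less_top)
  have g_sq: "integrable cube_measure (\<lambda>y. (norm (g y))\<^sup>2)"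
    using fin by (intro integrableI_bounded) (auto simp: g_norm)
  have coeff: "(\<integral>x. f x * cnj (character k ((1 / a) *\<^sub>R x)) \<partial>lborel) = V *\<^sub>R fourier_coeff g k" for k
  proof -
    have "(\<integral>x. f x * cnj (character k ((1 / a) *\<^sub>R x)) \<partial>lborel) = V *\<^sub>R (\<integral>y. g y * cnj (character k y) \<partial>lborel)"
      using a by (subst integral_lborel_affine[where c=a and t=0]) (simp_all add: V_def g_def)
    also have "(\<integral>y. g y * cnj (character k y) \<partial>lborel) = fourier_coeff g k"
      unfolding fourier_coeff_def
      by (subst integral_cube_measure, measurable, rule integral_cong_AE, measurable, use g_supp in eventually_elim)
        (metis mult_scaleR_left)
    finally show ?thesis .
  qed
  have "(\<integral>\<^sup>+k. ennreal ((norm (V *\<^sub>R fourier_coeff g k))\<^sup>2) \<partial>count_space UNIV) =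
     (\<integral>\<^sup>+k. ennreal (V\<^sup>2) * ennreal ((norm (fourier_coeff g k))\<^sup>2) \<partial>count_space UNIV)"
    by (simp add: power_mult_distrib ennreal_mult)
  also have "\<dots> = ennreal (V\<^sup>2) * (\<integral>\<^sup>+k. ennreal ((norm (fourier_coeff g k))\<^sup>2) \<partial>count_space UNIV)"
    by (simp add: nn_integral_cmult)
  also have "(\<integral>\<^sup>+k. ennreal ((norm (fourier_coeff g k))\<^sup>2) \<partial>count_space UNIV) =
     ennreal ((2 * pi) ^ CARD('n) * (\<integral>y. (norm (g y))\<^sup>2 \<partial>cube_measure))"
    by (rule has_sum_imp_nn_integral_count_space[OF _ parseval_cube]) (use g_sq in auto)
  also have "\<dots> = ennreal ((2 * pi) ^ CARD('n)) * (\<integral>\<^sup>+y. ennreal ((norm (g y))\<^sup>2) \<partial>lborel)"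
    unfolding g_norm[symmetric] nn_integral_eq_integral[OF g_sq, simplified] by (rule ennreal_mult) auto
  also have "ennreal (V\<^sup>2) * \<dots> = ennreal ((2 * pi * a) ^ CARD('n)) * (\<integral>\<^sup>+x. ennreal ((norm (f x))\<^sup>2) \<partial>lborel)"
  proof -
    have "V\<^sup>2 * (2 * pi) ^ CARD('n) = (2 * pi * a) ^ CARD('n) * V"
      by (simp add: V_def power_mult_distrib power2_eq_square)
    then have "ennreal (V\<^sup>2) * ennreal ((2 * pi) ^ CARD('n)) = ennreal ((2 * pi * a) ^ CARD('n)) * ennreal V"
      using V a by (subst (1 2) ennreal_mult[symmetric]) auto
    then show ?thesis unfolding f_g mult.assoc[symmetric] by (simp only:)
  qed
  finally show ?thesis unfolding coeff .
qed

corollary parseval_scaled_conjugate: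
  fixes f :: "real ^ 'n \<Rightarrow> complex"
  assumes f [measurable]: "f \<in> borel_measurable borel"
    and sq: "(\<integral>\<^sup>+x. ennreal ((norm (f x))\<^sup>2) \<partial>lborel) < \<infinity>"
    and a: "a > 0" and supp: "\<And>x. norm x > a * pi \<Longrightarrow> f x = 0"
  shows "(\<integral>\<^sup>+k. ennreal ((norm (\<integral>x. f x * character k ((1 / a) *\<^sub>R x) \<partial>lborel))\<^sup>2) \<partial>count_space UNIV) =
    ennreal ((2 * pi * a) ^ CARD('n)) * (\<integral>\<^sup>+x. ennreal ((norm (f x))\<^sup>2) \<partial>lborel)"
proof -
  have "(\<integral>x. cnj (f x) * cnj (character k ((1 / a) *\<^sub>R x)) \<partial>lborel) = cnj (\<integral>x. f x * character k ((1 / a) *\<^sub>R x) \<partial>lborel)" for k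
    using Bochner_Integration.integral_cnj[of lborel "\<lambda>x. f x * character k ((1 / a) *\<^sub>R x)"] by simp
  with parseval_scaled[of "\<lambda>x. cnj (f x)" a] sq a supp show ?thesis by simp
qed

section \<open>Plancherel's identity for functions of bounded support\<close>

definition unit_cell :: "(real ^ 'n) set" where
  "unit_cell = {x. \<forall>i. 0 \<le> x $ i \<and> x $ i < 1}"

lemma unit_cell_borel [measurable]: "unit_cell \<in> sets borel"
  unfolding unit_cell_def by measurable

text \<open>
  The half-open unit cell lies between the open and the closed unit box, which have measure 1.
\<close>

lemma emeasure_unit_cell: "emeasure lborel (unit_cell :: (real ^ 'n) set) = 1"
proof (rule antisym)
  have prod1: "(\<Prod>b\<in>Basis. ((\<chi> i. 1) :: real^'n) \<bullet> b) = 1"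
    by (rule prod.neutral) (auto simp: Basis_vec_def inner_axis)
  have le: "(0 :: real^'n) \<bullet> b \<le> ((\<chi> i. 1) :: real^'n) \<bullet> b" if "b \<in> Basis" for b
    using that by (auto simp: Basis_vec_def inner_axis)
  have "emeasure lborel (unit_cell :: (real^'n) set) \<le> emeasure lborel (cbox 0 (\<chi> i. 1) :: (real^'n) set)"
    by (rule emeasure_mono) (auto simp: unit_cell_def mem_box_cart less_imp_le)
  also have "\<dots> = 1" using le prod1 by (simp add: emeasure_lborel_cbox_eq)
  finally show "emeasure lborel (unit_cell :: (real^'n) set) \<le> 1" .
  have "1 = emeasure lborel (box 0 (\<chi> i. 1) :: (real^'n) set)"
    using le prod1 by (simp add: emeasure_lborel_box_eq)
  also have "\<dots> \<le> emeasure lborel (unit_cell :: (real^'n) set)"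
    by (rule emeasure_mono) (auto simp: unit_cell_def mem_box_cart less_imp_le)
  finally show "1 \<le> emeasure lborel (unit_cell :: (real^'n) set)" .
qed

lemma unit_cell_translates:
  "x - lattice_point k \<in> unit_cell \<longleftrightarrow> k = (\<chi> i. \<lfloor>x $ i\<rfloor>)"
  by (auto simp: unit_cell_def lattice_point_def vec_eq_iff eq_commute[of "_ $ _" "\<lfloor>_\<rfloor>"] floor_eq_iff algebra_simps)

text \<open>
  The integer translates of the half-open unit cell partition the space.
\<close>

lemma nn_integral_unit_cell_translates:
  fixes F :: "real ^ 'n \<Rightarrow> ennreal"
  assumes [measurable]: "F \<in> borel_measurable borel"
  shows "(\<integral>\<^sup>+x. F x \<partial>lborel) =
    (\<integral>\<^sup>+\<zeta>. (\<integral>\<^sup>+k. F (\<zeta> + lattice_point k) \<partial>count_space UNIV) * indicator unit_cell \<zeta> \<partial>lborel)"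
proof -
  have "(\<integral>\<^sup>+x. F x \<partial>lborel) = (\<integral>\<^sup>+x. \<integral>\<^sup>+k. F x * indicator unit_cell (x - lattice_point k) \<partial>count_space UNIV \<partial>lborel)"
  proof (rule nn_integral_cong)
    fix x :: "real^'n"
    have "(\<integral>\<^sup>+k. F x * indicator unit_cell (x - lattice_point k) \<partial>count_space UNIV) =
       (\<Sum>k\<in>{\<chi> i. \<lfloor>x $ i\<rfloor>}. F x * indicator unit_cell (x - lattice_point k))"
      by (rule nn_integral_count_space') (auto simp: indicator_def unit_cell_translates)
    also have "\<dots> = F x" using unit_cell_translates[of x] by (simp add: indicator_def)
    finally show "F x = (\<integral>\<^sup>+k. F x * indicator unit_cell (x - lattice_point k) \<partial>count_space UNIV)" ..
  qed
  also have "\<dots> = (\<integral>\<^sup>+k. \<integral>\<^sup>+x. F x * indicator unit_cell (x - lattice_point k) \<partial>lborel \<partial>count_space UNIV)"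
    by (rule nn_integral_count_space_nn_integral) auto
  also have "\<dots> = (\<integral>\<^sup>+k. \<integral>\<^sup>+\<zeta>. F (\<zeta> + lattice_point k) * indicator unit_cell \<zeta> \<partial>lborel \<partial>count_space UNIV)"
  proof (rule nn_integral_cong)
    fix k :: "int^'n"
    show "(\<integral>\<^sup>+x. F x * indicator unit_cell (x - lattice_point k) \<partial>lborel) =
      (\<integral>\<^sup>+\<zeta>. F (\<zeta> + lattice_point k) * indicator unit_cell \<zeta> \<partial>lborel)"
      by (subst nn_integral_lborel_affine[where c=1 and t="lattice_point k"]) (simp_all add: add.commute)
  qed
  also have "\<dots> = (\<integral>\<^sup>+\<zeta>. \<integral>\<^sup>+k. F (\<zeta> + lattice_point k) * indicator unit_cell \<zeta> \<partial>count_space UNIV \<partial>lborel)"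
    by (rule nn_integral_count_space_nn_integral[symmetric]) auto
  also have "\<dots> = (\<integral>\<^sup>+\<zeta>. (\<integral>\<^sup>+k. F (\<zeta> + lattice_point k) \<partial>count_space UNIV) * indicator unit_cell \<zeta> \<partial>lborel)"
    by (simp add: nn_integral_multc)
  finally show ?thesis .
qed

text \<open>
  Plancherel's identity by averaging Parseval's: for \<open>f\<close> supported in a cube of side \<open>2 \<pi> a\<close>, the values of
  its Fourier integral on the shifted lattice \<open>(\<zeta> + \<int>\<^sup>n) / a\<close> are the Fourier coefficients of \<open>f\<close> multiplied by a
  function of modulus 1. Their squares therefore have the same sum for every \<open>\<zeta>\<close>, and integration over \<open>\<zeta>\<close> in a
  unit cell turns the sum into the integral over the whole space.
\<close>

theorem plancherel_compact_support:
  fixes f :: "real ^ 'n \<Rightarrow> complex"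
  assumes f [measurable]: "f \<in> borel_measurable borel"
    and sq: "(\<integral>\<^sup>+x. ennreal ((norm (f x))\<^sup>2) \<partial>lborel) < \<infinity>"
    and supp: "\<And>x. norm x > R \<Longrightarrow> f x = 0"
  shows "(\<integral>\<^sup>+\<xi>. ennreal ((norm (\<integral>x. f x * cis (- (x \<bullet> \<xi>)) \<partial>lborel))\<^sup>2) \<partial>lborel) =
    ennreal ((2 * pi) ^ CARD('n)) * (\<integral>\<^sup>+x. ennreal ((norm (f x))\<^sup>2) \<partial>lborel)"
proof -
  \<comment> \<open>any scale whose ball of radius \<open>a \<pi>\<close> contains the support\<close>
  define a where "a = \<bar>R\<bar> + 1"
  have a: "a > 0" by (simp add: a_def add_nonneg_pos)
  have "\<bar>R\<bar> + 1 \<le> (\<bar>R\<bar> + 1) * pi" using pi_gt3 by (intro mult_le_cancel_left1[THEN iffD2]) auto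
  then have supp': "norm x > a * pi \<Longrightarrow> f x = 0" for x using supp[of x] by (auto simp: a_def)
  define Ff where "Ff \<xi> = (\<integral>x. f x * cis (- (x \<bullet> \<xi>)) \<partial>lborel)" for \<xi>
  have Ff_meas [measurable]: "Ff \<in> borel_measurable borel"
    unfolding Ff_def by measurable
  have "(\<integral>\<^sup>+\<xi>. ennreal ((norm (Ff \<xi>))\<^sup>2) \<partial>lborel) =
    ennreal ((1 / a) ^ CARD('n)) * (\<integral>\<^sup>+\<eta>. ennreal ((norm (Ff ((1 / a) *\<^sub>R \<eta>)))\<^sup>2) \<partial>lborel)"
    using a by (subst nn_integral_lborel_affine[where c="1 / a" and t=0]) simp_all
  also have "(\<integral>\<^sup>+\<eta>. ennreal ((norm (Ff ((1 / a) *\<^sub>R \<eta>)))\<^sup>2) \<partial>lborel) =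
    (\<integral>\<^sup>+\<zeta>. (\<integral>\<^sup>+k. ennreal ((norm (Ff ((1 / a) *\<^sub>R (\<zeta> + lattice_point k))))\<^sup>2) \<partial>count_space UNIV) * indicator unit_cell \<zeta> \<partial>lborel)"
    by (rule nn_integral_unit_cell_translates) measurable
  also have "\<dots> = (\<integral>\<^sup>+\<zeta>. ennreal ((2 * pi * a) ^ CARD('n)) * (\<integral>\<^sup>+x. ennreal ((norm (f x))\<^sup>2) \<partial>lborel) * indicator unit_cell (\<zeta> :: real^'n) \<partial>lborel)"
  proof (rule nn_integral_cong)
    fix \<zeta> :: "real^'n"
    define g where "g x = f x * cis (- (x \<bullet> ((1 / a) *\<^sub>R \<zeta>)))" for x
    have "Ff ((1 / a) *\<^sub>R (\<zeta> + lattice_point k)) = (\<integral>x. g x * cnj (character k ((1 / a) *\<^sub>R x)) \<partial>lborel)" for k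
      unfolding Ff_def g_def character_def
      by (rule Bochner_Integration.integral_cong) (simp_all add: cis_cnj cis_mult inner_add_right algebra_simps inner_commute[of _ "lattice_point k"] add_divide_distrib)
    moreover have "(\<integral>\<^sup>+k. ennreal ((norm (\<integral>x. g x * cnj (character k ((1 / a) *\<^sub>R x)) \<partial>lborel))\<^sup>2) \<partial>count_space UNIV) =
      ennreal ((2 * pi * a) ^ CARD('n)) * (\<integral>\<^sup>+x. ennreal ((norm (g x))\<^sup>2) \<partial>lborel)"
      using sq a by (intro parseval_scaled) (auto simp: g_def norm_mult supp')
    ultimately show "(\<integral>\<^sup>+k. ennreal ((norm (Ff ((1 / a) *\<^sub>R (\<zeta> + lattice_point k))))\<^sup>2) \<partial>count_space UNIV) * indicator unit_cell \<zeta> =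
      ennreal ((2 * pi * a) ^ CARD('n)) * (\<integral>\<^sup>+x. ennreal ((norm (f x))\<^sup>2) \<partial>lborel) * indicator unit_cell \<zeta>"
      by (simp add: g_def norm_mult)
  qed
  also have "\<dots> = ennreal ((2 * pi * a) ^ CARD('n)) * (\<integral>\<^sup>+x. ennreal ((norm (f x))\<^sup>2) \<partial>lborel)"
    by (simp add: nn_integral_cmult emeasure_unit_cell)
  also have "ennreal ((1 / a) ^ CARD('n)) * \<dots> = ennreal ((2 * pi) ^ CARD('n)) * (\<integral>\<^sup>+x. ennreal ((norm (f x))\<^sup>2) \<partial>lborel)"
  proof -
    have "(1 / a) ^ CARD('n) * (2 * pi * a) ^ CARD('n) = (2 * pi) ^ CARD('n)"
      using a by (simp add: power_mult_distrib power_divide)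
    then have "ennreal ((1 / a) ^ CARD('n)) * ennreal ((2 * pi * a) ^ CARD('n)) = ennreal ((2 * pi) ^ CARD('n))"
      using a by (subst ennreal_mult[symmetric]) auto
    then show ?thesis unfolding mult.assoc[symmetric] by (simp only:)
  qed
  finally show ?thesis by (simp add: Ff_def)
qed

section \<open>The Fourier transform of square integrable vector fields\<close>

definition L2_norm_sq :: "(real^2 \<Rightarrow> complex^2) \<Rightarrow> ennreal" where
  "L2_norm_sq u = (\<integral>\<^sup>+x. ennreal ((norm (u x))\<^sup>2) \<partial>lborel)"

lemma norm_vec_square: "(norm v)\<^sup>2 = (\<Sum>i\<in>UNIV. (norm (v $ i))\<^sup>2)"
  by (simp add: norm_vec_def L2_set_def sum_nonneg)

lemma square_integrable_iff:
  "square_integrable u \<longleftrightarrow> u \<in> borel_measurable borel \<and> L2_norm_sq u < \<infinity>"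
  unfolding square_integrable_def L2_norm_sq_def
  by (auto simp: integrable_iff_bounded)

lemma L2_norm_sq_components:
  assumes [measurable]: "u \<in> borel_measurable borel"
  shows "L2_norm_sq u = (\<Sum>i\<in>UNIV. \<integral>\<^sup>+x. ennreal ((norm (u x $ i))\<^sup>2) \<partial>lborel)"
  unfolding L2_norm_sq_def norm_vec_square
  by (subst nn_integral_sum[symmetric]) (simp_all add: sum_ennreal)

lemma L2_norm_sq_component_le: "(\<integral>\<^sup>+x. ennreal ((norm (u x $ i))\<^sup>2) \<partial>lborel) \<le> L2_norm_sq u"
  unfolding L2_norm_sq_def
  by (intro nn_integral_mono ennreal_leI power_mono Finite_Cartesian_Product.norm_nth_le) auto

lemma fourier_integral_measurable [measurable]:
  assumes [measurable]: "u \<in> borel_measurable borel"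
  shows "fourier_integral u \<in> borel_measurable borel"
  unfolding fourier_integral_def[abs_def] by measurable

lemma inverse_fourier_integral_measurable [measurable]:
  assumes [measurable]: "u \<in> borel_measurable borel"
  shows "inverse_fourier_integral u \<in> borel_measurable borel"
  unfolding inverse_fourier_integral_def[abs_def] by measurable

lemma L2_norm_sq_fourier_integral:
  assumes u [measurable]: "u \<in> borel_measurable borel" and fin: "L2_norm_sq u < \<infinity>"
    and supp: "\<And>x. norm x > R \<Longrightarrow> u x = 0"
  shows "L2_norm_sq (fourier_integral u) = L2_norm_sq u"
proof -
  have "(\<integral>\<^sup>+\<xi>. ennreal ((norm (fourier_integral u \<xi> $ i))\<^sup>2) \<partial>lborel) = (\<integral>\<^sup>+x. ennreal ((norm (u x $ i))\<^sup>2) \<partial>lborel)" for i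
  proof -
    have "(\<integral>\<^sup>+\<xi>. ennreal ((norm (fourier_integral u \<xi> $ i))\<^sup>2) \<partial>lborel) =
      (\<integral>\<^sup>+\<xi>. ennreal ((1 / (2 * pi))\<^sup>2) * ennreal ((norm (\<integral>x. u x $ i * cis (- (x \<bullet> \<xi>)) \<partial>lborel))\<^sup>2) \<partial>lborel)"
    proof (rule nn_integral_cong)
      fix \<xi>
      have "(norm (fourier_integral u \<xi> $ i))\<^sup>2 = (1 / (2 * pi))\<^sup>2 * (norm (\<integral>x. u x $ i * cis (- (x \<bullet> \<xi>)) \<partial>lborel))\<^sup>2"
        unfolding fourier_integral_def by (simp add: norm_mult norm_divide power_mult_distrib power_divide)
      then show "ennreal ((norm (fourier_integral u \<xi> $ i))\<^sup>2) =
        ennreal ((1 / (2 * pi))\<^sup>2) * ennreal ((norm (\<integral>x. u x $ i * cis (- (x \<bullet> \<xi>)) \<partial>lborel))\<^sup>2)"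
        by (simp only: ennreal_mult zero_le_power2)
    qed
    also have "\<dots> = ennreal ((1 / (2 * pi))\<^sup>2) * (\<integral>\<^sup>+\<xi>. ennreal ((norm (\<integral>x. u x $ i * cis (- (x \<bullet> \<xi>)) \<partial>lborel))\<^sup>2) \<partial>lborel)"
      by (rule nn_integral_cmult) measurable
    also have "(\<integral>\<^sup>+\<xi>. ennreal ((norm (\<integral>x. u x $ i * cis (- (x \<bullet> \<xi>)) \<partial>lborel))\<^sup>2) \<partial>lborel) =
      ennreal ((2 * pi) ^ CARD(2)) * (\<integral>\<^sup>+x. ennreal ((norm (u x $ i))\<^sup>2) \<partial>lborel)"
      using supp le_less_trans[OF L2_norm_sq_component_le fin]
      by (intro plancherel_compact_support[where R=R]) auto
    also have "ennreal ((1 / (2 * pi))\<^sup>2) * \<dots> = (\<integral>\<^sup>+x. ennreal ((norm (u x $ i))\<^sup>2) \<partial>lborel)"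
    proof -
      have "(1 / (2 * pi))\<^sup>2 * (2 * pi) ^ CARD(2) = 1" by (simp add: power_divide)
      then have "ennreal ((1 / (2 * pi))\<^sup>2) * ennreal ((2 * pi) ^ CARD(2)) = 1"
        using ennreal_mult[of "(1 / (2 * pi))\<^sup>2" "(2 * pi) ^ CARD(2)"] pi_ge_zero by simp
      then show ?thesis unfolding mult.assoc[symmetric] by (simp only: mult_1)
    qed
    finally show ?thesis .
  qed
  then show ?thesis by (simp add: L2_norm_sq_components)
qed

text \<open>
  Complex conjugation turns the inverse Fourier integral into the Fourier integral.
\<close>

lemma L2_norm_sq_inverse_fourier_integral:
  assumes u [measurable]: "u \<in> borel_measurable borel" and fin: "L2_norm_sq u < \<infinity>"
    and supp: "\<And>x. norm x > R \<Longrightarrow> u x = 0"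
  shows "L2_norm_sq (inverse_fourier_integral u) = L2_norm_sq u"
proof -
  let ?v = "\<lambda>x. \<chi> i. cnj (u x $ i)"
  have norm_v: "norm (?v x) = norm (u x)" for x by (simp add: norm_vec_def)
  have "inverse_fourier_integral u x $ i = cnj (fourier_integral ?v x $ i)" for x i
  proof -
    have "cnj (\<integral>\<xi>. cnj (u \<xi> $ i) * cis (- (\<xi> \<bullet> x)) \<partial>lborel) = (\<integral>\<xi>. u \<xi> $ i * cis (x \<bullet> \<xi>) \<partial>lborel)"
      unfolding Bochner_Integration.integral_cnj[symmetric] by (simp add: cis_cnj inner_commute)
    then show ?thesis by (simp add: inverse_fourier_integral_def fourier_integral_def)
  qed
  then have "norm (inverse_fourier_integral u x) = norm (fourier_integral ?v x)" for x
    by (simp add: norm_vec_def)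
  then have "L2_norm_sq (inverse_fourier_integral u) = L2_norm_sq (fourier_integral ?v)"
    by (simp add: L2_norm_sq_def)
  also have "\<dots> = L2_norm_sq ?v"
    using fin supp by (intro L2_norm_sq_fourier_integral[where R=R]) (auto simp: L2_norm_sq_def norm_v vec_eq_iff)
  also have "\<dots> = L2_norm_sq u" by (simp add: L2_norm_sq_def norm_v)
  finally show ?thesis .
qed

lemma norm_vec_inner_le: "norm (\<Sum>i\<in>UNIV. u $ i * cnj (v $ i)) \<le> norm u * norm v" for u v :: "complex ^ 'n"
proof -
  have "norm (\<Sum>i\<in>UNIV. u $ i * cnj (v $ i)) \<le> (\<Sum>i\<in>UNIV. \<bar>norm (u $ i)\<bar> * \<bar>norm (v $ i)\<bar>)"
    by (rule order_trans[OF norm_sum]) (simp add: norm_mult)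
  also have "\<dots> \<le> norm u * norm v"
    unfolding norm_vec_def by (rule L2_set_mult_ineq)
  finally show ?thesis .
qed

lemma integrable_L2_inner_component:
  assumes "square_integrable u" "square_integrable v"
  shows "integrable lborel (\<lambda>x. u x $ i * cnj (v x $ i))"
proof (rule Bochner_Integration.integrable_bound)
  show "integrable lborel (\<lambda>x. (norm (u x))\<^sup>2 + (norm (v x))\<^sup>2)"
    using assms by (simp add: square_integrable_def)
  have [measurable]: "u \<in> borel_measurable borel" "v \<in> borel_measurable borel"
    using assms by (auto simp: square_integrable_def)
  show "(\<lambda>x. u x $ i * cnj (v x $ i)) \<in> borel_measurable lborel" by measurable
  show "AE x in lborel. norm (u x $ i * cnj (v x $ i)) \<le> norm ((norm (u x))\<^sup>2 + (norm (v x))\<^sup>2)"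
  proof (rule AE_I2)
    fix x
    have "norm (u x $ i * cnj (v x $ i)) \<le> norm (u x) * norm (v x)"
      by (simp add: norm_mult mult_mono Finite_Cartesian_Product.norm_nth_le)
    also have "\<dots> \<le> (norm (u x))\<^sup>2 + (norm (v x))\<^sup>2"
      using sum_squares_bound[of "norm (u x)" "norm (v x)"] mult_nonneg_nonneg[OF norm_ge_zero norm_ge_zero, of "u x" "v x"]
      by linarith
    finally show "norm (u x $ i * cnj (v x $ i)) \<le> norm ((norm (u x))\<^sup>2 + (norm (v x))\<^sup>2)" by simp
  qed
qed

lemma integrable_L2_inner:
  "square_integrable u \<Longrightarrow> square_integrable v \<Longrightarrow> integrable lborel (\<lambda>x. \<Sum>i\<in>UNIV. u x $ i * cnj (v x $ i))"
  by (intro Bochner_Integration.integrable_sum integrable_L2_inner_component)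

lemma L2_Cauchy_Schwarz:
  assumes [measurable]: "u \<in> borel_measurable borel" "v \<in> borel_measurable borel"
  shows "ennreal ((norm (L2_inner u v))\<^sup>2) \<le> L2_norm_sq u * L2_norm_sq v"
proof -
  have "ennreal (norm (L2_inner u v)) \<le> (\<integral>\<^sup>+x. ennreal (norm (\<Sum>i\<in>UNIV. u x $ i * cnj (v x $ i))) \<partial>lborel)"
    unfolding L2_inner_def
    by (cases "integrable lborel (\<lambda>x. \<Sum>i\<in>UNIV. u x $ i * cnj (v x $ i))")
      (rule integral_norm_bound_ennreal, assumption, simp add: not_integrable_integral_eq)
  also have "\<dots> \<le> (\<integral>\<^sup>+x. ennreal (norm (u x)) * ennreal (norm (v x)) \<partial>lborel)"
    by (intro nn_integral_mono) (simp add: norm_vec_inner_le ennreal_leI flip: ennreal_mult)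
  finally have "(ennreal (norm (L2_inner u v)))\<^sup>2 \<le> (\<integral>\<^sup>+x. ennreal (norm (u x)) * ennreal (norm (v x)) \<partial>lborel)\<^sup>2"
    by (rule power_mono) simp
  also have "\<dots> \<le> L2_norm_sq u * L2_norm_sq v"
    unfolding L2_norm_sq_def
    by (rule order_trans[OF Cauchy_Schwarz_nn_integral]) (auto simp: ennreal_power)
  finally show ?thesis by (simp add: ennreal_power)
qed

lemma compact_support_integrable:
  fixes f :: "'a::euclidean_space \<Rightarrow> complex"
  assumes [measurable]: "f \<in> borel_measurable borel"
    and sq: "(\<integral>\<^sup>+x. ennreal ((norm (f x))\<^sup>2) \<partial>lborel) < \<infinity>"
    and supp: "\<And>x. norm x > R \<Longrightarrow> f x = 0"
  shows "integrable lborel f"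
proof (rule Bochner_Integration.integrable_bound)
  have "integrable lborel (\<lambda>x. (norm (f x))\<^sup>2)"
    using sq by (intro integrableI_bounded) auto
  then show "integrable lborel (\<lambda>x. indicator (cball 0 R) x + (norm (f x))\<^sup>2)"
    by (intro Bochner_Integration.integrable_add integrable_real_indicator) (auto intro!: emeasure_lborel_cball_finite[simplified])
  show "AE x in lborel. norm (f x) \<le> norm (indicator (cball 0 R) x + (norm (f x))\<^sup>2)"
  proof (rule AE_I2)
    fix x
    show "norm (f x) \<le> norm (indicator (cball 0 R) x + (norm (f x))\<^sup>2)"
    proof (cases "norm x \<le> R")
      case True
      have "norm (f x) \<le> 1 + (norm (f x))\<^sup>2"
        using sum_squares_bound[of 1 "norm (f x)"] norm_ge_zero[of "f x"] by (simp only: power2_eq_square)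
      with True show ?thesis by simp
    qed (use supp in auto)
  qed
qed simp

text \<open>
  Both sides are iterated integrals of \<open>f x * cnj (g \<xi>) * cis (- (x \<bullet> \<xi>))\<close>.
\<close>

lemma fourier_adjoint_scalar:
  fixes f g :: "real ^ 'n \<Rightarrow> complex"
  assumes f: "integrable lborel f" and g: "integrable lborel g"
  shows "(\<integral>x. f x * cnj (\<integral>\<xi>. g \<xi> * cis (x \<bullet> \<xi>) \<partial>lborel) \<partial>lborel) =
    (\<integral>\<xi>. (\<integral>x. f x * cis (- (x \<bullet> \<xi>)) \<partial>lborel) * cnj (g \<xi>) \<partial>lborel)"
proof -
  have [measurable]: "f \<in> borel_measurable borel" "g \<in> borel_measurable borel" using f g by auto
  let ?K = "\<lambda>x \<xi>. f x * cnj (g \<xi>) * cis (- (x \<bullet> \<xi>))"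
  have int: "integrable (lborel \<Otimes>\<^sub>M lborel) (\<lambda>(x, \<xi>). ?K x \<xi>)"
  proof (rule lborel_pair.Fubini_integrable)
    show "(\<lambda>(x, \<xi>). ?K x \<xi>) \<in> borel_measurable (lborel \<Otimes>\<^sub>M lborel)" by measurable
    show "integrable lborel (\<lambda>x. \<integral>\<xi>. norm (case (x, \<xi>) of (x, \<xi>) \<Rightarrow> ?K x \<xi>) \<partial>lborel)"
      using f by (simp add: norm_mult)
    show "AE x in lborel. integrable lborel (\<lambda>\<xi>. case (x, \<xi>) of (x, \<xi>) \<Rightarrow> ?K x \<xi>)"
    proof (rule AE_I2)
      fix x
      show "integrable lborel (\<lambda>\<xi>. case (x, \<xi>) of (x, \<xi>) \<Rightarrow> ?K x \<xi>)"
        by (rule Bochner_Integration.integrable_bound[of _ "\<lambda>\<xi>. norm (f x) * norm (g \<xi>)"])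
          (use g in \<open>auto simp: norm_mult\<close>)
    qed
  qed
  have "(\<integral>x. f x * cnj (\<integral>\<xi>. g \<xi> * cis (x \<bullet> \<xi>) \<partial>lborel) \<partial>lborel) = (\<integral>x. \<integral>\<xi>. ?K x \<xi> \<partial>lborel \<partial>lborel)"
    unfolding Bochner_Integration.integral_cnj[symmetric] integral_mult_right_zero[symmetric]
    by (simp add: cis_cnj mult_ac)
  also have "\<dots> = (\<integral>\<xi>. \<integral>x. ?K x \<xi> \<partial>lborel \<partial>lborel)"
    by (rule lborel_pair.Fubini_integral[OF int, symmetric])
  also have "\<dots> = (\<integral>\<xi>. (\<integral>x. f x * cis (- (x \<bullet> \<xi>)) \<partial>lborel) * cnj (g \<xi>) \<partial>lborel)"
    unfolding integral_mult_left_zero[symmetric] by (simp add: mult_ac)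
  finally show ?thesis .
qed

definition disc_truncation :: "real \<Rightarrow> (real^2 \<Rightarrow> complex^2) \<Rightarrow> real^2 \<Rightarrow> complex^2" where
  "disc_truncation R u x = (if norm x \<le> R then u x else 0)"

lemma disc_truncation_measurable [measurable]:
  assumes [measurable]: "u \<in> borel_measurable borel"
  shows "disc_truncation R u \<in> borel_measurable borel"
  unfolding disc_truncation_def[abs_def] by measurable

lemma norm_disc_truncation_le: "norm (disc_truncation R u x) \<le> norm (u x)"
  by (simp add: disc_truncation_def)

lemma L2_norm_sq_disc_truncation_le: "L2_norm_sq (disc_truncation R u) \<le> L2_norm_sq u"
  unfolding L2_norm_sq_def
  by (intro nn_integral_mono ennreal_leI power_mono norm_disc_truncation_le) auto

lemma disc_truncation_tendsto: "(\<lambda>n. disc_truncation (real n) u x) \<longlonglongrightarrow> u x"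
proof (rule tendsto_eventually)
  obtain m where "norm x \<le> real m" using real_arch_simple by blast
  then show "eventually (\<lambda>n. disc_truncation (real n) u x = u x) sequentially"
    by (intro eventually_sequentiallyI[of m]) (auto simp: disc_truncation_def)
qed

lemma fourier_adjoint:
  assumes u [measurable]: "u \<in> borel_measurable borel" and u_fin: "L2_norm_sq u < \<infinity>"
    and u_supp: "\<And>x. norm x > R \<Longrightarrow> u x = 0"
    and G [measurable]: "G \<in> borel_measurable borel" and G_fin: "L2_norm_sq G < \<infinity>"
    and G_supp: "\<And>x. norm x > S \<Longrightarrow> G x = 0"
  shows "L2_inner u (inverse_fourier_integral G) = L2_inner (fourier_integral u) G"
proof -
  have sq: "square_integrable u" "square_integrable G"
    "square_integrable (inverse_fourier_integral G)" "square_integrable (fourier_integral u)"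
    using u_fin G_fin L2_norm_sq_fourier_integral[OF u u_fin u_supp]
      L2_norm_sq_inverse_fourier_integral[OF G G_fin G_supp]
    by (auto simp: square_integrable_iff)
  have comp: "(\<integral>x. u x $ i * cnj (inverse_fourier_integral G x $ i) \<partial>lborel) =
    (\<integral>\<xi>. fourier_integral u \<xi> $ i * cnj (G \<xi> $ i) \<partial>lborel)" for i
  proof -
    have "integrable lborel (\<lambda>x. u x $ i)"
      using u_supp le_less_trans[OF L2_norm_sq_component_le u_fin]
      by (intro compact_support_integrable[where R=R]) auto
    moreover have "integrable lborel (\<lambda>x. G x $ i)"
      using G_supp le_less_trans[OF L2_norm_sq_component_le G_fin]
      by (intro compact_support_integrable[where R=S]) auto
    ultimately have "(\<integral>x. u x $ i * cnj (\<integral>\<xi>. G \<xi> $ i * cis (x \<bullet> \<xi>) \<partial>lborel) \<partial>lborel) =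
      (\<integral>\<xi>. (\<integral>x. u x $ i * cis (- (x \<bullet> \<xi>)) \<partial>lborel) * cnj (G \<xi> $ i) \<partial>lborel)"
      by (rule fourier_adjoint_scalar)
    then have "1 / (2 * pi) * (\<integral>x. u x $ i * cnj (\<integral>\<xi>. G \<xi> $ i * cis (x \<bullet> \<xi>) \<partial>lborel) \<partial>lborel) =
      1 / (2 * pi) * (\<integral>\<xi>. (\<integral>x. u x $ i * cis (- (x \<bullet> \<xi>)) \<partial>lborel) * cnj (G \<xi> $ i) \<partial>lborel)"
      by simp
    then show ?thesis
      unfolding inverse_fourier_integral_def fourier_integral_def integral_mult_right_zero[symmetric]
      by (simp add: mult_ac)
  qed
  show ?thesis
    unfolding L2_inner_def
    using sq by (simp add: integrable_L2_inner_component comp)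
qed

lemma has_fourier_transform_sequence:
  assumes "has_fourier_transform u g"
  shows "(\<lambda>n. L2_norm_sq (\<lambda>\<xi>. g \<xi> - fourier_integral (disc_truncation (real n) u) \<xi>)) \<longlonglongrightarrow> 0"
  using assms filterlim_compose[OF _ filterlim_real_sequentially]
  unfolding has_fourier_transform_def L2_dist_sq_def L2_norm_sq_def disc_truncation_def[abs_def] by blast

lemma L2_inner_diff_left:
  assumes "square_integrable u" "square_integrable v" "square_integrable w"
  shows "L2_inner (\<lambda>x. u x - v x) w = L2_inner u w - L2_inner v w"
proof -
  have "(\<Sum>i\<in>UNIV. (u x - v x) $ i * cnj (w x $ i)) =
    (\<Sum>i\<in>UNIV. u x $ i * cnj (w x $ i)) - (\<Sum>i\<in>UNIV. v x $ i * cnj (w x $ i))" for x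
    by (simp add: left_diff_distrib sum_subtractf)
  then show ?thesis
    unfolding L2_inner_def using assms by (simp add: integrable_L2_inner del: sum_subtractf)
qed

text \<open>
  The identity holds for the truncations of \<open>u\<close> by Fubini's theorem. In the limit, the left side is
  handled by dominated convergence and the right side by the Cauchy-Schwarz inequality, as the
  transforms of the truncations tend to \<open>g\<close> in the mean.
\<close>

lemma L2_inner_fourier_transform:
  assumes ft: "has_fourier_transform u g"
    and G [measurable]: "G \<in> borel_measurable borel" and G_fin: "L2_norm_sq G < \<infinity>"
    and G_supp: "\<And>x. norm x > S \<Longrightarrow> G x = 0"
  shows "L2_inner u (inverse_fourier_integral G) = L2_inner g G"
proof -
  have u: "square_integrable u" and g: "square_integrable g"
    using ft by (auto simp: has_fourier_transform_def)
  have [measurable]: "u \<in> borel_measurable borel" "g \<in> borel_measurable borel"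
    and u_fin: "L2_norm_sq u < \<infinity>"
    using u g by (auto simp: square_integrable_iff)
  define \<psi> where "\<psi> = inverse_fourier_integral G"
  have \<psi>: "square_integrable \<psi>"
    using L2_norm_sq_inverse_fourier_integral[OF G G_fin G_supp] G_fin
    by (simp add: square_integrable_iff \<psi>_def)
  have G_sq: "square_integrable G" using G G_fin by (simp add: square_integrable_iff)
  have [measurable]: "\<psi> \<in> borel_measurable borel" by (simp add: \<psi>_def)
  define v where "v n = disc_truncation (real n) u" for n
  have v_meas [measurable]: "v n \<in> borel_measurable borel" for n by (simp add: v_def)
  have v_fin: "L2_norm_sq (v n) < \<infinity>" for n
    unfolding v_def using L2_norm_sq_disc_truncation_le u_fin by (rule le_less_trans)
  have v_supp: "norm x > real n \<Longrightarrow> v n x = 0" for n x by (simp add: v_def disc_truncation_def)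
  have Fv: "square_integrable (fourier_integral (v n))" for n
    using L2_norm_sq_fourier_integral[OF v_meas v_fin v_supp] v_fin by (simp add: square_integrable_iff)
  have inner_v: "L2_inner (v n) \<psi> = L2_inner (fourier_integral (v n)) G" for n
    unfolding \<psi>_def using v_fin v_supp G_fin G_supp by (intro fourier_adjoint) auto
  have lim1: "(\<lambda>n. L2_inner (v n) \<psi>) \<longlonglongrightarrow> L2_inner u \<psi>"
    unfolding L2_inner_def
  proof (rule integral_dominated_convergence[where w="\<lambda>x. (norm (u x))\<^sup>2 + (norm (\<psi> x))\<^sup>2"])
    show "integrable lborel (\<lambda>x. (norm (u x))\<^sup>2 + (norm (\<psi> x))\<^sup>2)"
      using u \<psi> by (simp add: square_integrable_def)
    show "AE x in lborel. (\<lambda>n. \<Sum>i\<in>UNIV. v n x $ i * cnj (\<psi> x $ i)) \<longlonglongrightarrow> (\<Sum>i\<in>UNIV. u x $ i * cnj (\<psi> x $ i))"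
      unfolding v_def by (intro AE_I2 tendsto_intros disc_truncation_tendsto)
    show "AE x in lborel. norm (\<Sum>i\<in>UNIV. v n x $ i * cnj (\<psi> x $ i)) \<le> (norm (u x))\<^sup>2 + (norm (\<psi> x))\<^sup>2" for n
    proof (rule AE_I2)
      fix x
      have "norm (\<Sum>i\<in>UNIV. v n x $ i * cnj (\<psi> x $ i)) \<le> norm (v n x) * norm (\<psi> x)" by (rule norm_vec_inner_le)
      also have "\<dots> \<le> norm (u x) * norm (\<psi> x)"
        unfolding v_def by (intro mult_right_mono norm_disc_truncation_le) auto
      also have "\<dots> \<le> (norm (u x))\<^sup>2 + (norm (\<psi> x))\<^sup>2"
        using sum_squares_bound[of "norm (u x)" "norm (\<psi> x)"] mult_nonneg_nonneg[OF norm_ge_zero norm_ge_zero, of "u x" "\<psi> x"]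
        by linarith
      finally show "norm (\<Sum>i\<in>UNIV. v n x $ i * cnj (\<psi> x $ i)) \<le> (norm (u x))\<^sup>2 + (norm (\<psi> x))\<^sup>2" .
    qed
  qed measurable
  define d where "d n = (\<lambda>\<xi>. g \<xi> - fourier_integral (v n) \<xi>)" for n
  have [measurable]: "d n \<in> borel_measurable borel" for n unfolding d_def by measurable
  have "(\<lambda>n. L2_norm_sq (d n)) \<longlonglongrightarrow> 0"
    unfolding d_def v_def by (rule has_fourier_transform_sequence[OF ft])
  then have "(\<lambda>n. L2_norm_sq G * L2_norm_sq (d n)) \<longlonglongrightarrow> L2_norm_sq G * 0"
    using G_fin by (intro ennreal_tendsto_cmult) (simp_all only: infinity_ennreal_def)
  then have lim: "(\<lambda>n. L2_norm_sq G * L2_norm_sq (d n)) \<longlonglongrightarrow> 0" by simp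
  have "ennreal ((norm (L2_inner (d n) G))\<^sup>2) \<le> L2_norm_sq G * L2_norm_sq (d n)" for n
    by (subst mult.commute, rule L2_Cauchy_Schwarz) measurable
  then have "(\<lambda>n. ennreal ((norm (L2_inner (d n) G))\<^sup>2)) \<longlonglongrightarrow> 0"
    by (intro tendsto_sandwich[OF _ _ tendsto_const lim] always_eventually allI) simp_all
  then have "(\<lambda>n. (norm (L2_inner (d n) G))\<^sup>2) \<longlonglongrightarrow> 0"
    by (rule ennreal_tendsto_0_iff[THEN iffD1, rotated]) simp
  from tendsto_real_sqrt[OF this]
  have "(\<lambda>n. norm (L2_inner (d n) G)) \<longlonglongrightarrow> 0"
    by simp
  moreover have "L2_inner (d n) G = L2_inner g G - L2_inner (v n) \<psi>" for n
    unfolding inner_v d_def by (rule L2_inner_diff_left[OF g Fv G_sq])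
  ultimately have "(\<lambda>n. norm (L2_inner g G - L2_inner (v n) \<psi>)) \<longlonglongrightarrow> 0"
    by (simp only:)
  then have "(\<lambda>n. norm (L2_inner (v n) \<psi> - L2_inner g G)) \<longlonglongrightarrow> 0"
    by (simp only: norm_minus_commute[of "L2_inner g G"])
  then have "(\<lambda>n. L2_inner (v n) \<psi>) \<longlonglongrightarrow> L2_inner g G"
    by (rule LIM_zero_cancel[OF tendsto_norm_zero_cancel])
  with lim1 show ?thesis unfolding \<psi>_def by (rule LIMSEQ_unique)
qed

text \<open>
  A triangle inequality for squared norms whose leading constant can be brought arbitrarily close to 1,
  which makes norms pass to limits in the mean without taking square roots of extended reals.
\<close>

lemma norm_square_weighted_triangle:
  fixes a b :: "'a::real_normed_vector"
  assumes "e > 0"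
  shows "(norm a)\<^sup>2 \<le> (1 + e) * (norm b)\<^sup>2 + (1 + 1 / e) * (norm (b - a))\<^sup>2"
proof -
  let ?x = "norm b" and ?y = "norm (b - a)"
  have "norm a \<le> ?x + ?y" using norm_triangle_ineq4[of b "b - a"] by simp
  then have "(norm a)\<^sup>2 \<le> (?x + ?y)\<^sup>2" by (intro power_mono) auto
  also have "\<dots> \<le> (1 + e) * ?x\<^sup>2 + (1 + 1 / e) * ?y\<^sup>2"
  proof -
    \<comment> \<open>weighted arithmetic-geometric mean inequality for the mixed term\<close>
    have "0 \<le> (e * ?x - ?y)\<^sup>2 / e" using assms by simp
    also have "\<dots> = (1 + e) * ?x\<^sup>2 + (1 + 1 / e) * ?y\<^sup>2 - (?x + ?y)\<^sup>2"
      using assms by (simp add: power2_eq_square field_simps)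
    finally show ?thesis by simp
  qed
  finally show ?thesis .
qed

text \<open>
  Plancherel's identity for the truncations and a passage to the limit. The inequality excludes
  fields that the frame coefficients, which depend on the transform alone, could not see.
\<close>

lemma L2_norm_sq_le_fourier_transform:
  assumes ft: "has_fourier_transform u g"
  shows "L2_norm_sq u \<le> L2_norm_sq g"
proof -
  have u: "square_integrable u" and g: "square_integrable g"
    using ft by (auto simp: has_fourier_transform_def)
  have [measurable]: "u \<in> borel_measurable borel" "g \<in> borel_measurable borel"
    and u_fin: "L2_norm_sq u < \<infinity>" and g_fin: "L2_norm_sq g < \<infinity>"
    using u g by (auto simp: square_integrable_iff)
  define v where "v n = disc_truncation (real n) u" for n
  have v_meas [measurable]: "v n \<in> borel_measurable borel" for n by (simp add: v_def)
  have v_fin: "L2_norm_sq (v n) < \<infinity>" for n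
    unfolding v_def using L2_norm_sq_disc_truncation_le u_fin by (rule le_less_trans)
  have v_supp: "norm x > real n \<Longrightarrow> v n x = 0" for n x by (simp add: v_def disc_truncation_def)
  have lim_v: "(\<lambda>n. L2_norm_sq (v n)) \<longlonglongrightarrow> L2_norm_sq u"
    unfolding L2_norm_sq_def
  proof (rule nn_integral_dominated_convergence[where w="\<lambda>x. ennreal ((norm (u x))\<^sup>2)"])
    show "(\<integral>\<^sup>+x. ennreal ((norm (u x))\<^sup>2) \<partial>lborel) < \<infinity>" using u_fin by (simp add: L2_norm_sq_def)
    show "AE x in lborel. (\<lambda>n. ennreal ((norm (v n x))\<^sup>2)) \<longlonglongrightarrow> ennreal ((norm (u x))\<^sup>2)"
      unfolding v_def by (intro AE_I2 tendsto_ennrealI tendsto_intros disc_truncation_tendsto)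
    show "AE x in lborel. ennreal ((norm (v n x))\<^sup>2) \<le> ennreal ((norm (u x))\<^sup>2)" for n
      unfolding v_def by (intro AE_I2 ennreal_leI power_mono norm_disc_truncation_le) auto
  qed measurable
  have weighted: "L2_norm_sq u \<le> ennreal (1 + e) * L2_norm_sq g" if "e > 0" for e
  proof (rule LIMSEQ_le[OF lim_v])
    let ?d = "\<lambda>n. L2_norm_sq (\<lambda>\<xi>. g \<xi> - fourier_integral (v n) \<xi>)"
    have "(\<lambda>n. ennreal (1 + e) * L2_norm_sq g + ennreal (1 + 1 / e) * ?d n) \<longlonglongrightarrow>
      ennreal (1 + e) * L2_norm_sq g + ennreal (1 + 1 / e) * 0"
      unfolding v_def
      by (intro tendsto_add tendsto_const ennreal_tendsto_cmult has_fourier_transform_sequence ft) simp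
    then show "(\<lambda>n. ennreal (1 + e) * L2_norm_sq g + ennreal (1 + 1 / e) * ?d n) \<longlonglongrightarrow> ennreal (1 + e) * L2_norm_sq g"
      by simp
    have "L2_norm_sq (v n) \<le> ennreal (1 + e) * L2_norm_sq g + ennreal (1 + 1 / e) * ?d n" for n
    proof -
      have "L2_norm_sq (v n) = L2_norm_sq (fourier_integral (v n))"
        by (rule L2_norm_sq_fourier_integral[OF v_meas v_fin v_supp, symmetric])
      also have "\<dots> \<le> (\<integral>\<^sup>+\<xi>. ennreal (1 + e) * ennreal ((norm (g \<xi>))\<^sup>2) +
          ennreal (1 + 1 / e) * ennreal ((norm (g \<xi> - fourier_integral (v n) \<xi>))\<^sup>2) \<partial>lborel)"
        unfolding L2_norm_sq_def
      proof (rule nn_integral_mono)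
        fix \<xi>
        have "ennreal ((norm (fourier_integral (v n) \<xi>))\<^sup>2) \<le>
          ennreal ((1 + e) * (norm (g \<xi>))\<^sup>2 + (1 + 1 / e) * (norm (g \<xi> - fourier_integral (v n) \<xi>))\<^sup>2)"
          by (intro ennreal_leI norm_square_weighted_triangle that)
        also have "\<dots> = ennreal (1 + e) * ennreal ((norm (g \<xi>))\<^sup>2) +
          ennreal (1 + 1 / e) * ennreal ((norm (g \<xi> - fourier_integral (v n) \<xi>))\<^sup>2)"
          using that by (subst ennreal_plus) (auto simp: ennreal_mult'' intro!: mult_nonneg_nonneg add_nonneg_nonneg)
        finally show "ennreal ((norm (fourier_integral (v n) \<xi>))\<^sup>2) \<le> \<dots>" .
      qed
      also have "\<dots> = ennreal (1 + e) * L2_norm_sq g + ennreal (1 + 1 / e) * ?d n"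
        unfolding L2_norm_sq_def by (subst nn_integral_add) (auto simp: nn_integral_cmult)
      finally show ?thesis .
    qed
    then show "\<exists>N. \<forall>n\<ge>N. L2_norm_sq (v n) \<le> ennreal (1 + e) * L2_norm_sq g + ennreal (1 + 1 / e) * ?d n"
      by blast
  qed
  obtain s where s: "L2_norm_sq u = ennreal s" "s \<ge> 0" using u_fin by (cases "L2_norm_sq u") auto
  obtain r where r: "L2_norm_sq g = ennreal r" "r \<ge> 0" using g_fin by (cases "L2_norm_sq g") auto
  have "s \<le> r"
  proof (rule field_le_epsilon)
    fix d :: real assume "d > 0"
    \<comment> \<open>chosen such that \<open>e * r \<le> d\<close>\<close>
    define e where "e = d / (r + 1)"
    have "e > 0" using \<open>d > 0\<close> r by (simp add: e_def)
    have "ennreal s \<le> ennreal ((1 + e) * r)"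
      using weighted[OF \<open>e > 0\<close>] \<open>e > 0\<close> r unfolding s(1) r(1) by (simp add: ennreal_mult)
    then have "s \<le> (1 + e) * r" using \<open>e > 0\<close> r by (subst (asm) ennreal_le_iff) auto
    also have "(1 + e) * r \<le> r + e * (r + 1)" using \<open>e > 0\<close> by (simp add: algebra_simps)
    also have "\<dots> = r + d" using r by (simp add: e_def)
    finally show "s \<le> r + d" .
  qed
  then show ?thesis using s r by (simp add: ennreal_leI)
qed

section \<open>Summing the angular windows over the orientations\<close>

lemma mat_adjoint_mult_index:
  assumes A: "A \<in> carrier_mat m n" and "c < n" "d < n"
  shows "(mat_adjoint A * A) $$ (c, d) = (\<Sum>r<m. cnj (A $$ (r, c)) * (A $$ (r, d) :: complex))"
proof -
  have "(mat_adjoint A * A) $$ (c, d) = scalar_prod (conjugate (Matrix.col A c)) (Matrix.col A d)"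
    using assms by (simp add: mat_adjoint_def)
  also have "\<dots> = (\<Sum>r<m. cnj (A $$ (r, c)) * A $$ (r, d))"
    using assms by (simp add: scalar_prod_def atLeast0LessThan conjugate_complex_def)
  finally show ?thesis .
qed

text \<open>
  The left hand side is the quadratic form of \<open>A\<^sup>H A = D\<close> at \<open>z\<close>. As \<open>D\<close> is diagonal and the entries of \<open>z\<close> have
  modulus 1, it reduces to the trace.
\<close>

lemma tight_matrix_norm_sum:
  assumes A: "A \<in> carrier_mat m n" and eq: "mat_adjoint A * A = D" and D: "diagonal_mat D"
    and z: "\<And>c. c < n \<Longrightarrow> norm (z c) = 1"
  shows "complex_of_real (\<Sum>r<m. (norm (\<Sum>c<n. A $$ (r, c) * z c))\<^sup>2) = mat_trace D"
proof -
  have D_car: "D \<in> carrier_mat n n" unfolding eq[symmetric] using A by (auto simp: mat_adjoint_def)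
  have entry: "(\<Sum>r<m. cnj (A $$ (r, c)) * A $$ (r, d)) = (if c = d then D $$ (c, c) else 0)"
    if "c < n" "d < n" for c d
    using mat_adjoint_mult_index[OF A that] eq D D_car that by (auto simp: diagonal_mat_def)
  have "complex_of_real (\<Sum>r<m. (norm (\<Sum>c<n. A $$ (r, c) * z c))\<^sup>2) =
    (\<Sum>r<m. (\<Sum>d<n. A $$ (r, d) * z d) * cnj (\<Sum>c<n. A $$ (r, c) * z c))"
    by (simp only: of_real_sum complex_norm_square)
  also have "\<dots> = (\<Sum>r<m. \<Sum>c<n. \<Sum>d<n. (cnj (z c) * z d) * (cnj (A $$ (r, c)) * A $$ (r, d)))"
    by (simp only: sum_product cnj_sum complex_cnj_mult) (subst sum.swap, simp add: mult_ac)
  also have "\<dots> = (\<Sum>c<n. \<Sum>r<m. \<Sum>d<n. (cnj (z c) * z d) * (cnj (A $$ (r, c)) * A $$ (r, d)))"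
    by (rule sum.swap)
  also have "\<dots> = (\<Sum>c<n. \<Sum>d<n. \<Sum>r<m. (cnj (z c) * z d) * (cnj (A $$ (r, c)) * A $$ (r, d)))"
    by (intro sum.cong refl sum.swap)
  also have "\<dots> = (\<Sum>c<n. \<Sum>d<n. (cnj (z c) * z d) * (if c = d then D $$ (c, c) else 0))"
    by (intro sum.cong refl) (simp only: sum_distrib_left[symmetric] entry lessThan_iff)
  also have "\<dots> = (\<Sum>c<n. (cnj (z c) * z c) * D $$ (c, c))"
    by (simp add: if_distrib cong: if_cong)
  also have "\<dots> = (\<Sum>c<n. D $$ (c, c))"
  proof (intro sum.cong refl)
    fix c assume "c \<in> {..<n}"
    then have "z c * cnj (z c) = 1" using z[of c] by (simp add: complex_norm_square[symmetric])
    then show "(cnj (z c) * z c) * D $$ (c, c) = D $$ (c, c)" by (simp add: mult.commute)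
  qed
  also have "\<dots> = mat_trace D"
    using D_car by (simp add: mat_trace_def diag_mat_def sum_list_distinct_conv_sum_set atLeast0LessThan)
  finally show ?thesis .
qed

text \<open>
  At every angle \<open>\<theta>\<close> the vector of the \<open>e\<^sup>i\<^sup>n\<^sup>\<theta>\<close> has entries of modulus 1, so the rotated angular windows
  form a partition of unity in the sense of squares. Rows and orientations differ by an index shift of 1,
  columns and angular frequencies by one of \<open>N\<close>.
\<close>

lemma orientation_sum_eq_1:
  assumes UD: "mat_adjoint (orientation_matrix M N \<beta>) * orientation_matrix M N \<beta> = D"
    and D: "diagonal_mat D" "mat_trace D = 1"
  shows "(\<Sum>t\<in>{1..M}. (norm (\<Sum>n\<in>{- int N..int N}. rotated_coeffs M \<beta> t n * cis (of_int n * \<theta>)))\<^sup>2) = 1"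
proof -
  define U where "U = orientation_matrix M N \<beta>"
  define z where "z c = cis (of_int (int c - int N) * \<theta>)" for c
  have U: "U \<in> carrier_mat M (2 * N + 1)" by (simp add: U_def orientation_matrix_def)
  have row: "(\<Sum>c<2 * N + 1. U $$ (r, c) * z c) =
    (\<Sum>n\<in>{- int N..int N}. rotated_coeffs M \<beta> (r + 1) n * cis (of_int n * \<theta>))" if "r < M" for r
  proof (rule sum.reindex_bij_witness[of _ "\<lambda>n. nat (n + int N)" "\<lambda>c. int c - int N"])
    fix c assume "c \<in> {..<2 * N + 1}"
    with that show "rotated_coeffs M \<beta> (r + 1) (int c - int N) * cis (of_int (int c - int N) * \<theta>) = U $$ (r, c) * z c"
      by (simp add: U_def orientation_matrix_def z_def)
  qed auto
  have "complex_of_real (\<Sum>r<M. (norm (\<Sum>c<2 * N + 1. U $$ (r, c) * z c))\<^sup>2) = mat_trace D"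
    using UD D by (intro tight_matrix_norm_sum[OF U]) (auto simp: U_def z_def)
  then have "(\<Sum>r<M. (norm (\<Sum>c<2 * N + 1. U $$ (r, c) * z c))\<^sup>2) = 1"
    by (simp only: D(2) of_real_eq_1_iff)
  moreover have "(\<Sum>r<M. (norm (\<Sum>c<2 * N + 1. U $$ (r, c) * z c))\<^sup>2) =
    (\<Sum>t\<in>{1..M}. (norm (\<Sum>n\<in>{- int N..int N}. rotated_coeffs M \<beta> t n * cis (of_int n * \<theta>)))\<^sup>2)"
  proof -
    have "(\<Sum>r<M. (norm (\<Sum>c<2 * N + 1. U $$ (r, c) * z c))\<^sup>2) =
      (\<Sum>r<M. (norm (\<Sum>n\<in>{- int N..int N}. rotated_coeffs M \<beta> (r + 1) n * cis (of_int n * \<theta>)))\<^sup>2)"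
      by (intro sum.cong refl) (simp only: row lessThan_iff)
    also have "\<dots> = (\<Sum>t\<in>{1..M}. (norm (\<Sum>n\<in>{- int N..int N}. rotated_coeffs M \<beta> t n * cis (of_int n * \<theta>)))\<^sup>2)"
      by (rule sum.reindex_bij_witness[of _ "\<lambda>t. t - 1" "\<lambda>r. r + 1"]) auto
    finally show ?thesis .
  qed
  ultimately show ?thesis by simp
qed

section \<open>The frame functions in frequency space\<close>

text \<open>
  Away from the negative real axis the argument is continuous, and on the axis it takes the constant
  value \<open>\<pi>\<close>, apart from its value 0 at the origin.
\<close>

lemma borel_measurable_Arg [measurable]: "Arg \<in> borel_measurable borel"
proof -
  have cl: "closed (\<real>\<^sub>\<le>\<^sub>0 :: complex set)" by (rule closed_nonpos_Reals_complex)
  then have [measurable]: "- \<real>\<^sub>\<le>\<^sub>0 \<in> sets (borel :: complex measure)" by auto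
  have [measurable]: "(\<lambda>z. indicator (- \<real>\<^sub>\<le>\<^sub>0) z *\<^sub>R Arg z) \<in> borel_measurable borel"
  proof (rule borel_measurable_continuous_on_indicator)
    show "continuous_on (- \<real>\<^sub>\<le>\<^sub>0) Arg"
      by (intro continuous_at_imp_continuous_on ballI continuous_at_Arg) auto
  qed measurable
  have "Arg z = indicator (- \<real>\<^sub>\<le>\<^sub>0) z *\<^sub>R Arg z + (if z \<in> - \<real>\<^sub>\<le>\<^sub>0 \<or> z = 0 then 0 else pi)" for z
  proof (cases "z = 0")
    case False
    then show ?thesis by (auto simp: indicator_def Arg_eq_pi complex_nonpos_Reals_iff complex_eq_iff)
  qed (simp add: Arg_zero)
  then have "Arg = (\<lambda>z. indicator (- \<real>\<^sub>\<le>\<^sub>0) z *\<^sub>R Arg z + (if z \<in> - \<real>\<^sub>\<le>\<^sub>0 \<or> z = 0 then 0 else pi))"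
    by blast
  also have "\<dots> \<in> borel_measurable borel" by measurable
  finally show ?thesis .
qed

lemma polar_angle_measurable [measurable]: "polar_angle \<in> borel_measurable borel"
proof -
  have "(\<lambda>\<xi> :: real^2. Complex (\<xi> $ 1) (\<xi> $ 2)) \<in> borel_measurable borel"
    unfolding Complex_eq by measurable
  then show ?thesis unfolding polar_angle_def[abs_def] by measurable
qed

lemma polar_angle_scale: "a > 0 \<Longrightarrow> polar_angle (a *\<^sub>R \<xi>) = polar_angle \<xi>"
  unfolding polar_angle_def
  using Arg_times_of_real[of a "Complex (\<xi> $ 1) (\<xi> $ 2)"]
  by (simp add: complex_of_real_mult_Complex)

lemma e_theta_scale: "a > 0 \<Longrightarrow> e_theta (a *\<^sub>R \<xi>) = e_theta \<xi>"
  by (simp add: e_theta_def polar_angle_scale)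

lemma norm_e_theta [simp]: "norm (e_theta \<xi>) = 1"
  by (simp add: norm_vec_def L2_set_def e_theta_def UNIV_2)

lemma e_theta_measurable [measurable]: "e_theta \<in> borel_measurable borel"
proof -
  have "e_theta = (\<lambda>\<xi>. \<chi> i. if i = 1 then of_real (sin (polar_angle \<xi>)) else of_real (- cos (polar_angle \<xi>)))"
    by (auto simp: fun_eq_iff vec_eq_iff e_theta_def forall_2)
  also have "\<dots> \<in> borel_measurable borel" by measurable
  finally show ?thesis .
qed

lemma norm_vector_scalar_mult: "norm (c *s v) = norm c * norm v" for c :: complex and v :: "complex ^ 'n"
  by (simp add: norm_vec_def norm_mult L2_set_right_distrib)

lemma borel_measurable_vector_scalar_mult [measurable (raw)]:
  fixes f :: "'a \<Rightarrow> complex ^ 'n"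
  assumes [measurable]: "c \<in> borel_measurable M" "f \<in> borel_measurable M"
  shows "(\<lambda>x. c x *s f x) \<in> borel_measurable M"
  unfolding vector_scalar_mult_def by measurable

lemma inner_parallel:
  "(\<Sum>i\<in>UNIV. (a *s e) $ i * cnj ((b *s e) $ i)) = a * cnj b * of_real ((norm e)\<^sup>2)" for e :: "complex ^ 'n"
  unfolding norm_vec_square of_real_sum complex_norm_square
  by (simp add: sum_distrib_left mult_ac)

text \<open>
  Dilation and translation in space become dilation and modulation in frequency.
\<close>

lemma dilated_translate_inverse_fourier:
  fixes g :: "real^2 \<Rightarrow> complex^2"
  assumes s: "s > 0"
  shows "(s / (2 * pi)) *\<^sub>R inverse_fourier_integral g (s *\<^sub>R x - lattice_point k) =
    inverse_fourier_integral (\<lambda>\<xi>. (of_real (1 / (2 * pi * s)) * cnj (character k ((1 / s) *\<^sub>R \<xi>))) *s g ((1 / s) *\<^sub>R \<xi>)) x"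
proof (rule vec_eq_iff[THEN iffD2], rule allI)
  fix i
  define I where "I = (\<integral>\<eta>. g \<eta> $ i * cis ((s *\<^sub>R x - lattice_point k) \<bullet> \<eta>) \<partial>lborel)"
  have "(\<integral>\<xi>. ((of_real (1 / (2 * pi * s)) * cnj (character k ((1 / s) *\<^sub>R \<xi>))) *s g ((1 / s) *\<^sub>R \<xi>)) $ i * cis (x \<bullet> \<xi>) \<partial>lborel) =
    (s ^ 2) *\<^sub>R (\<integral>\<eta>. of_real (1 / (2 * pi * s)) * (g \<eta> $ i * cis ((s *\<^sub>R x - lattice_point k) \<bullet> \<eta>)) \<partial>lborel)"
    using s by (subst integral_lborel_affine[where c=s and t=0])
      (simp_all add: character_def cis_cnj cis_mult inner_diff_left mult_ac)
  also have "\<dots> = of_real (s / (2 * pi)) * I"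
    using s by (simp add: I_def scaleR_conv_of_real power2_eq_square)
  finally have J: "(\<integral>\<xi>. ((of_real (1 / (2 * pi * s)) * cnj (character k ((1 / s) *\<^sub>R \<xi>))) *s g ((1 / s) *\<^sub>R \<xi>)) $ i * cis (x \<bullet> \<xi>) \<partial>lborel) =
    of_real (s / (2 * pi)) * I" .
  show "((s / (2 * pi)) *\<^sub>R inverse_fourier_integral g (s *\<^sub>R x - lattice_point k)) $ i =
    inverse_fourier_integral (\<lambda>\<xi>. (of_real (1 / (2 * pi * s)) * cnj (character k ((1 / s) *\<^sub>R \<xi>))) *s g ((1 / s) *\<^sub>R \<xi>)) x $ i"
    unfolding inverse_fourier_integral_def vector_scaleR_component vec_lambda_beta J I_def[symmetric]
    by (simp only: scaleR_conv_of_real mult_ac)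
qed

text \<open>
  The scalar factor of \<^const>\<open>polar_wavelet_hat\<close> along the unit tangent field.
\<close>

definition wavelet_amplitude :: "nat \<Rightarrow> (int \<Rightarrow> complex) \<Rightarrow> (real \<Rightarrow> complex) \<Rightarrow> real^2 \<Rightarrow> complex" where
  "wavelet_amplitude N \<beta> h \<xi> =
     - \<i> * (\<Sum>n\<in>{- int N..int N}. \<beta> n * cis (of_int n * polar_angle \<xi>)) * h (norm \<xi>)"

lemma polar_wavelet_hat_amplitude: "polar_wavelet_hat N \<beta> h \<xi> = wavelet_amplitude N \<beta> h \<xi> *s e_theta \<xi>"
  by (simp add: polar_wavelet_hat_def wavelet_amplitude_def)

text \<open>
  The Fourier transform of \<^const>\<open>frame_function\<close>. Since the direction of \<^const>\<open>e_theta\<close> is invariant under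
  dilations, it is written as a scalar multiple of the tangent field at \<open>\<xi>\<close> itself.
\<close>

definition frame_hat ::
  "(int \<Rightarrow> nat) \<Rightarrow> (int \<Rightarrow> nat) \<Rightarrow> (int \<Rightarrow> int \<Rightarrow> complex) \<Rightarrow> (real \<Rightarrow> complex)
     \<Rightarrow> int \<times> (int^2) \<times> nat \<Rightarrow> real^2 \<Rightarrow> complex^2" where
  "frame_hat N M \<beta> h = (\<lambda>(j, k, t) \<xi>.
     (of_real (1 / (2 * pi * 2 powi j)) * cnj (character k ((1 / 2 powi j) *\<^sub>R \<xi>)) *
       wavelet_amplitude (N j) (rotated_coeffs (M j) (\<beta> j) t) h ((1 / 2 powi j) *\<^sub>R \<xi>)) *s e_theta \<xi>)"

lemma frame_function_eq_inverse_fourier: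
  "frame_function N M \<beta> h i = inverse_fourier_integral (frame_hat N M \<beta> h i)"
proof (cases i)
  case (fields j k t)
  let ?w = "polar_wavelet_hat (N j) (rotated_coeffs (M j) (\<beta> j) t) h"
  have s: "(2::real) powi j > 0" by simp
  have eq: "frame_hat N M \<beta> h (j, k, t) =
    (\<lambda>\<xi>. (of_real (1 / (2 * pi * 2 powi j)) * cnj (character k ((1 / 2 powi j) *\<^sub>R \<xi>))) *s ?w ((1 / 2 powi j) *\<^sub>R \<xi>))"
    by (simp add: frame_hat_def polar_wavelet_hat_amplitude e_theta_scale vector_smult_assoc fun_eq_iff)
  show ?thesis
    unfolding fields eq frame_function_def polar_wavelet_def lattice_point_def[symmetric] case_prod_conv
    by (intro ext dilated_translate_inverse_fourier s)
qed

lemma wavelet_amplitude_measurable [measurable]: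
  assumes [measurable]: "h \<in> borel_measurable borel"
  shows "wavelet_amplitude N \<beta> h \<in> borel_measurable borel"
  unfolding wavelet_amplitude_def[abs_def] by measurable

lemma frame_hat_measurable:
  assumes [measurable]: "h \<in> borel_measurable borel"
  shows "frame_hat N M \<beta> h i \<in> borel_measurable borel"
  by (cases i) (simp add: frame_hat_def)

lemma wavelet_amplitude_bounded:
  assumes "\<And>\<rho>. \<rho> \<ge> 0 \<Longrightarrow> norm (h \<rho>) \<le> H"
  shows "norm (wavelet_amplitude N \<beta> h \<xi>) \<le> (\<Sum>n\<in>{- int N..int N}. norm (\<beta> n)) * H"
proof -
  have "norm (\<Sum>n\<in>{- int N..int N}. \<beta> n * cis (of_int n * polar_angle \<xi>)) \<le> (\<Sum>n\<in>{- int N..int N}. norm (\<beta> n))"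
    by (rule order_trans[OF norm_sum]) (simp add: norm_mult)
  then show ?thesis
    using assms[of "norm \<xi>"] unfolding wavelet_amplitude_def
    by (simp add: norm_mult mult_mono sum_nonneg)
qed

lemma frame_hat_support:
  assumes "\<And>\<rho>. \<rho> > pi \<Longrightarrow> h \<rho> = 0" and "norm \<xi> > 2 powi j * pi"
  shows "frame_hat N M \<beta> h (j, k, t) \<xi> = 0"
proof -
  have "norm ((1 / 2 powi j) *\<^sub>R \<xi>) > pi" using assms(2) by (simp add: field_simps)
  then show ?thesis using assms(1) by (simp add: frame_hat_def wavelet_amplitude_def)
qed

lemma L2_norm_sq_bounded_support:
  assumes bound: "\<And>\<xi>. norm (G \<xi>) \<le> B" and supp: "\<And>\<xi>. norm \<xi> > R \<Longrightarrow> G \<xi> = 0"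
  shows "L2_norm_sq G < \<infinity>"
proof -
  have "L2_norm_sq G \<le> (\<integral>\<^sup>+\<xi>. ennreal (B\<^sup>2) * indicator (cball (0::real^2) R) \<xi> \<partial>lborel)"
    unfolding L2_norm_sq_def
  proof (rule nn_integral_mono)
    fix \<xi>
    show "ennreal ((norm (G \<xi>))\<^sup>2) \<le> ennreal (B\<^sup>2) * indicator (cball 0 R) \<xi>"
      using bound[of \<xi>] supp[of \<xi>]
      by (cases "norm \<xi> \<le> R") (auto intro!: ennreal_leI power_mono)
  qed
  also have "\<dots> < \<infinity>"
    by (subst nn_integral_cmult_indicator)
      (simp_all add: ennreal_mult_less_top emeasure_lborel_cball_finite[simplified])
  finally show ?thesis .
qed

lemma frame_hat_square_integrable:
  assumes h [measurable]: "h \<in> borel_measurable borel" and H: "\<And>\<rho>. \<rho> \<ge> 0 \<Longrightarrow> norm (h \<rho>) \<le> H"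
    and band: "\<And>\<rho>. \<rho> > pi \<Longrightarrow> h \<rho> = 0"
  shows "square_integrable (frame_hat N M \<beta> h i)"
proof (cases i)
  case (fields j k t)
  let ?b = "rotated_coeffs (M j) (\<beta> j) t"
  have "norm (frame_hat N M \<beta> h (j, k, t) \<xi>) \<le> 1 / (2 * pi * 2 powi j) * ((\<Sum>n\<in>{- int (N j)..int (N j)}. norm (?b n)) * H)" for \<xi>
  proof -
    have "norm (frame_hat N M \<beta> h (j, k, t) \<xi>) =
      1 / (2 * pi * 2 powi j) * norm (wavelet_amplitude (N j) ?b h ((1 / 2 powi j) *\<^sub>R \<xi>))"
      by (simp add: frame_hat_def norm_vector_scalar_mult norm_mult norm_divide norm_power_int)
    also have "\<dots> \<le> 1 / (2 * pi * 2 powi j) * ((\<Sum>n\<in>{- int (N j)..int (N j)}. norm (?b n)) * H)"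
      by (intro mult_left_mono wavelet_amplitude_bounded H) simp_all
    finally show ?thesis .
  qed
  then have "L2_norm_sq (frame_hat N M \<beta> h (j, k, t)) < \<infinity>"
    by (rule L2_norm_sq_bounded_support[where R="2 powi j * pi"]) (rule frame_hat_support[OF band])
  then show ?thesis unfolding fields square_integrable_iff using frame_hat_measurable[OF h] by blast
qed

text \<open>
  Pairing the two tangential fields pointwise gives a scalar function \<open>G\<close> supported in the disc of
  radius \<open>2\<^sup>j \<pi>\<close>, and the inner products with the frame functions are, up to a factor, the Fourier
  coefficients of \<open>G\<close> on the cube of side \<open>2 \<pi> 2\<^sup>j\<close>. This is where the radius \<open>\<pi>\<close> of the band limit enters:
  with a larger one, periodic copies of \<open>G\<close> would overlap.
\<close>

lemma frame_hat_parseval_translations: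
  assumes h [measurable]: "h \<in> borel_measurable borel" and H: "\<And>\<rho>. \<rho> \<ge> 0 \<Longrightarrow> norm (h \<rho>) \<le> H"
    and band: "\<And>\<rho>. \<rho> > pi \<Longrightarrow> h \<rho> = 0"
    and g: "square_integrable g" and tangential: "AE \<xi> in lborel. \<exists>c. g \<xi> = c *s e_theta \<xi>"
  shows "(\<integral>\<^sup>+k. ennreal ((norm (L2_inner g (frame_hat N M \<beta> h (j, k, t))))\<^sup>2) \<partial>count_space UNIV) =
    (\<integral>\<^sup>+\<xi>. ennreal ((norm (g \<xi>))\<^sup>2 *
      (norm (wavelet_amplitude (N j) (rotated_coeffs (M j) (\<beta> j) t) h ((1 / 2 powi j) *\<^sub>R \<xi>)))\<^sup>2) \<partial>lborel)"
proof -
  define s where "s = (2::real) powi j"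
  have s: "s > 0" by (simp add: s_def)
  define w where "w \<xi> = wavelet_amplitude (N j) (rotated_coeffs (M j) (\<beta> j) t) h ((1 / s) *\<^sub>R \<xi>)" for \<xi>
  have [measurable]: "w \<in> borel_measurable borel" unfolding w_def by measurable
  have [measurable]: "g \<in> borel_measurable borel" and g_fin: "L2_norm_sq g < \<infinity>"
    using g by (auto simp: square_integrable_iff)
  define G where "G \<xi> = (\<Sum>i\<in>UNIV. g \<xi> $ i * cnj ((w \<xi> *s e_theta \<xi>) $ i))" for \<xi>
  have [measurable]: "G \<in> borel_measurable borel" unfolding G_def by measurable
  obtain B where B: "\<And>\<xi>. norm (w \<xi>) \<le> B"
    unfolding w_def using wavelet_amplitude_bounded[of h H, OF H] by blast
  have norm_G: "AE \<xi> in lborel. (norm (G \<xi>))\<^sup>2 = (norm (g \<xi>))\<^sup>2 * (norm (w \<xi>))\<^sup>2"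
    using tangential
  proof eventually_elim
    case (elim \<xi>)
    then obtain c where "g \<xi> = c *s e_theta \<xi>" by blast
    then show ?case
      unfolding G_def by (simp only: inner_parallel) (simp add: norm_mult norm_vector_scalar_mult power_mult_distrib)
  qed
  have G_eq: "(\<integral>\<^sup>+\<xi>. ennreal ((norm (G \<xi>))\<^sup>2) \<partial>lborel) = (\<integral>\<^sup>+\<xi>. ennreal ((norm (g \<xi>))\<^sup>2 * (norm (w \<xi>))\<^sup>2) \<partial>lborel)"
    by (rule nn_integral_cong_AE, use norm_G in eventually_elim) simp
  have G_fin: "(\<integral>\<^sup>+\<xi>. ennreal ((norm (G \<xi>))\<^sup>2) \<partial>lborel) < \<infinity>"
  proof -
    have "(\<integral>\<^sup>+\<xi>. ennreal ((norm (g \<xi>))\<^sup>2 * (norm (w \<xi>))\<^sup>2) \<partial>lborel) \<le> (\<integral>\<^sup>+\<xi>. ennreal ((norm (g \<xi>))\<^sup>2) * ennreal (B\<^sup>2) \<partial>lborel)"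
      by (intro nn_integral_mono) (simp add: B mult_left_mono power_mono ennreal_leI flip: ennreal_mult)
    also have "\<dots> = L2_norm_sq g * ennreal (B\<^sup>2)" by (simp add: nn_integral_multc L2_norm_sq_def)
    also have "\<dots> < \<infinity>" using g_fin by (simp add: ennreal_mult_less_top)
    finally show ?thesis unfolding G_eq .
  qed
  have G_supp: "G \<xi> = 0" if "norm \<xi> > s * pi" for \<xi>
  proof -
    have "norm ((1 / s) *\<^sub>R \<xi>) > pi" using that s by (simp add: field_simps)
    then have "w \<xi> = 0" using band by (simp add: w_def wavelet_amplitude_def)
    then show ?thesis by (simp add: G_def)
  qed
  have inner: "L2_inner g (frame_hat N M \<beta> h (j, k, t)) =
    of_real (1 / (2 * pi * s)) * (\<integral>\<xi>. G \<xi> * character k ((1 / s) *\<^sub>R \<xi>) \<partial>lborel)" for k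
  proof -
    have "(\<Sum>i\<in>UNIV. g \<xi> $ i * cnj (frame_hat N M \<beta> h (j, k, t) \<xi> $ i)) =
      of_real (1 / (2 * pi * s)) * (G \<xi> * character k ((1 / s) *\<^sub>R \<xi>))" for \<xi>
      unfolding G_def frame_hat_def w_def s_def
      by (simp add: sum_distrib_left sum_distrib_right mult_ac)
    then show ?thesis
      unfolding L2_inner_def by (simp only: integral_mult_right_zero)
  qed
  have "(\<integral>\<^sup>+k. ennreal ((norm (L2_inner g (frame_hat N M \<beta> h (j, k, t))))\<^sup>2) \<partial>count_space UNIV) =
    (\<integral>\<^sup>+k. ennreal ((1 / (2 * pi * s))\<^sup>2) * ennreal ((norm (\<integral>\<xi>. G \<xi> * character k ((1 / s) *\<^sub>R \<xi>) \<partial>lborel))\<^sup>2) \<partial>count_space UNIV)"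
  proof (rule nn_integral_cong)
    fix k
    have "norm (complex_of_real (1 / (2 * pi * s))) = 1 / (2 * pi * s)"
      using s by (simp only: norm_of_real) simp
    then show "ennreal ((norm (L2_inner g (frame_hat N M \<beta> h (j, k, t))))\<^sup>2) =
      ennreal ((1 / (2 * pi * s))\<^sup>2) * ennreal ((norm (\<integral>\<xi>. G \<xi> * character k ((1 / s) *\<^sub>R \<xi>) \<partial>lborel))\<^sup>2)"
      unfolding inner by (simp only: norm_mult power_mult_distrib ennreal_mult zero_le_power2)
  qed
  also have "\<dots> = ennreal ((1 / (2 * pi * s))\<^sup>2) * (\<integral>\<^sup>+k. ennreal ((norm (\<integral>\<xi>. G \<xi> * character k ((1 / s) *\<^sub>R \<xi>) \<partial>lborel))\<^sup>2) \<partial>count_space UNIV)"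
    by (rule nn_integral_cmult) simp
  also have "\<dots> = ennreal ((1 / (2 * pi * s))\<^sup>2) * (ennreal ((2 * pi * s) ^ CARD(2)) * (\<integral>\<^sup>+\<xi>. ennreal ((norm (G \<xi>))\<^sup>2) \<partial>lborel))"
    using G_fin s G_supp by (subst parseval_scaled_conjugate) auto
  also have "\<dots> = (\<integral>\<^sup>+\<xi>. ennreal ((norm (G \<xi>))\<^sup>2) \<partial>lborel)"
  proof -
    have "(1 / (2 * pi * s))\<^sup>2 * (2 * pi * s) ^ CARD(2) = 1" using s by (simp add: power_divide)
    then have "ennreal ((1 / (2 * pi * s))\<^sup>2) * ennreal ((2 * pi * s) ^ CARD(2)) = 1"
      using ennreal_mult[of "(1 / (2 * pi * s))\<^sup>2" "(2 * pi * s) ^ CARD(2)"] s by simp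
    then show ?thesis unfolding mult.assoc[symmetric] by (simp only: mult_1)
  qed
  finally show ?thesis unfolding G_eq w_def s_def .
qed

lemma sum_wavelet_amplitude_square:
  assumes "mat_adjoint (orientation_matrix M N \<beta>) * orientation_matrix M N \<beta> = D"
    and "diagonal_mat D" "mat_trace D = 1"
  shows "(\<Sum>t\<in>{1..M}. (norm (wavelet_amplitude N (rotated_coeffs M \<beta> t) h \<xi>))\<^sup>2) = (norm (h (norm \<xi>)))\<^sup>2"
  using orientation_sum_eq_1[OF assms, of "polar_angle \<xi>"]
  by (simp add: wavelet_amplitude_def norm_mult power_mult_distrib sum_distrib_right[symmetric])

text \<open>
  The sum over the translations is an integral against the squared amplitude. Summing over
  the orientations replaces the amplitude by the radial window, and summing over the levels
  replaces the window by 1.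
\<close>

lemma frame_hat_parseval:
  assumes h [measurable]: "h \<in> borel_measurable borel" and H: "\<And>\<rho>. \<rho> \<ge> 0 \<Longrightarrow> norm (h \<rho>) \<le> H"
    and band: "\<And>\<rho>. \<rho> > pi \<Longrightarrow> h \<rho> = 0"
    and calderon: "\<And>\<xi> :: real^2. \<xi> \<noteq> 0 \<Longrightarrow>
      ((\<lambda>j :: int. (cmod (h (2 powi (- j) * norm \<xi>)))\<^sup>2) has_sum 1) UNIV"
    and U_D: "\<And>j. mat_adjoint (orientation_matrix (M j) (N j) (\<beta> j)) * orientation_matrix (M j) (N j) (\<beta> j) = D j"
    and D: "\<And>j. diagonal_mat (D j)" "\<And>j. mat_trace (D j) = 1"
    and g: "square_integrable g" and tangential: "AE \<xi> in lborel. \<exists>c. g \<xi> = c *s e_theta \<xi>"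
  shows "(\<integral>\<^sup>+i. ennreal ((norm (L2_inner g (frame_hat N M \<beta> h i)))\<^sup>2) \<partial>count_space {(j, k, t). 1 \<le> t \<and> t \<le> M j}) =
    L2_norm_sq g"
proof -
  let ?A = "{(j :: int, k :: int^2, t). 1 \<le> t \<and> t \<le> M j}"
  define c where "c i = ennreal ((norm (L2_inner g (frame_hat N M \<beta> h i)))\<^sup>2)" for i
  have [measurable]: "g \<in> borel_measurable borel" using g by (simp add: square_integrable_iff)
  have level: "(\<integral>\<^sup>+kt. c (j, kt) * indicator ?A (j, kt) \<partial>count_space UNIV) =
    (\<integral>\<^sup>+\<xi>. ennreal ((norm (g \<xi>))\<^sup>2) * ennreal ((norm (h (2 powi (- j) * norm \<xi>)))\<^sup>2) \<partial>lborel)" for j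
  proof -
    define a where "a t \<xi> = (norm (wavelet_amplitude (N j) (rotated_coeffs (M j) (\<beta> j) t) h ((1 / 2 powi j) *\<^sub>R \<xi>)))\<^sup>2" for t \<xi>
    have [measurable]: "a t \<in> borel_measurable borel" for t unfolding a_def by measurable
    have "(\<integral>\<^sup>+kt. c (j, kt) * indicator ?A (j, kt) \<partial>count_space UNIV) =
      (\<integral>\<^sup>+k. \<integral>\<^sup>+t. c (j, k, t) * indicator ?A (j, k, t) \<partial>count_space UNIV \<partial>count_space UNIV)"
      by (rule nn_integral_fst_count_space[symmetric])
    also have "\<dots> = (\<integral>\<^sup>+k. (\<Sum>t\<in>{1..M j}. c (j, k, t)) \<partial>count_space UNIV)"
    proof (rule nn_integral_cong)
      fix k :: "int^2"
      have "(\<integral>\<^sup>+t. c (j, k, t) * indicator ?A (j, k, t) \<partial>count_space UNIV) = (\<Sum>t\<in>{1..M j}. c (j, k, t) * indicator ?A (j, k, t))"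
        by (rule nn_integral_count_space') (auto simp: indicator_def)
      also have "\<dots> = (\<Sum>t\<in>{1..M j}. c (j, k, t))" by (intro sum.cong) auto
      finally show "(\<integral>\<^sup>+t. c (j, k, t) * indicator ?A (j, k, t) \<partial>count_space UNIV) = (\<Sum>t\<in>{1..M j}. c (j, k, t))" .
    qed
    also have "\<dots> = (\<Sum>t\<in>{1..M j}. \<integral>\<^sup>+k. c (j, k, t) \<partial>count_space UNIV)"
      by (rule nn_integral_sum) simp
    also have "\<dots> = (\<Sum>t\<in>{1..M j}. \<integral>\<^sup>+\<xi>. ennreal ((norm (g \<xi>))\<^sup>2 * a t \<xi>) \<partial>lborel)"
      unfolding c_def a_def
      by (intro sum.cong refl frame_hat_parseval_translations[OF h H band g tangential])
    also have "\<dots> = (\<integral>\<^sup>+\<xi>. (\<Sum>t\<in>{1..M j}. ennreal ((norm (g \<xi>))\<^sup>2 * a t \<xi>)) \<partial>lborel)"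
      by (rule nn_integral_sum[symmetric]) measurable
    also have "\<dots> = (\<integral>\<^sup>+\<xi>. ennreal ((norm (g \<xi>))\<^sup>2) * ennreal ((norm (h (2 powi (- j) * norm \<xi>)))\<^sup>2) \<partial>lborel)"
    proof (rule nn_integral_cong)
      fix \<xi> :: "real^2"
      have "(\<Sum>t\<in>{1..M j}. ennreal ((norm (g \<xi>))\<^sup>2 * a t \<xi>)) = ennreal (\<Sum>t\<in>{1..M j}. (norm (g \<xi>))\<^sup>2 * a t \<xi>)"
        by (rule sum_ennreal) (simp add: a_def)
      also have "(\<Sum>t\<in>{1..M j}. (norm (g \<xi>))\<^sup>2 * a t \<xi>) = (norm (g \<xi>))\<^sup>2 * (norm (h (norm ((1 / 2 powi j) *\<^sub>R \<xi>))))\<^sup>2"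
        unfolding a_def sum_distrib_left[symmetric] sum_wavelet_amplitude_square[OF U_D D] ..
      also have "norm ((1 / 2 powi j) *\<^sub>R \<xi>) = 2 powi (- j) * norm \<xi>"
        by (simp add: power_int_minus divide_simps)
      finally show "(\<Sum>t\<in>{1..M j}. ennreal ((norm (g \<xi>))\<^sup>2 * a t \<xi>)) =
        ennreal ((norm (g \<xi>))\<^sup>2) * ennreal ((norm (h (2 powi (- j) * norm \<xi>)))\<^sup>2)"
        by (simp only: ennreal_mult zero_le_power2)
    qed
    finally show ?thesis .
  qed
  have "(\<integral>\<^sup>+i. c i \<partial>count_space ?A) = (\<integral>\<^sup>+i. c i * indicator ?A i \<partial>count_space UNIV)"
    by (rule nn_integral_count_space_indicator) simp
  also have "\<dots> = (\<integral>\<^sup>+j. \<integral>\<^sup>+kt. c (j, kt) * indicator ?A (j, kt) \<partial>count_space UNIV \<partial>count_space UNIV)"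
    by (rule nn_integral_fst_count_space[symmetric])
  also have "\<dots> = (\<integral>\<^sup>+j. \<integral>\<^sup>+\<xi>. ennreal ((norm (g \<xi>))\<^sup>2) * ennreal ((norm (h (2 powi (- j) * norm \<xi>)))\<^sup>2) \<partial>lborel \<partial>count_space UNIV)"
    by (simp only: level)
  also have "\<dots> = (\<integral>\<^sup>+\<xi>. \<integral>\<^sup>+j. ennreal ((norm (g \<xi>))\<^sup>2) * ennreal ((norm (h (2 powi (- j) * norm \<xi>)))\<^sup>2) \<partial>count_space UNIV \<partial>lborel)"
    by (rule nn_integral_count_space_nn_integral[symmetric]) auto
  also have "\<dots> = L2_norm_sq g"
    unfolding L2_norm_sq_def
  proof (rule nn_integral_cong_AE)
    \<comment> \<open>the Calderon condition says nothing at the origin, which is a null set\<close>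
    have "AE \<xi> :: real^2 in lborel. \<xi> \<noteq> 0" by (rule AE_lborel_singleton)
    then show "AE \<xi> in lborel. (\<integral>\<^sup>+j. ennreal ((norm (g \<xi>))\<^sup>2) * ennreal ((norm (h (2 powi (- j) * norm \<xi>)))\<^sup>2) \<partial>count_space UNIV) =
      ennreal ((norm (g \<xi>))\<^sup>2)"
    proof eventually_elim
      case (elim \<xi>)
      have "(\<integral>\<^sup>+j. ennreal ((norm (h (2 powi (- j) * norm \<xi>)))\<^sup>2) \<partial>count_space UNIV) = ennreal 1"
        by (rule has_sum_imp_nn_integral_count_space[OF _ calderon[OF elim]]) simp
      then show ?case by (simp add: nn_integral_cmult)
    qed
  qed
  finally show ?thesis unfolding c_def .
qed

section \<open>Reconstruction from a Parseval identity\<close>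

lemma square_integrable_sum:
  assumes "finite F" "\<And>i. i \<in> F \<Longrightarrow> square_integrable (v i)"
  shows "square_integrable (\<lambda>x. \<Sum>i\<in>F. c i *s v i x)"
  using assms
proof (induction F rule: finite_induct)
  case empty
  show ?case by (simp add: square_integrable_def)
next
  case (insert i F)
  define s where "s = (\<lambda>x. \<Sum>i\<in>F. c i *s v i x)"
  have v: "square_integrable (v i)" and s: "square_integrable s" using insert by (auto simp: s_def)
  then have [measurable]: "v i \<in> borel_measurable borel" "s \<in> borel_measurable borel"
    by (auto simp: square_integrable_def)
  have "integrable lborel (\<lambda>x. 2 * ((norm (c i))\<^sup>2 * (norm (v i x))\<^sup>2) + 2 * (norm (s x))\<^sup>2)"
    using v s by (simp add: square_integrable_def)
  then have "integrable lborel (\<lambda>x. (norm (c i *s v i x + s x))\<^sup>2)"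
  proof (rule Bochner_Integration.integrable_bound)
    show "(\<lambda>x. (norm (c i *s v i x + s x))\<^sup>2) \<in> borel_measurable lborel" by measurable
    show "AE x in lborel. norm ((norm (c i *s v i x + s x))\<^sup>2) \<le> norm (2 * ((norm (c i))\<^sup>2 * (norm (v i x))\<^sup>2) + 2 * (norm (s x))\<^sup>2)"
    proof (rule AE_I2)
      fix x
      have "norm (c i *s v i x) = norm (c i) * norm (v i x)" by (rule norm_vector_scalar_mult)
      then show "norm ((norm (c i *s v i x + s x))\<^sup>2) \<le> norm (2 * ((norm (c i))\<^sup>2 * (norm (v i x))\<^sup>2) + 2 * (norm (s x))\<^sup>2)"
        using norm_add_square_le[of "c i *s v i x" "s x"] by (simp only: power_mult_distrib) simp
    qed
  qed
  moreover have "(\<lambda>x. c i *s v i x + s x) \<in> borel_measurable lborel" by measurable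
  moreover have "(\<lambda>x. \<Sum>i\<in>insert i F. c i *s v i x) = (\<lambda>x. c i *s v i x + s x)"
    using insert.hyps by (simp add: s_def)
  ultimately show ?case by (simp only: square_integrable_def)
qed

lemma L2_inner_sum_right:
  assumes F: "finite F" and u: "square_integrable u" and v: "\<And>i. i \<in> F \<Longrightarrow> square_integrable (v i)"
  shows "L2_inner u (\<lambda>x. \<Sum>i\<in>F. c i *s v i x) = (\<Sum>i\<in>F. cnj (c i) * L2_inner u (v i))"
proof -
  have "(\<Sum>l\<in>UNIV. u x $ l * cnj ((\<Sum>i\<in>F. c i *s v i x) $ l)) =
    (\<Sum>i\<in>F. cnj (c i) * (\<Sum>l\<in>UNIV. u x $ l * cnj (v i x $ l)))" for x
  proof -
    have "(\<Sum>l\<in>UNIV. u x $ l * cnj ((\<Sum>i\<in>F. c i *s v i x) $ l)) =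
      (\<Sum>l\<in>UNIV. \<Sum>i\<in>F. cnj (c i) * (u x $ l * cnj (v i x $ l)))"
      by (simp only: sum_component vector_smult_component cnj_sum complex_cnj_mult sum_distrib_left mult_ac)
    also have "\<dots> = (\<Sum>i\<in>F. \<Sum>l\<in>UNIV. cnj (c i) * (u x $ l * cnj (v i x $ l)))" by (rule sum.swap)
    finally show ?thesis by (simp only: sum_distrib_left)
  qed
  then have "L2_inner u (\<lambda>x. \<Sum>i\<in>F. c i *s v i x) =
    (\<integral>x. (\<Sum>i\<in>F. cnj (c i) * (\<Sum>l\<in>UNIV. u x $ l * cnj (v i x $ l))) \<partial>lborel)"
    unfolding L2_inner_def by (simp only:)
  also have "\<dots> = (\<Sum>i\<in>F. \<integral>x. cnj (c i) * (\<Sum>l\<in>UNIV. u x $ l * cnj (v i x $ l)) \<partial>lborel)"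
    by (rule Bochner_Integration.integral_sum) (intro integrable_mult_right integrable_L2_inner u v)
  also have "\<dots> = (\<Sum>i\<in>F. cnj (c i) * L2_inner u (v i))"
    unfolding L2_inner_def by (simp only: integral_mult_right_zero)
  finally show ?thesis .
qed

lemma L2_norm_sq_eq_integral:
  "square_integrable u \<Longrightarrow> L2_norm_sq u = ennreal (\<integral>x. (norm (u x))\<^sup>2 \<partial>lborel)"
  unfolding L2_norm_sq_def square_integrable_def by (intro nn_integral_eq_integral) auto

lemma L2_inner_self: "L2_inner u u = complex_of_real (\<integral>x. (norm (u x))\<^sup>2 \<partial>lborel)"
  unfolding L2_inner_def norm_vec_square complex_norm_square[symmetric] of_real_sum[symmetric]
  by (rule integral_complex_of_real)

lemma integral_norm_diff_square:
  assumes u: "square_integrable u" and v: "square_integrable v"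
  shows "(\<integral>x. (norm (u x - v x))\<^sup>2 \<partial>lborel) =
    (\<integral>x. (norm (u x))\<^sup>2 \<partial>lborel) - 2 * Re (L2_inner u v) + (\<integral>x. (norm (v x))\<^sup>2 \<partial>lborel)"
proof -
  define p where "p = (\<lambda>x. \<Sum>i\<in>UNIV. u x $ i * cnj (v x $ i))"
  have p: "integrable lborel p" using integrable_L2_inner[OF u v] by (simp only: p_def)
  have "(norm (u x - v x))\<^sup>2 = (norm (u x))\<^sup>2 - 2 * Re (p x) + (norm (v x))\<^sup>2" for x
  proof -
    have "(norm (u x - v x))\<^sup>2 =
      (\<Sum>i\<in>UNIV. (norm (u x $ i))\<^sup>2 - 2 * Re (u x $ i * cnj (v x $ i)) + Re (v x $ i * cnj (v x $ i)))"
      unfolding norm_vec_square vector_minus_component norm_diff_square_complex ..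
    also have "\<dots> = (norm (u x))\<^sup>2 - 2 * Re (p x) + (norm (v x))\<^sup>2"
      unfolding norm_vec_square p_def complex_norm_square[symmetric] Re_complex_of_real
      by (simp only: sum.distrib sum_subtractf sum_distrib_left Re_sum)
    finally show ?thesis .
  qed
  then show ?thesis
    unfolding L2_inner_def p_def[symmetric] using u v p by (simp add: square_integrable_def)
qed

lemma inverse_fourier_integral_sum:
  assumes F: "finite F" and G: "\<And>i l. i \<in> F \<Longrightarrow> integrable lborel (\<lambda>\<xi>. G i \<xi> $ l)"
  shows "inverse_fourier_integral (\<lambda>\<xi>. \<Sum>i\<in>F. c i *s G i \<xi>) x = (\<Sum>i\<in>F. c i *s inverse_fourier_integral (G i) x)"
proof (rule vec_eq_iff[THEN iffD2], rule allI)
  fix l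
  have int: "integrable lborel (\<lambda>\<xi>. G i \<xi> $ l * cis (x \<bullet> \<xi>))" if "i \<in> F" for i
  proof (rule Bochner_Integration.integrable_bound[OF G[OF that, of l]])
    have [measurable]: "(\<lambda>\<xi>. G i \<xi> $ l) \<in> borel_measurable borel" using G[OF that, of l] by auto
    show "(\<lambda>\<xi>. G i \<xi> $ l * cis (x \<bullet> \<xi>)) \<in> borel_measurable lborel" by measurable
  qed (simp add: norm_mult)
  have "(\<integral>\<xi>. (\<Sum>i\<in>F. c i *s G i \<xi>) $ l * cis (x \<bullet> \<xi>) \<partial>lborel) =
    (\<integral>\<xi>. (\<Sum>i\<in>F. c i * (G i \<xi> $ l * cis (x \<bullet> \<xi>))) \<partial>lborel)"
    by (simp only: sum_component vector_smult_component sum_distrib_right mult.assoc)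
  also have "\<dots> = (\<Sum>i\<in>F. c i * (\<integral>\<xi>. G i \<xi> $ l * cis (x \<bullet> \<xi>) \<partial>lborel))"
    using int by (subst Bochner_Integration.integral_sum) (auto simp only: integrable_mult_right integral_mult_right_zero)
  finally show "inverse_fourier_integral (\<lambda>\<xi>. \<Sum>i\<in>F. c i *s G i \<xi>) x $ l = (\<Sum>i\<in>F. c i *s inverse_fourier_integral (G i) x) $ l"
    unfolding inverse_fourier_integral_def sum_component vector_smult_component vec_lambda_beta
    by (simp only: sum_distrib_left mult.left_commute)
qed

text \<open>
  The dual form of Bessel's inequality. Pairing \<open>w\<close> with itself and expanding one side gives
  \<open>\<parallel>w\<parallel>\<^sup>2 = Re (\<Sum>i\<in>F. cnj (c i) * d i)\<close> with the coefficients \<open>d i\<close> of \<open>w\<close>. The arithmetic-geometric mean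
  inequality bounds this by half the sum of all \<open>\<bar>c i\<bar>\<^sup>2\<close> and \<open>\<bar>d i\<bar>\<^sup>2\<close>, and the latter contribute at most \<open>\<parallel>w\<parallel>\<^sup>2\<close>.
\<close>

lemma bessel_synthesis:
  assumes F: "finite F" and w: "square_integrable w" and v: "\<And>i. i \<in> F \<Longrightarrow> square_integrable (v i)"
    and w_eq: "w = (\<lambda>x. \<Sum>i\<in>F. c i *s v i x)"
    and bessel: "(\<Sum>i\<in>F. (norm (L2_inner w (v i)))\<^sup>2) \<le> (\<integral>x. (norm (w x))\<^sup>2 \<partial>lborel)"
  shows "(\<integral>x. (norm (w x))\<^sup>2 \<partial>lborel) \<le> (\<Sum>i\<in>F. (norm (c i))\<^sup>2)"
proof -
  let ?W = "\<integral>x. (norm (w x))\<^sup>2 \<partial>lborel"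
  have "complex_of_real ?W = L2_inner w (\<lambda>x. \<Sum>i\<in>F. c i *s v i x)"
    using L2_inner_self[of w] w_eq by simp
  also have "\<dots> = (\<Sum>i\<in>F. cnj (c i) * L2_inner w (v i))"
    by (rule L2_inner_sum_right[OF F w v])
  finally have "?W = Re (\<Sum>i\<in>F. cnj (c i) * L2_inner w (v i))"
    by (metis Re_complex_of_real)
  also have "\<dots> = (\<Sum>i\<in>F. Re (cnj (c i) * L2_inner w (v i)))" by (rule Re_sum)
  also have "\<dots> \<le> (\<Sum>i\<in>F. ((norm (c i))\<^sup>2 + (norm (L2_inner w (v i)))\<^sup>2) / 2)"
  proof (rule sum_mono)
    fix i
    have "Re (cnj (c i) * L2_inner w (v i)) \<le> norm (c i) * norm (L2_inner w (v i))"
      using complex_Re_le_cmod[of "cnj (c i) * L2_inner w (v i)"] by (simp only: norm_mult complex_mod_cnj)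
    also have "\<dots> \<le> ((norm (c i))\<^sup>2 + (norm (L2_inner w (v i)))\<^sup>2) / 2"
      using sum_squares_bound[of "norm (c i)" "norm (L2_inner w (v i))"] by simp
    finally show "Re (cnj (c i) * L2_inner w (v i)) \<le> ((norm (c i))\<^sup>2 + (norm (L2_inner w (v i)))\<^sup>2) / 2" .
  qed
  also have "\<dots> = ((\<Sum>i\<in>F. (norm (c i))\<^sup>2) + (\<Sum>i\<in>F. (norm (L2_inner w (v i)))\<^sup>2)) / 2"
    by (simp only: sum.distrib sum_divide_distrib[symmetric])
  also have "\<dots> \<le> ((\<Sum>i\<in>F. (norm (c i))\<^sup>2) + ?W) / 2" using bessel by simp
  finally show ?thesis by simp
qed

text \<open>
  Each term of the Calderon sum is at most 1, in particular the one for level 0. The condition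
  leaves the value at radius 0 open.
\<close>

lemma calderon_window_bounded:
  assumes calderon: "\<And>\<xi> :: real^2. \<xi> \<noteq> 0 \<Longrightarrow>
      ((\<lambda>j :: int. (cmod (h (2 powi (- j) * norm \<xi>)))\<^sup>2) has_sum 1) UNIV"
    and "\<rho> \<ge> 0"
  shows "norm (h \<rho>) \<le> max 1 (norm (h 0))"
proof (cases "\<rho> = 0")
  case False
  define \<xi> :: "real^2" where "\<xi> = \<rho> *\<^sub>R axis 1 1"
  have \<xi>: "norm \<xi> = \<rho>" "\<xi> \<noteq> 0" using False \<open>\<rho> \<ge> 0\<close> by (auto simp: \<xi>_def norm_axis_1 axis_eq_0_iff)
  have "(\<Sum>j\<in>{0 :: int}. (cmod (h (2 powi (- j) * norm \<xi>)))\<^sup>2) \<le> 1"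
    by (rule finite_sum_le_has_sum[OF calderon[OF \<xi>(2)]]) auto
  then show ?thesis using \<xi> by (simp add: abs_square_le_1)
qed simp

text \<open>
  For a finite part \<open>F\<close> of the frame, let \<open>v\<close> be the partial sum and \<open>S\<close> the sum of the \<open>\<bar>c i\<bar>\<^sup>2\<close> over \<open>F\<close>. Then
  \<open>\<parallel>u - v\<parallel>\<^sup>2 = \<parallel>u\<parallel>\<^sup>2 - 2 S + \<parallel>v\<parallel>\<^sup>2 \<le> \<parallel>u\<parallel>\<^sup>2 - S\<close>, and \<open>S\<close> tends to the squared norm of the transform of \<open>u\<close>, which
  dominates that of \<open>u\<close>.
\<close>

theorem proposition1:
  fixes N M :: "int \<Rightarrow> nat"
    and \<beta> :: "int \<Rightarrow> int \<Rightarrow> complex"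
    and D :: "int \<Rightarrow> complex Matrix.mat"
    and h :: "real \<Rightarrow> complex"
    and u :: "real^2 \<Rightarrow> complex^2"
  assumes M_ge_1: "\<And>j. M j \<ge> 1"
    and h_measurable: "h \<in> borel_measurable borel"
    and h_bandlimited: "\<And>\<rho>. \<rho> > pi \<Longrightarrow> h \<rho> = 0"
    and calderon: "\<And>\<xi> :: real^2. \<xi> \<noteq> 0 \<Longrightarrow>
      ((\<lambda>j :: int. (cmod (h (2 powi (- j) * norm \<xi>)))\<^sup>2) has_sum 1) UNIV"
    and D_dim: "\<And>j. D j \<in> carrier_mat (2 * N j + 1) (2 * N j + 1)"
    and D_diagonal: "\<And>j. diagonal_mat (D j)"
    and U_D: "\<And>j. mat_adjoint (orientation_matrix (M j) (N j) (\<beta> j))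
      * orientation_matrix (M j) (N j) (\<beta> j) = D j"
    and D_trace: "\<And>j. mat_trace (D j) = 1"
    and u: "L2_div_free u"
  shows "L2_has_sum
    (\<lambda>i x. L2_inner u (frame_function N M \<beta> h i) *s frame_function N M \<beta> h i x)
    u {(j, k, t). 1 \<le> t \<and> t \<le> M j}"
proof -
  let ?A = "{(j, k, t). 1 \<le> t \<and> t \<le> M j} :: (int \<times> (int^2) \<times> nat) set"
  define \<psi> where "\<psi> = frame_function N M \<beta> h"
  define \<Psi> where "\<Psi> = frame_hat N M \<beta> h"
  have \<psi>_eq: "\<psi> i = inverse_fourier_integral (\<Psi> i)" for i
    by (simp add: \<psi>_def \<Psi>_def frame_function_eq_inverse_fourier)
  have bound: "\<rho> \<ge> 0 \<Longrightarrow> norm (h \<rho>) \<le> max 1 (norm (h 0))" for \<rho>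
    by (rule calderon_window_bounded[OF calderon])
  have \<Psi>_sq: "square_integrable (\<Psi> i)" for i
    unfolding \<Psi>_def by (rule frame_hat_square_integrable[OF h_measurable bound h_bandlimited])
  then have \<Psi>_meas [measurable]: "\<Psi> i \<in> borel_measurable borel" and \<Psi>_fin: "L2_norm_sq (\<Psi> i) < \<infinity>" for i
    by (simp_all add: square_integrable_iff)
  \<comment> \<open>the frame function of index \<open>i\<close> is supported in frequency in the disc of radius \<open>r i\<close>\<close>
  define r where "r i = 2 powi (fst i) * pi" for i :: "int \<times> (int^2) \<times> nat"
  have r_pos: "r i \<ge> 0" for i by (simp add: r_def)
  have \<Psi>_supp: "\<Psi> i \<xi> = 0" if "norm \<xi> > r i" for i \<xi>
    using frame_hat_support[OF h_bandlimited] that unfolding \<Psi>_def r_def by (cases i) auto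
  have "\<exists>d. \<Psi> i \<xi> = d *s e_theta \<xi>" for i \<xi>
    unfolding \<Psi>_def frame_hat_def by (cases i) auto
  then obtain \<alpha> where \<alpha>: "\<And>i \<xi>. \<Psi> i \<xi> = \<alpha> i \<xi> *s e_theta \<xi>" by metis
  have \<psi>_sq: "square_integrable (\<psi> i)" for i
    using L2_norm_sq_inverse_fourier_integral[OF \<Psi>_meas \<Psi>_fin \<Psi>_supp] \<Psi>_fin
    by (simp add: square_integrable_iff \<psi>_eq)
  have parseval: "((\<lambda>i. (norm (L2_inner g (\<Psi> i)))\<^sup>2) has_sum (\<integral>\<xi>. (norm (g \<xi>))\<^sup>2 \<partial>lborel)) ?A"
    if g: "square_integrable g" and tan: "AE \<xi> in lborel. \<exists>c. g \<xi> = c *s e_theta \<xi>" for g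
    using frame_hat_parseval[OF h_measurable bound h_bandlimited calderon U_D D_diagonal D_trace g tan]
    unfolding \<Psi>_def L2_norm_sq_eq_integral[OF g]
    by (intro nn_integral_count_space_imp_has_sum) auto

  obtain g where ft: "has_fourier_transform u g" and g_tan: "AE \<xi> in lborel. \<exists>c. g \<xi> = c *s e_theta \<xi>"
    using u by (auto simp: L2_div_free_def)
  have u_sq: "square_integrable u" and g_sq: "square_integrable g"
    using ft by (auto simp: has_fourier_transform_def)
  define c where "c i = L2_inner u (\<psi> i)" for i
  have c_eq: "c i = L2_inner g (\<Psi> i)" for i
    unfolding c_def \<psi>_eq by (rule L2_inner_fourier_transform[OF ft \<Psi>_meas \<Psi>_fin \<Psi>_supp])
  define T where "T = (\<integral>\<xi>. (norm (g \<xi>))\<^sup>2 \<partial>lborel)"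
  have sum_c: "((\<lambda>i. (norm (c i))\<^sup>2) has_sum T) ?A"
    unfolding c_eq T_def by (rule parseval[OF g_sq g_tan])
  have u_le: "(\<integral>x. (norm (u x))\<^sup>2 \<partial>lborel) \<le> T"
    using L2_norm_sq_le_fourier_transform[OF ft]
    unfolding L2_norm_sq_eq_integral[OF u_sq] L2_norm_sq_eq_integral[OF g_sq] T_def
    by (subst (asm) ennreal_le_iff) auto

  have error: "L2_dist_sq u (\<lambda>x. \<Sum>i\<in>F. c i *s \<psi> i x) \<le> ennreal (T - (\<Sum>i\<in>F. (norm (c i))\<^sup>2))"
    if F: "finite F" "F \<subseteq> ?A" for F
  proof -
    define v where "v = (\<lambda>x. \<Sum>i\<in>F. c i *s \<psi> i x)"
    define w where "w = (\<lambda>\<xi>. \<Sum>i\<in>F. c i *s \<Psi> i \<xi>)"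
    have v_sq: "square_integrable v" unfolding v_def by (rule square_integrable_sum[OF F(1) \<psi>_sq])
    have w_sq: "square_integrable w" unfolding w_def by (rule square_integrable_sum[OF F(1) \<Psi>_sq])
    have w_supp: "w \<xi> = 0" if "norm \<xi> > (\<Sum>i\<in>F. r i)" for \<xi>
      unfolding w_def
    proof (rule sum.neutral, rule ballI)
      fix i assume "i \<in> F"
      then have "r i \<le> (\<Sum>i\<in>F. r i)" using F(1) r_pos by (intro member_le_sum) auto
      then show "c i *s \<Psi> i \<xi> = 0" using that \<Psi>_supp by simp
    qed
    have "v = inverse_fourier_integral w"
      unfolding v_def w_def \<psi>_eq
    proof (rule ext, rule inverse_fourier_integral_sum[OF F(1), symmetric])
      show "integrable lborel (\<lambda>\<xi>. \<Psi> i \<xi> $ l)" for i l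
        using \<Psi>_supp le_less_trans[OF L2_norm_sq_component_le \<Psi>_fin]
        by (intro compact_support_integrable[where R="r i"]) auto
    qed
    then have "L2_norm_sq v = L2_norm_sq w"
      using w_sq w_supp L2_norm_sq_inverse_fourier_integral[of w "\<Sum>i\<in>F. r i"] by (simp add: square_integrable_iff)
    then have v_w: "(\<integral>x. (norm (v x))\<^sup>2 \<partial>lborel) = (\<integral>x. (norm (w x))\<^sup>2 \<partial>lborel)"
      unfolding L2_norm_sq_eq_integral[OF v_sq] L2_norm_sq_eq_integral[OF w_sq]
      by (subst (asm) ennreal_inj) auto
    have "w \<xi> = (\<Sum>i\<in>F. c i * \<alpha> i \<xi>) *s e_theta \<xi>" for \<xi>
      by (simp add: w_def \<alpha> vec_eq_iff sum_distrib_right mult.assoc)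
    \<comment> \<open>partial sums are divergence free again, so the Parseval identity applies to them\<close>
    then have w_tan: "AE \<xi> in lborel. \<exists>c. w \<xi> = c *s e_theta \<xi>" by blast
    have "(\<integral>x. (norm (w x))\<^sup>2 \<partial>lborel) \<le> (\<Sum>i\<in>F. (norm (c i))\<^sup>2)"
      by (rule bessel_synthesis[OF F(1) w_sq \<Psi>_sq w_def])
        (rule finite_sum_le_has_sum[OF parseval[OF w_sq w_tan] F], simp)
    moreover have "Re (L2_inner u v) = (\<Sum>i\<in>F. (norm (c i))\<^sup>2)"
    proof -
      have "L2_inner u v = (\<Sum>i\<in>F. cnj (c i) * c i)"
        unfolding v_def L2_inner_sum_right[OF F(1) u_sq \<psi>_sq] c_def ..
      also have "\<dots> = complex_of_real (\<Sum>i\<in>F. (norm (c i))\<^sup>2)"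
        by (simp only: of_real_sum complex_norm_square mult.commute)
      finally show ?thesis by (simp only: Re_complex_of_real)
    qed
    ultimately have "(\<integral>x. (norm (u x - v x))\<^sup>2 \<partial>lborel) \<le> T - (\<Sum>i\<in>F. (norm (c i))\<^sup>2)"
      using u_le unfolding integral_norm_diff_square[OF u_sq v_sq] v_w by linarith
    moreover have "L2_dist_sq u v = ennreal (\<integral>x. (norm (u x - v x))\<^sup>2 \<partial>lborel)"
    proof -
      \<comment> \<open>the difference as a linear combination with two terms\<close>
      have "square_integrable (\<lambda>x. \<Sum>b\<in>{True, False}. (if b then 1 else -1) *s (if b then u else v) x)"
        by (rule square_integrable_sum) (auto simp: u_sq v_sq)
      then have "square_integrable (\<lambda>x. u x - v x)" by (simp add: vector_smult_lneg)
      from L2_norm_sq_eq_integral[OF this] show ?thesis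
        by (simp add: L2_dist_sq_def L2_norm_sq_def)
    qed
    ultimately show ?thesis unfolding v_def by (simp add: ennreal_leI)
  qed

  have "((\<lambda>F. ennreal (T - (\<Sum>i\<in>F. (norm (c i))\<^sup>2))) \<longlongrightarrow> ennreal (T - T)) (finite_subsets_at_top ?A)"
    using sum_c unfolding has_sum_def by (intro tendsto_ennrealI tendsto_intros)
  then have upper: "((\<lambda>F. ennreal (T - (\<Sum>i\<in>F. (norm (c i))\<^sup>2))) \<longlongrightarrow> 0) (finite_subsets_at_top ?A)"
    by (simp only: diff_self ennreal_0)
  have "((\<lambda>F. L2_dist_sq u (\<lambda>x. \<Sum>i\<in>F. c i *s \<psi> i x)) \<longlongrightarrow> 0) (finite_subsets_at_top ?A)"
  proof (rule tendsto_sandwich[OF _ _ tendsto_const upper])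
    show "\<forall>\<^sub>F F in finite_subsets_at_top ?A. 0 \<le> L2_dist_sq u (\<lambda>x. \<Sum>i\<in>F. c i *s \<psi> i x)"
      by simp
    show "\<forall>\<^sub>F F in finite_subsets_at_top ?A. L2_dist_sq u (\<lambda>x. \<Sum>i\<in>F. c i *s \<psi> i x) \<le> ennreal (T - (\<Sum>i\<in>F. (norm (c i))\<^sup>2))"
      by (rule eventually_finite_subsets_at_top_weakI) (rule error)
  qed
  then show ?thesis unfolding L2_has_sum_def c_def \<psi>_def .
qed

end
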